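(* For each $d\in\mathbb{Z}^+$ there are constants $c_2=c_2(d)>0$ and $c_3=c_3(d)>0$ with the following property. Let $A\subseteq\mathbb{R}^2$ be finite with $|A|>c_2$. If $A$ is not contained in any curve of degree $d$, then \[ \left|\mathcal{O}_{d,\frac{3d^2-3d+4}{2}}(A)\right|\geq c_3|A|^{d}. \]
   Context: A curve of degree $d$ is a subset of $\mathbb{R}^2$ equal to the zero set of a polynomial in $\mathbb{R}[x,y]$ of degree exactly $d$; $\mathcal{C}_d$ denotes the family of curves of degree $d$. For $A\subseteq\mathbb{R}^2$, a curve $C_1\in\mathcal{C}_d$ is determined by $A$ if for every $C_2\in\mathcal{C}_d$ with $C_2\cap A\supseteq C_1\cap A$ we have $C_1=C_2$; $\mathcal{D}_d(A)$ is the family of curves of degree $d$ determined by $A$. For $n\in\mathbb{R}$, $\mathcal{O}_{d,n}(A):=\{C\in\mathcal{D}_d(A): |C\cap A|\le n\}$. *)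

theory Defs
  imports "HOL-Analysis.Analysis"
begin

text \<open>Bivariate real polynomials are represented by coefficient functions
  c :: nat \<Rightarrow> nat \<Rightarrow> real, where c i j is the coefficient of x^i y^j.
  c has degree exactly d iff all coefficients with i + j > d vanish and
  some coefficient with i + j = d is nonzero.\<close>

definition poly2_deg :: "nat \<Rightarrow> (nat \<Rightarrow> nat \<Rightarrow> real) \<Rightarrow> bool" where
  "poly2_deg d c \<longleftrightarrow> (\<forall>i j. d < i + j \<longrightarrow> c i j = 0) \<and> (\<exists>i j. i + j = d \<and> c i j \<noteq> 0)"

definition poly2_eval :: "nat \<Rightarrow> (nat \<Rightarrow> nat \<Rightarrow> real) \<Rightarrow> real \<times> real \<Rightarrow> real" where
  "poly2_eval d c p = (\<Sum>i\<le>d. \<Sum>j\<le>d. c i j * fst p ^ i * snd p ^ j)"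

definition curves :: "nat \<Rightarrow> (real \<times> real) set set" where
  "curves d = {{p. poly2_eval d c p = 0} | c. poly2_deg d c}"

definition determined_curves :: "nat \<Rightarrow> (real \<times> real) set \<Rightarrow> (real \<times> real) set set" where
  "determined_curves d A = {C1 \<in> curves d. \<forall>C2 \<in> curves d. C1 \<inter> A \<subseteq> C2 \<inter> A \<longrightarrow> C1 = C2}"

definition O_curves :: "nat \<Rightarrow> real \<Rightarrow> (real \<times> real) set \<Rightarrow> (real \<times> real) set set" where
  "O_curves d n A = {C \<in> determined_curves d A. real (card (C \<inter> A)) \<le> n}"

end

theory Submission
  imports Defs "HOL-Computational_Algebra.Polynomial_Factorial" "HOL-Computational_Algebra.Field_as_Ring"
begin

text \<open>
  Let \<open>B \<subseteq> A\<close> consist of \<open>(d + 1)(d + 2) / 2 - 3\<close> points that impose independent conditions on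
  curves of degree \<open>d\<close>. The curves through \<open>B\<close> form a net, which maps the plane to a projective
  plane and turns these curves into lines. A line containing exactly two points of the image of
  \<open>A\<close> is a determined curve. If no two curves of the net share a component, Bezout bounds each
  fibre, with \<open>B\<close> added, by \<open>d\<^sup>2\<close>, so that this curve contains at most
  \<open>2 d\<^sup>2 - |B| = (3 d\<^sup>2 - 3 d + 4) / 2\<close> points of \<open>A\<close>. The argument of Kelly and Moser with triangular
  faces of the dual arrangement produces linearly many such lines avoiding one prescribed
  point, provided that the others are not collinear. As a determined curve with few points arises
  from boundedly many \<open>B\<close>, it suffices to find \<open>c |A|\<^sup>d\<^sup>-\<^sup>1\<close> sets \<open>B\<close>.

  If almost all of \<open>A\<close> lies on a line, one instead takes the curves through \<open>d\<close> points of that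
  line and a fixed basis for degree \<open>d - 1\<close> off it. Otherwise, for \<open>d \<ge> 3\<close>, a positive
  proportion of \<open>A\<close> lies on an irreducible curve of degree at least 2, or on each of two lines, or
  no curve is that rich; a fixed basis off the curve together with generic points on it gives
  \<open>B\<close>, and Hilbert functions exclude common components. For \<open>d = 2\<close> the set \<open>B\<close> is a triangle
  and conics of the net share its sides; the only large fibres are the sides, and a
  determined conic of excessive size contains a line with few points through a vertex. Either
  there are few such lines, or two sides of \<open>B\<close> are chosen among them and the prescribed point
  to be avoided is the image of the third side.
\<close>

section \<open>Bivariate polynomials and Hilbert functions\<close>

text \<open>Everything rests on dimension counts in the spaces \<open>Van t S\<close> of polynomials
  of degree at most \<open>t\<close> vanishing on \<open>S\<close>; Bezout's bound is itself derived
  that way. The delicate point is a common factor of degree u, with cofactors of degree v and u + v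
  = d, inside a net. Counting conditions on both factors separately leads to a contradiction only
  because pd d exceeds pd u + pd v by u v - 1. This surplus is positive for d >= 3 but zero for u =
  v = 1: nets of conics through a triangle really do contain pencils sharing a side, and they need
  another argument. The same count wants the Hilbert function of the fixed points to gain at least 2
  when the degree rises by the degree of the curve that carries the generic points. For a single
  line only a gain of 1 is guaranteed, so lines occur in pairs, and a set close to one line is
  treated directly. There only d points are free, whereas the choices for d >= 3 leave at least 2 d
  - 2 free points, so the near-line case is the one that matches the exponent d.\<close>

type_synonym bipoly = "real poly poly"

text \<open>\<open>smult\<close> on \<open>bipoly\<close> scales by elements of
  \<open>real poly\<close>; dimensions are to be taken over the reals, so the scalars are restricted
  to constants.\<close>

definition cmul :: "real \<Rightarrow> bipoly \<Rightarrow> bipoly" where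
  "cmul r f = smult [:r:] f"

interpretation pv: vector_space cmul
proof
  fix a b :: real and x :: bipoly
  have "[:a + b:] = [:a:] + [:b:]" by simp
  then show "cmul (a + b) x = cmul a x + cmul b x" by (simp only: cmul_def smult_add_left)
qed (simp_all add: cmul_def smult_add_right mult.commute flip: one_pCons)

section \<open>Linear algebra in finite-dimensional spaces of polynomials\<close>

definition fin_dim :: "bipoly set \<Rightarrow> bool" where
  "fin_dim U \<longleftrightarrow> (\<exists>F. finite F \<and> U \<subseteq> pv.span F)"

lemma fin_dim_subset: "fin_dim V \<Longrightarrow> U \<subseteq> V \<Longrightarrow> fin_dim U"
  unfolding fin_dim_def by blast

lemma fin_dim_basis:
  assumes "fin_dim U"
  obtains B where "finite B" "B \<subseteq> U" "pv.independent B" "U \<subseteq> pv.span B" "card B = pv.dim U"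
proof -
  obtain F where F: "finite F" "U \<subseteq> pv.span F" using assms fin_dim_def by auto
  obtain B where B: "B \<subseteq> U" "pv.independent B" "U \<subseteq> pv.span B" "card B = pv.dim U"
    using pv.basis_exists by blast
  then have "finite B" using pv.independent_span_bound[OF F(1) B(2)] F(2) by auto
  with B that show thesis by blast
qed

lemma independent_card_le:
  assumes "fin_dim V" "pv.independent B" "B \<subseteq> V"
  shows "finite B" "card B \<le> pv.dim V"
proof -
  obtain C where C: "finite C" "V \<subseteq> pv.span C" "card C = pv.dim V"
    using fin_dim_basis[OF assms(1)] by metis
  have "finite B \<and> card B \<le> card C"
    using pv.independent_span_bound[OF C(1) assms(2)] assms(3) C(2) by auto
  then show "finite B" "card B \<le> pv.dim V" using C by auto
qed

lemma fin_dim_mono: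
  assumes "fin_dim V" "U \<subseteq> V"
  shows "pv.dim U \<le> pv.dim V"
  using fin_dim_basis[OF fin_dim_subset[OF assms]] independent_card_le(2)[OF assms(1)] assms(2)
  by (metis subset_trans)

lemma fin_dim_eq:
  assumes "fin_dim V" "pv.subspace U" "U \<subseteq> V" "pv.dim V \<le> pv.dim U"
  shows "U = V"
proof -
  obtain B where B: "finite B" "B \<subseteq> U" "pv.independent B" "U \<subseteq> pv.span B" "card B = pv.dim U"
    using fin_dim_basis[OF fin_dim_subset[OF assms(1,3)]] by metis
  have "v \<in> pv.span B" if "v \<in> V" for v
  proof (rule ccontr)
    assume v: "v \<notin> pv.span B"
    then have "pv.independent (insert v B)" using B(3) pv.independent_insertI by blast
    moreover have "insert v B \<subseteq> V" using that B(2) assms(3) by auto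
    ultimately have "card (insert v B) \<le> pv.dim V" using independent_card_le assms(1) by blast
    moreover have "v \<notin> B" using v pv.span_base by blast
    ultimately show False using B assms(4) by simp
  qed
  moreover have "pv.span B \<subseteq> U" using B(2) assms(2) by (simp add: pv.span_minimal)
  ultimately show ?thesis using assms(3) by auto
qed

lemma fin_dim_nonzero:
  assumes "fin_dim U" "0 < pv.dim U"
  obtains u where "u \<in> U" "u \<noteq> 0"
proof -
  obtain B where B: "finite B" "B \<subseteq> U" "pv.independent B" "U \<subseteq> pv.span B" "card B = pv.dim U"
    using fin_dim_basis[OF assms(1)] by metis
  then obtain b where "b \<in> B" using assms(2) by fastforce
  then show thesis using that B pv.dependent_zero by blast
qed

text \<open>Rank and nullity for one functional: a basis of the kernel and one vector outside it
  span \<open>U\<close>. With \<open>\<phi>\<close> an evaluation, a new point lowers the dimension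
  by exactly one.\<close>

lemma dim_kernel:
  fixes \<phi> :: "bipoly \<Rightarrow> real"
  assumes U: "fin_dim U" "pv.subspace U"
    and add: "\<And>x y. \<phi> (x + y) = \<phi> x + \<phi> y" and sc: "\<And>r x. \<phi> (cmul r x) = r * \<phi> x"
    and w: "w \<in> U" "\<phi> w \<noteq> 0"
  shows "pv.dim U = pv.dim {u \<in> U. \<phi> u = 0} + 1"
proof -
  let ?K = "{u \<in> U. \<phi> u = 0}"
  have K0: "\<phi> 0 = 0" using sc[of 0 0] by simp
  have K: "pv.subspace ?K"
    using U(2) K0 by (auto simp: pv.subspace_def add sc)
  have fK: "fin_dim ?K" using fin_dim_subset[OF U(1)] by auto
  obtain B where B: "finite B" "B \<subseteq> ?K" "pv.independent B" "?K \<subseteq> pv.span B" "card B = pv.dim ?K"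
    by (rule fin_dim_basis[OF fK])
  have sB: "pv.span B \<subseteq> ?K" using B(2) K by (simp add: pv.span_minimal)
  have wB: "w \<notin> pv.span B" using sB w by auto
  have ind: "pv.independent (insert w B)" using wB B(3) pv.independent_insertI by blast
  have "u \<in> pv.span (insert w B)" if "u \<in> U" for u
  proof -
    let ?c = "\<phi> u / \<phi> w"
    have "\<phi> (u - cmul ?c w) = 0"
      using add[of "u - cmul ?c w" "cmul ?c w"] w by (simp add: sc)
    then have "u - cmul ?c w \<in> ?K"
      using that w U(2) by (simp add: pv.subspace_diff pv.subspace_scale)
    then have "u - cmul ?c w \<in> pv.span (insert w B)"
      using B(4) pv.span_mono[of B "insert w B"] by auto
    moreover have "cmul ?c w \<in> pv.span (insert w B)" by (simp add: pv.span_base pv.span_scale)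
    ultimately have "(u - cmul ?c w) + cmul ?c w \<in> pv.span (insert w B)" by (rule pv.span_add)
    then show ?thesis by simp
  qed
  then have "U \<subseteq> pv.span (insert w B)" by blast
  moreover have "insert w B \<subseteq> U" using B(2) w by auto
  ultimately have "pv.dim U = card (insert w B)"
    using pv.basis_card_eq_dim[of "insert w B" U] ind by simp
  moreover have "w \<notin> B" using wB pv.span_base by blast
  ultimately show ?thesis using B by simp
qed

lemma dim_injective_image:
  assumes U: "fin_dim U"
    and add: "\<And>x y. f (x + y) = f x + f y" and sc: "\<And>r x. f (cmul r x) = cmul r (f x)"
    and inj: "\<And>x. f x = 0 \<Longrightarrow> x = 0"
  shows "pv.dim (f ` U) = pv.dim U" "fin_dim (f ` U)"
proof -
  interpret f: Vector_Spaces.linear cmul cmul f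
    by unfold_locales (simp_all add: add sc)
  obtain B where B: "finite B" "B \<subseteq> U" "pv.independent B" "U \<subseteq> pv.span B" "card B = pv.dim U"
    using fin_dim_basis[OF assms(1)] by metis
  have i: "inj f"
    using f.inj_iff_eq_0 inj by blast
  have "pv.independent (f ` B)"
    using f.independent_injective_image[OF B(3)] i inj_on_subset by blast
  moreover have sp: "f ` U \<subseteq> pv.span (f ` B)" using B(4) f.span_image by auto
  ultimately have "pv.dim (f ` U) = card (f ` B)"
    using pv.basis_card_eq_dim[of "f ` B" "f ` U"] B(2) by (metis image_mono)
  then show "pv.dim (f ` U) = pv.dim U" using card_image[of f B] i B(5) inj_on_subset by (metis subset_UNIV)
  show "fin_dim (f ` U)" unfolding fin_dim_def using sp B(1) by blast
qed

lemma dim_insert_ge: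
  assumes V: "fin_dim V" "pv.subspace U" "U \<subseteq> V" "w \<in> V" "w \<notin> U"
  shows "pv.dim U + 1 \<le> pv.dim V"
proof -
  obtain B where B: "finite B" "B \<subseteq> U" "pv.independent B" "U \<subseteq> pv.span B" "card B = pv.dim U"
    using fin_dim_basis[OF fin_dim_subset[OF V(1,3)]] by metis
  have "w \<notin> pv.span B" using B(2) V by (metis pv.span_minimal subsetD)
  then have "pv.independent (insert w B)" "w \<notin> B" using B(3) pv.independent_insertI pv.span_base by blast+
  then show ?thesis
    using independent_card_le(2)[OF V(1), of "insert w B"] B V by auto
qed

text \<open>Independence of \<open>w1\<close> and \<open>w2\<close> is required modulo
  \<open>U\<close>, not merely as vectors; in the main application \<open>U\<close> consists of
  multiples of a fixed curve and \<open>w1\<close>, \<open>w2\<close> are the cofactors of a common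
  factor.\<close>

lemma dim_insert2_ge:
  assumes V: "fin_dim V" "pv.subspace V" "pv.subspace U" "U \<subseteq> V" "w1 \<in> V" "w2 \<in> V"
    and ind: "\<And>r s. cmul r w1 + cmul s w2 \<in> U \<Longrightarrow> r = 0 \<and> s = 0"
  shows "pv.dim U + 2 \<le> pv.dim V"
proof -
  obtain B where B: "finite B" "B \<subseteq> U" "pv.independent B" "U \<subseteq> pv.span B" "card B = pv.dim U"
    using fin_dim_basis[OF fin_dim_subset[OF V(1,4)]] by metis
  have sB: "pv.span B \<subseteq> U" using B(2) V by (metis pv.span_minimal)
  have w1: "w1 \<notin> pv.span B" using ind[of 1 0] sB by auto
  then have 1: "pv.independent (insert w1 B)" "w1 \<notin> B" using B(3) pv.independent_insertI pv.span_base by blast+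
  have w2: "w2 \<notin> pv.span (insert w1 B)"
  proof
    assume "w2 \<in> pv.span (insert w1 B)"
    then obtain k where "w2 - cmul k w1 \<in> pv.span B"
      using pv.span_breakdown_eq by blast
    then have "cmul (-k) w1 + cmul 1 w2 \<in> U" using sB by auto
    from ind[OF this] show False by simp
  qed
  then have "pv.independent (insert w2 (insert w1 B))" "w2 \<notin> insert w1 B"
    using 1 pv.independent_insertI pv.span_base by blast+
  then have "card (insert w2 (insert w1 B)) \<le> pv.dim V"
    using independent_card_le(2)[OF V(1), of "insert w2 (insert w1 B)"] B V by auto
  then show ?thesis using B 1 \<open>w2 \<notin> insert w1 B\<close> by simp
qed

lemma dim_two:
  assumes "fin_dim V" "pv.subspace V" "2 \<le> pv.dim V"
  obtains u v where "u \<in> V" "v \<in> V" "\<And>r s. cmul r u + cmul s v = 0 \<Longrightarrow> r = 0 \<and> s = 0"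
proof -
  obtain u where u: "u \<in> V" "u \<noteq> 0" using fin_dim_nonzero[OF assms(1)] assms(3) by auto
  have "\<not> V \<subseteq> pv.span {u}"
    using pv.dim_le_card[of V "{u}"] assms(3) by auto
  then obtain v where v: "v \<in> V" "v \<notin> pv.span {u}" by blast
  have "r = 0 \<and> s = 0" if *: "cmul r u + cmul s v = 0" for r s
  proof (cases "s = 0")
    case True then show ?thesis using * u by simp
  next
    case False
    have "cmul s v = cmul (-r) u" using * by (simp add: eq_neg_iff_add_eq_0 add.commute)
    then have "cmul (inverse s) (cmul s v) = cmul (inverse s) (cmul (-r) u)" by simp
    then have "v = cmul (inverse s * (-r)) u" using False by simp
    then have "v \<in> pv.span {u}" by (metis pv.span_base pv.span_scale singletonI)
    with v show ?thesis by simp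
  qed
  with u v that show thesis by blast
qed

text \<open>Bases of \<open>U\<close> and \<open>V\<close> extending one of
  \<open>U \<inter> V\<close> have an independent union inside \<open>W\<close>. Allowing a superset
  \<open>I\<close> of the intersection suits Bezout's bound, where \<open>I\<close> is an explicit
  space of multiples.\<close>

lemma dim_sum_ge:
  assumes W: "fin_dim W" and U: "pv.subspace U" "U \<subseteq> W" and V: "pv.subspace V" "V \<subseteq> W"
    and I: "U \<inter> V \<subseteq> I" "fin_dim I" and W': "pv.subspace W"
  shows "pv.dim U + pv.dim V \<le> pv.dim W + pv.dim I"
proof -
  have fU: "fin_dim U" and fV: "fin_dim V" using fin_dim_subset W U V by auto
  have fI: "fin_dim (U \<inter> V)" using fin_dim_subset[OF fU] by auto
  obtain B where B: "finite B" "B \<subseteq> U \<inter> V" "pv.independent B" "U \<inter> V \<subseteq> pv.span B" "card B = pv.dim (U \<inter> V)"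
    using fin_dim_basis[OF fI] by metis
  obtain C where C: "B \<subseteq> C" "C \<subseteq> U" "pv.independent C" "U \<subseteq> pv.span C"
    using pv.maximal_independent_subset_extend[of B U] B by auto
  obtain D where D: "B \<subseteq> D" "D \<subseteq> V" "pv.independent D" "V \<subseteq> pv.span D"
    using pv.maximal_independent_subset_extend[of B V] B by auto
  have fin: "finite C" "finite D"
    using independent_card_le(1) fU fV C D by blast+
  have sc: "pv.span C = U" using C U by (metis pv.span_minimal subset_antisym)
  have sd: "pv.span D = V" using D V by (metis pv.span_minimal subset_antisym)
  have sb: "pv.span B = U \<inter> V" using B U V subspace_Int by (metis pv.span_minimal subset_antisym pv.subspace_inter)
  have dis: "C \<inter> (D - B) = {}"
  proof (rule ccontr)
    assume "C \<inter> (D - B) \<noteq> {}"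
    then obtain x where x: "x \<in> C" "x \<in> D" "x \<notin> B" by blast
    then have "x \<in> pv.span B" using sb C D by auto
    then have "x \<in> pv.span (D - {x})" using pv.span_mono[of B "D - {x}"] x D by auto
    with D x show False by (auto simp: pv.dependent_def)
  qed
  have "pv.independent (C \<union> (D - B))"
  proof (rule pv.independent_if_scalars_zero)
    show "finite (C \<union> (D - B))" using fin by auto
  next
    fix g x assume s: "(\<Sum>x\<in>C \<union> (D - B). cmul (g x) x) = 0" and x: "x \<in> C \<union> (D - B)"
    have split: "(\<Sum>x\<in>C. cmul (g x) x) + (\<Sum>x\<in>D - B. cmul (g x) x) = 0"
      using s dis fin by (simp add: sum.union_disjoint)
    let ?v = "\<Sum>x\<in>D - B. cmul (g x) x"
    have vV: "?v \<in> V" using V D by (intro pv.subspace_sum pv.subspace_scale) auto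
    have "- (\<Sum>x\<in>C. cmul (g x) x) \<in> U"
      using U C by (intro pv.subspace_neg pv.subspace_sum pv.subspace_scale) auto
    then have vU: "?v \<in> U" using split by (simp add: add_eq_0_iff)
    have "?v \<in> pv.span B" using vV vU sb by auto
    then obtain h where h: "?v = (\<Sum>x\<in>B. cmul (h x) x)"
      using pv.span_finite[OF B(1)] by auto
    \<comment> \<open>The part of the relation supported on \<open>D - B\<close> lies in both
      spaces, so it can be rewritten over \<open>B\<close>; \<open>k\<close> turns this into a
      relation on \<open>D\<close>.\<close>
    define k where "k x = (if x \<in> B then - h x else g x)" for x
    have "(\<Sum>x\<in>D. cmul (k x) x) = (\<Sum>x\<in>D - B. cmul (k x) x) + (\<Sum>x\<in>B. cmul (k x) x)"
      using D fin by (simp add: sum.subset_diff)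
    also have "(\<Sum>x\<in>D - B. cmul (k x) x) = ?v" by (intro sum.cong) (auto simp: k_def)
    also have "(\<Sum>x\<in>B. cmul (k x) x) = - (\<Sum>x\<in>B. cmul (h x) x)"
      by (simp add: k_def sum_negf)
    finally have "(\<Sum>x\<in>D. cmul (k x) x) = 0" using h by simp
    then have k0: "\<And>x. x \<in> D \<Longrightarrow> k x = 0"
      using D(3) fin(2) pv.independentD[of D D k] by blast
    then have g0: "\<And>x. x \<in> D - B \<Longrightarrow> g x = 0" unfolding k_def by (metis DiffD1 DiffD2)
    then have "(\<Sum>x\<in>C. cmul (g x) x) = 0" using split by simp
    then have "\<And>x. x \<in> C \<Longrightarrow> g x = 0"
      using C(3) fin(1) pv.independentD[of C C g] by blast
    with g0 x show "g x = 0" by blast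
  qed
  moreover have "C \<union> (D - B) \<subseteq> W" using C D U V by auto
  ultimately have "card (C \<union> (D - B)) \<le> pv.dim W" using independent_card_le W by blast
  moreover have "card (C \<union> (D - B)) = card C + card (D - B)"
    using dis fin by (simp add: card_Un_disjoint)
  moreover have "card (D - B) + card B = card D" using D fin B
    by (metis card_Diff_subset card_mono le_add_diff_inverse2)
  moreover have "card C = pv.dim U" "card D = pv.dim V"
    using C D pv.basis_card_eq_dim by blast+
  moreover have "card B \<le> pv.dim I" using B(5) fin_dim_mono[OF I(2,1)] by simp
  ultimately show ?thesis by linarith
qed

section \<open>Evaluation and total degree\<close>

definition ev :: "bipoly \<Rightarrow> real \<times> real \<Rightarrow> real" where
  "ev f p = poly (poly f [:fst p:]) (snd p)"

lemma ev_simps [simp]: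
  "ev (f + g) p = ev f p + ev g p" "ev (f - g) p = ev f p - ev g p" "ev (f * g) p = ev f p * ev g p"
  "ev (- f) p = - ev f p" "ev 0 p = 0" "ev 1 p = 1" "ev (cmul r f) p = r * ev f p"
  by (simp_all add: ev_def cmul_def)

text \<open>\<open>ev\<close> inserts the first coordinate into the outer variable, so
  \<open>cf f i j\<close> is the coefficient of x^i y^j, matching the coefficient functions of
  \<open>poly2_eval\<close>.\<close>

abbreviation cf :: "bipoly \<Rightarrow> nat \<Rightarrow> nat \<Rightarrow> real" where
  "cf f i j \<equiv> coeff (coeff f i) j"

lemma cf_cmul [simp]: "cf (cmul r f) i j = r * cf f i j"
  by (simp add: cmul_def)

text \<open>Degrees are integers so that differences such as \<open>int d - int e\<close> can drop
  below zero without truncation; the space is then \<open>{0}\<close>.\<close>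

definition Pol :: "int \<Rightarrow> bipoly set" where
  "Pol t = {f. \<forall>i j. cf f i j \<noteq> 0 \<longrightarrow> int i + int j \<le> t}"

lemma Pol_subspace: "pv.subspace (Pol t)"
  unfolding pv.subspace_def Pol_def by (auto, metis add.right_neutral)

lemma Pol_mono: "s \<le> t \<Longrightarrow> Pol s \<subseteq> Pol t"
  by (force simp: Pol_def)

lemma Pol_neg: "t < 0 \<Longrightarrow> Pol t = {0}"
  by (force simp: Pol_def poly_eq_iff)

lemma Pol_ex: "\<exists>n. f \<in> Pol (int n)"
proof -
  define N where "N = degree f + Max ((\<lambda>i. degree (coeff f i)) ` {..degree f})"
  have "i + j \<le> N" if "cf f i j \<noteq> 0" for i j
  proof -
    have "coeff f i \<noteq> 0" using that by auto
    then have i: "i \<le> degree f" by (rule le_degree)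
    have "j \<le> degree (coeff f i)" using that by (rule le_degree)
    also have "\<dots> \<le> Max ((\<lambda>i. degree (coeff f i)) ` {..degree f})" using i by (intro Max_ge) auto
    finally show ?thesis using i by (simp add: N_def)
  qed
  then have "f \<in> Pol (int N)" by (auto simp: Pol_def simp flip: of_nat_add)
  then show ?thesis by blast
qed

definition tdeg :: "bipoly \<Rightarrow> nat" where
  "tdeg f = (LEAST n. f \<in> Pol (int n))"

lemma Pol_iff: "f \<noteq> 0 \<Longrightarrow> f \<in> Pol t \<longleftrightarrow> int (tdeg f) \<le> t"
proof
  assume f: "f \<noteq> 0" "f \<in> Pol t"
  then have "t \<ge> 0" using Pol_neg[of t] by fastforce
  then have "f \<in> Pol (int (nat t))" using f by simp
  then have "tdeg f \<le> nat t" unfolding tdeg_def by (rule Least_le)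
  then show "int (tdeg f) \<le> t" using \<open>t \<ge> 0\<close> by simp
next
  assume t: "int (tdeg f) \<le> t"
  have "f \<in> Pol (int (tdeg f))" unfolding tdeg_def using Pol_ex[of f] by (rule LeastI_ex)
  then show "f \<in> Pol t" using Pol_mono[OF t] by auto
qed

lemma zero_Pol [simp]: "0 \<in> Pol t" by (simp add: Pol_def)

lemma one_Pol: "0 \<le> t \<Longrightarrow> 1 \<in> Pol t"
  by (auto simp: Pol_def coeff_1 one_pCons coeff_pCons split: nat.splits)

text \<open>The homogeneous part of degree \<open>m\<close> with the second variable set to 1. Its
  value at z is the coefficient of y^m after substituting z y for x.\<close>

definition top_form :: "nat \<Rightarrow> bipoly \<Rightarrow> real poly" where
  "top_form m f = (\<Sum>i\<le>m. monom (cf f i (m - i)) i)"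

lemma coeff_subst:
  "coeff (poly f [:0, z:]) m = poly (top_form m f) z"
proof -
  have mon: "[:0, z:] ^ i = monom (z ^ i) i" for i
    by (induction i) (simp_all add: mult.commute smult_monom monom_Suc)
  define N where "N = max m (degree f)"
  have "poly f [:0, z:] = (\<Sum>i\<le>degree f. monom (z ^ i) i * coeff f i)"
    by (simp add: poly_altdef mon mult.commute)
  also have "coeff \<dots> m = (\<Sum>i\<le>degree f. if i \<le> m then cf f i (m - i) * z ^ i else 0)"
    by (auto simp: coeff_sum coeff_monom_mult intro!: sum.cong)
  also have "\<dots> = (\<Sum>i\<le>N. if i \<le> m then cf f i (m - i) * z ^ i else 0)"
    by (rule sum.mono_neutral_left) (auto simp: N_def coeff_eq_0)
  also have "\<dots> = (\<Sum>i\<le>m. cf f i (m - i) * z ^ i)"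
    by (rule sum.mono_neutral_cong_right) (auto simp: N_def)
  also have "\<dots> = poly (top_form m f) z"
    by (simp add: top_form_def poly_sum poly_monom)
  finally show ?thesis .
qed

lemma top_form_eq_0_iff: "top_form m f = 0 \<longleftrightarrow> (\<forall>i j. i + j = m \<longrightarrow> cf f i j = 0)"
proof -
  have c: "coeff (top_form m f) k = (if k \<le> m then cf f k (m - k) else 0)" for k
    by (simp add: top_form_def coeff_sum)
  show ?thesis unfolding poly_eq_iff c by (auto, metis diff_add_inverse le_add1)
qed

lemma top_form_high: "f \<in> Pol (int n) \<Longrightarrow> n < m \<Longrightarrow> top_form m f = 0"
  unfolding top_form_eq_0_iff Pol_def by force

lemma top_form_tdeg: "f \<noteq> 0 \<Longrightarrow> top_form (tdeg f) f \<noteq> 0"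
proof
  assume f: "f \<noteq> 0" "top_form (tdeg f) f = 0"
  have "f \<in> Pol (int (tdeg f))" using f Pol_iff by blast
  then have "f \<in> Pol (int (tdeg f) - 1)"
    using f(2) unfolding Pol_def top_form_eq_0_iff
    by (smt (verit) mem_Collect_eq of_nat_add of_nat_eq_iff)
  then show False using Pol_iff[OF f(1), of "int (tdeg f) - 1"] by simp
qed

lemma degree_subst: "f \<in> Pol (int n) \<Longrightarrow> degree (poly f [:0, z:]) \<le> n"
  by (rule degree_le) (simp add: coeff_subst top_form_high)

lemma Pol_mult: "f \<in> Pol s \<Longrightarrow> g \<in> Pol t \<Longrightarrow> f * g \<in> Pol (s + t)"
proof (cases "f = 0 \<or> g = 0")
  case False
  assume f: "f \<in> Pol s" and g: "g \<in> Pol t"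
  show ?thesis unfolding Pol_def
  proof (safe, rule ccontr)
    fix i j assume "\<not> int i + int j \<le> s + t"
    then have "coeff (coeff f k * coeff g (i - k)) j = 0" if "k \<le> i" for k
      unfolding coeff_mult
    proof (intro sum.neutral ballI)
      fix l assume "l \<in> {..j}"
      then have "int k + int l > s \<or> int (i - k) + int (j - l) > t"
        using that \<open>\<not> int i + int j \<le> s + t\<close> by auto
      then have "cf f k l = 0 \<or> cf g (i - k) (j - l) = 0" using f g unfolding Pol_def by force
      then show "cf f k l * cf g (i - k) (j - l) = 0" by auto
    qed
    then have "cf (f * g) i j = 0" by (simp add: coeff_mult[of f g i] coeff_sum)
    moreover assume "cf (f * g) i j \<noteq> 0"
    ultimately show False by simp
  qed
qed auto

text \<open>For the lower bound, pick \<open>z\<close> outside the roots of both leading forms.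
  Substituting z y for x then turns the total degrees of \<open>f\<close> and \<open>g\<close> into
  degrees of univariate polynomials, which add.\<close>

lemma tdeg_mult:
  assumes "f \<noteq> 0" "g \<noteq> 0"
  shows "tdeg (f * g) = tdeg f + tdeg g"
proof (rule antisym)
  have f: "f \<in> Pol (int (tdeg f))" and g: "g \<in> Pol (int (tdeg g))" using assms Pol_iff by blast+
  from Pol_mult[OF f g] show "tdeg (f * g) \<le> tdeg f + tdeg g"
    using Pol_iff[of "f * g"] assms by simp
  show "tdeg f + tdeg g \<le> tdeg (f * g)"
  proof (rule ccontr)
    let ?m = "tdeg f" and ?n = "tdeg g"
    assume less: "\<not> ?m + ?n \<le> tdeg (f * g)"
    have fg: "f * g \<in> Pol (int (tdeg (f * g)))" using assms Pol_iff[of "f * g"] by simp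
    have "finite {z. poly (top_form ?m f * top_form ?n g) z = 0}"
      using assms top_form_tdeg by (intro poly_roots_finite) simp
    then obtain z where z: "poly (top_form ?m f * top_form ?n g) z \<noteq> 0"
      using infinite_UNIV_char_0[where 'a=real] by (metis (mono_tags, lifting) UNIV_eq_I mem_Collect_eq)
    have "coeff (poly (f * g) [:0, z:]) (?m + ?n) = 0"
      using top_form_high[OF fg] less by (simp add: coeff_subst del: poly_mult)
    moreover have "coeff (poly (f * g) [:0, z:]) (?m + ?n)
        = coeff (poly f [:0, z:]) ?m * coeff (poly g [:0, z:]) ?n"
    proof -
      have df: "degree (poly f [:0, z:]) = ?m" and dg: "degree (poly g [:0, z:]) = ?n"
        using degree_subst[OF f, of z] degree_subst[OF g, of z] z
        by (auto intro!: antisym le_degree simp: coeff_subst)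
      show ?thesis using coeff_mult_degree_sum[of "poly f [:0, z:]" "poly g [:0, z:]"] df dg by simp
    qed
    ultimately show False using z by (simp add: coeff_subst)
  qed
qed

lemma tdeg_0_unit: "f \<noteq> 0 \<Longrightarrow> tdeg f = 0 \<Longrightarrow> is_unit f"
proof -
  assume f: "f \<noteq> 0" "tdeg f = 0"
  then have "f \<in> Pol 0" using Pol_iff by simp
  then have z: "cf f i j = 0" if "i + j > 0" for i j using that unfolding Pol_def by force
  have "f = [:[:cf f 0 0:]:]"
    by (intro poly_eqI) (use z in \<open>auto simp: coeff_pCons split: nat.splits\<close>)
  then obtain c where c: "f = [:[:c:]:]" by blast
  then have "c \<noteq> 0" using f by auto
  then have "f * [:[:1 / c:]:] = 1" using c by (simp add: one_pCons)
  then show "is_unit f" by (metis dvd_triv_left)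
qed

lemma tdeg_pos: "f \<noteq> 0 \<Longrightarrow> \<not> is_unit f \<Longrightarrow> 1 \<le> tdeg f"
  using tdeg_0_unit by fastforce

lemma Pol_div: "f \<noteq> 0 \<Longrightarrow> f * g \<in> Pol t \<Longrightarrow> g \<in> Pol (t - int (tdeg f))"
  by (cases "g = 0") (auto simp: Pol_iff tdeg_mult)

text \<open>The binomial coefficient of t + 2 over 2, set to 0 for negative \<open>t\<close>: the
  dimension of \<open>Pol t\<close>.\<close>

definition pd :: "int \<Rightarrow> nat" where
  "pd t = nat (t + 1) * nat (t + 2) div 2"

lemma pd2: "2 * pd t = nat (t + 1) * nat (t + 2)"
proof -
  have "even (nat (t + 1) * nat (t + 2))"
    by (cases "t < 0") (auto simp: nat_add_distrib)
  then show ?thesis by (simp add: pd_def)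
qed

lemma pd_neg: "t < 0 \<Longrightarrow> pd t = 0" by (simp add: pd_def)

lemma card_monomials: "card {(i, j). i + j \<le> n} = pd (int n)"
proof -
  have "card {(i, j). i + j \<le> n} = card (SIGMA i:{..n}. {..n - i})"
    by (rule arg_cong[where f=card]) auto
  also have "\<dots> = (\<Sum>i\<le>n. n - i + 1)" by simp
  also have "2 * \<dots> = (n + 1) * (n + 2)"
  proof (induction n)
    case (Suc n)
    have "(\<Sum>i\<le>Suc n. Suc n - i + 1) = (\<Sum>i\<le>n. (n - i + 1) + 1) + 1"
      by (simp add: Suc_diff_le)
    also have "\<dots> = (\<Sum>i\<le>n. n - i + 1) + (n + 1) + 1" by (subst sum.distrib) simp
    finally show ?case using Suc by simp
  qed simp
  finally have "card {(i, j). i + j \<le> n} * 2 = (n + 1) * (n + 2)" by simp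
  then show ?thesis using pd2[of "int n"] by (simp add: nat_add_distrib)
qed

lemma Pol_dim: "fin_dim (Pol t)" "pv.dim (Pol t) = pd t"
proof -
  have "fin_dim (Pol t) \<and> pv.dim (Pol t) = pd t"
  proof (cases "t < 0")
    case True
    then have s: "Pol t = pv.span {}" by (simp add: Pol_neg)
    have "fin_dim (Pol t)" unfolding fin_dim_def s by (rule exI[of _ "{}"]) simp
    moreover have "pv.dim (Pol t) = 0"
      using pv.dim_span_eq_card_independent[OF pv.independent_empty] s by simp
    ultimately show ?thesis using True by (simp add: pd_neg)
  next
    case False
    then obtain n where n: "t = int n" by (metis not_less zero_le_imp_eq_int)
    let ?I = "{(i, j). i + j \<le> n}"
    let ?m = "\<lambda>(i, j). monom (monom (1 :: real) j) i"
    let ?B = "?m ` ?I"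
    have fI: "finite ?I" by (rule finite_subset[of _ "{..n} \<times> {..n}"]) auto
    have cm: "cf (?m k) i j = (if k = (i, j) then 1 else 0)" for k i j
      by (cases k) (auto simp: coeff_monom)
    have inj: "inj_on ?m ?I"
    proof (rule inj_onI)
      fix k l assume "?m k = ?m l"
      then have "cf (?m k) (fst l) (snd l) = cf (?m l) (fst l) (snd l)" by simp
      then show "k = l" unfolding cm by (simp split: if_splits)
    qed
    have cfs: "cf (\<Sum>k\<in>?I. cmul (g k) (?m k)) i j = (if i + j \<le> n then g (i, j) else 0)" for g i j
    proof -
      have "cf (\<Sum>k\<in>?I. cmul (g k) (?m k)) i j = (\<Sum>k\<in>?I. g k * cf (?m k) i j)"
        by (simp only: coeff_sum cf_cmul)
      also have "\<dots> = (\<Sum>k\<in>?I. if k = (i, j) then g k else 0)" by (intro sum.cong refl) (simp add: cm)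
      also have "\<dots> = (if i + j \<le> n then g (i, j) else 0)" using fI by (simp add: sum.delta)
      finally show ?thesis .
    qed
    have sub: "?B \<subseteq> Pol t"
      by (auto simp: Pol_def n coeff_monom split: if_splits)
    have ind: "pv.independent ?B"
    proof (rule pv.independent_if_scalars_zero)
      show "finite ?B" using fI by simp
      fix g b assume s: "(\<Sum>x\<in>?B. cmul (g x) x) = 0" and b: "b \<in> ?B"
      then obtain i j where ij: "i + j \<le> n" "b = ?m (i, j)" by auto
      have "(\<Sum>k\<in>?I. cmul (g (?m k)) (?m k)) = 0" using s by (simp add: sum.reindex[OF inj])
      then have "cf (\<Sum>k\<in>?I. cmul (g (?m k)) (?m k)) i j = 0" by simp
      then show "g b = 0" using cfs[of "\<lambda>k. g (?m k)" i j] ij by simp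
    qed
    have span: "Pol t \<subseteq> pv.span ?B"
    proof
      fix f assume f: "f \<in> Pol t"
      have "f = (\<Sum>k\<in>?I. cmul (cf f (fst k) (snd k)) (?m k))"
        using f by (intro poly_eqI) (subst cfs, use f in \<open>auto simp: Pol_def n simp flip: of_nat_add\<close>)
      also have "\<dots> \<in> pv.span ?B"
        by (intro pv.span_sum pv.span_scale pv.span_base) auto
      finally show "f \<in> pv.span ?B" .
    qed
    have "pv.dim (Pol t) = card ?B" using pv.basis_card_eq_dim[OF sub span ind] by simp
    also have "\<dots> = pd t" using card_image[OF inj] card_monomials n by simp
    finally show ?thesis using span fI unfolding fin_dim_def by blast
  qed
  then show "fin_dim (Pol t)" "pv.dim (Pol t) = pd t" by auto
qed

section \<open>Vanishing spaces and points imposing independent conditions\<close>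

definition Van :: "int \<Rightarrow> (real \<times> real) set \<Rightarrow> bipoly set" where
  "Van t S = {f \<in> Pol t. \<forall>s\<in>S. ev f s = 0}"

lemma Van_subspace: "pv.subspace (Van t S)"
  using Pol_subspace[of t] by (auto simp: Van_def pv.subspace_def)

lemma Van_Pol: "Van t S \<subseteq> Pol t" by (auto simp: Van_def)

lemma Van_empty [simp]: "Van t {} = Pol t" by (auto simp: Van_def)

lemma Van_fin_dim: "fin_dim (Van t S)"
  using fin_dim_subset[OF Pol_dim(1) Van_Pol] .

lemma Van_anti: "S \<subseteq> T \<Longrightarrow> Van t T \<subseteq> Van t S" by (auto simp: Van_def)

lemma Van_insert: "Van t (insert s S) = {f \<in> Van t S. ev f s = 0}" by (auto simp: Van_def)

lemma zero_Van [simp]: "0 \<in> Van t S" by (simp add: Van_def)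

definition vdim :: "int \<Rightarrow> (real \<times> real) set \<Rightarrow> nat" where
  "vdim t S = pv.dim (Van t S)"

lemma vdim_empty [simp]: "vdim t {} = pd t" by (simp add: vdim_def Pol_dim)

lemma vdim_insert_new: "f \<in> Van t S \<Longrightarrow> ev f s \<noteq> 0 \<Longrightarrow> vdim t S = vdim t (insert s S) + 1"
  unfolding vdim_def Van_insert
  by (rule dim_kernel[OF Van_fin_dim Van_subspace, of "\<lambda>f. ev f s"]) auto

lemma vdim_insert_old: "(\<And>f. f \<in> Van t S \<Longrightarrow> ev f s = 0) \<Longrightarrow> Van t (insert s S) = Van t S"
  by (auto simp: Van_insert)

lemma vdim_insert_le: "vdim t S \<le> vdim t (insert s S) + 1"
  using vdim_insert_new vdim_insert_old by (metis le_add1 order_refl vdim_def)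

lemma vdim_anti: "S \<subseteq> T \<Longrightarrow> vdim t T \<le> vdim t S"
  unfolding vdim_def by (rule fin_dim_mono[OF Van_fin_dim Van_anti])

lemma vdim_le: "vdim t S \<le> pd t"
  using vdim_anti[of "{}" S t] by simp

lemma vdim_0_iff: "vdim t S = 0 \<longleftrightarrow> Van t S = {0}"
proof
  show "vdim t S = 0 \<Longrightarrow> Van t S = {0}"
  proof (rule ccontr)
    assume "vdim t S = 0" "Van t S \<noteq> {0}"
    then obtain f where "f \<in> Van t S" "f \<noteq> 0" using zero_Van by blast
    then have "pv.dim {0} + 1 \<le> pv.dim (Van t S)"
      by (intro dim_insert_ge[OF Van_fin_dim]) (auto simp: pv.subspace_def)
    then show False using \<open>vdim t S = 0\<close> by (simp add: vdim_def)
  qed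
  assume "Van t S = {0}"
  then have "Van t S \<subseteq> pv.span {}" by simp
  then show "vdim t S = 0" unfolding vdim_def using pv.dim_le_card[of "Van t S" "{}"] by simp
qed

lemma vdim_pos: "0 < vdim t S \<Longrightarrow> \<exists>f\<in>Van t S. f \<noteq> 0"
proof -
  assume "0 < vdim t S"
  then have "Van t S \<noteq> {0}" using vdim_0_iff[of t S] by linarith
  then show ?thesis using zero_Van[of t S] by auto
qed

lemma vdim_1_unique:
  assumes "vdim t S = 1" "f \<in> Van t S" "f \<noteq> 0" "g \<in> Van t S"
  shows "\<exists>r. g = cmul r f"
proof -
  have "pv.span {f} = Van t S"
  proof (rule fin_dim_eq[OF Van_fin_dim])
    show "pv.subspace (pv.span {f})" by simp
    show "pv.span {f} \<subseteq> Van t S" using assms Van_subspace by (simp add: pv.span_minimal)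
    have "pv.dim (pv.span {f}) = 1"
      using assms by (simp add: pv.dim_eq_card_independent)
    then show "pv.dim (Van t S) \<le> pv.dim (pv.span {f})" using assms by (simp add: vdim_def)
  qed
  then show ?thesis using assms(4) by (auto simp: pv.span_singleton)
qed

text \<open>Independence of the linear conditions imposed by the points, phrased by separation: this
  makes monotonicity in \<open>t\<close> immediate, and \<open>indep_vdim\<close> recovers the form
  with dimensions.\<close>

definition indep :: "int \<Rightarrow> (real \<times> real) set \<Rightarrow> bool" where
  "indep t S \<longleftrightarrow> finite S \<and> (\<forall>s\<in>S. \<exists>f\<in>Van t (S - {s}). ev f s \<noteq> 0)"

lemma indep_empty [simp]: "indep t {}" by (simp add: indep_def)

lemma indep_insert:
  assumes "indep t S" "f \<in> Van t S" "ev f s \<noteq> 0"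
  shows "indep t (insert s S)"
  unfolding indep_def
proof (intro conjI ballI)
  show "finite (insert s S)" using assms(1) by (simp add: indep_def)
  fix x assume x: "x \<in> insert s S"
  have sS: "s \<notin> S" using assms by (auto simp: Van_def)
  show "\<exists>f\<in>Van t (insert s S - {x}). ev f x \<noteq> 0"
  proof (cases "x = s")
    case True
    then show ?thesis using assms sS by (intro bexI[of _ f]) auto
  next
    case False
    then obtain g where g: "g \<in> Van t (S - {x})" "ev g x \<noteq> 0"
      using assms(1) x unfolding indep_def by blast
    let ?h = "g - cmul (ev g s / ev f s) f"
    have "?h \<in> Van t (insert s S - {x})"
      using g assms(2,3) Pol_subspace[of t] by (auto simp: Van_def pv.subspace_diff pv.subspace_scale)
    moreover have "ev ?h x \<noteq> 0" using g assms(2) x False by (auto simp: Van_def)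
    ultimately show ?thesis by blast
  qed
qed

lemma indep_mono: "indep s S \<Longrightarrow> s \<le> t \<Longrightarrow> indep t S"
  unfolding indep_def Van_def using Pol_mono by fast

lemma indep_vdim: "indep t S \<Longrightarrow> vdim t S + card S = pd t"
proof -
  assume i: "indep t S"
  then have "finite S" by (simp add: indep_def)
  then have "S' \<subseteq> S \<Longrightarrow> vdim t S' + card S' = pd t" for S'
  proof (induction "S'" rule: infinite_finite_induct)
    case (insert s F)
    obtain f where "f \<in> Van t (S - {s})" "ev f s \<noteq> 0" using i insert.prems by (auto simp: indep_def)
    moreover have "Van t (S - {s}) \<subseteq> Van t F" using insert by (intro Van_anti) auto
    ultimately have "vdim t F = vdim t (insert s F) + 1" by (intro vdim_insert_new) auto
    then show ?case using insert by simp
  qed (use finite_subset in auto)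
  then show ?thesis by blast
qed

text \<open>A largest independent set between \<open>S1\<close> and \<open>S\<close> has the same
  vanishing space as \<open>S\<close>: a point of \<open>S\<close> whose condition is not implied
  could be added.\<close>

lemma indep_extend:
  assumes "indep t S1" "S1 \<subseteq> S" "finite S"
  obtains S0 where "S1 \<subseteq> S0" "S0 \<subseteq> S" "indep t S0" "Van t S0 = Van t S"
proof -
  let ?P = "\<lambda>S0. S1 \<subseteq> S0 \<and> S0 \<subseteq> S \<and> indep t S0"
  have "\<exists>S0. ?P S0 \<and> (\<forall>T. ?P T \<longrightarrow> card T \<le> card S0)"
  proof (rule ex_has_greatest_nat[of ?P S1 card "card S + 1"])
    show "?P S1" using assms by simp
    show "\<forall>T. ?P T \<longrightarrow> card T < card S + 1"
      using assms(3) card_mono by (metis add.commute le_imp_less_Suc plus_1_eq_Suc)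
  qed
  then obtain S0 where S0: "?P S0" and m: "\<And>T. ?P T \<Longrightarrow> card T \<le> card S0" by blast
  have "ev f s = 0" if f: "f \<in> Van t S0" "s \<in> S" for f s
  proof (rule ccontr)
    assume n: "ev f s \<noteq> 0"
    have "card (insert s S0) \<le> card S0"
      using indep_insert[OF _ f(1) n] S0 f(2) m by blast
    moreover have "s \<notin> S0" using n f by (auto simp: Van_def)
    moreover have "finite S0" using S0 by (simp add: indep_def)
    ultimately show False by simp
  qed
  then have "Van t S0 = Van t S" using S0 by (auto simp: Van_def)
  with S0 that show thesis by blast
qed

lemma linear_separate:
  assumes "s \<noteq> (s' :: real \<times> real)"
  obtains l where "l \<in> Pol 1" "ev l s = 0" "ev l s' \<noteq> 0"
proof -
  have X: "[:- [:a:], 1:] \<in> Pol 1" "ev [:- [:a:], 1:] p = fst p - a" for a p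
    by (auto simp: Pol_def ev_def coeff_pCons one_pCons split: nat.splits)
  have Y: "[:[:- a, 1:]:] \<in> Pol 1" "ev [:[:- a, 1:]:] p = snd p - a" for a p
    by (auto simp: Pol_def ev_def coeff_pCons one_pCons split: nat.splits)
  show thesis
  proof (cases "fst s = fst s'")
    case True
    then have "snd s \<noteq> snd s'" using assms by (simp add: prod_eq_iff)
    with that[of "[:[:- snd s, 1:]:]"] Y show thesis by simp
  next
    case False
    with that[of "[:- [:fst s:], 1:]"] X show thesis by simp
  qed
qed

text \<open>If degree t - 1 does not separate \<open>s\<close>, some interpolating polynomial
  \<open>g x\<close> must be nonzero at \<open>s\<close>, for otherwise 1 minus their normalised sum
  would vanish on \<open>S\<close> but not at \<open>s\<close>. Multiply that \<open>g x\<close> by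
  a line through \<open>x\<close> that misses \<open>s\<close>.\<close>

lemma indep_step:
  assumes i: "indep (t - 1) S" and s: "s \<notin> S" and t: "0 \<le> t"
  obtains f where "f \<in> Van t S" "ev f s \<noteq> 0"
proof (cases "\<exists>f\<in>Van (t - 1) S. ev f s \<noteq> 0")
  case True
  moreover have "Van (t - 1) S \<subseteq> Van t S" using Pol_mono[of "t - 1" t] by (auto simp: Van_def)
  ultimately show ?thesis using that by blast
next
  case False
  show ?thesis
  proof (cases "S = {}")
    case True
    then show ?thesis using that[of 1] one_Pol[OF t] by simp
  next
    case ne: False
    have fin: "finite S" using i by (simp add: indep_def)
    obtain g where g: "\<And>x. x \<in> S \<Longrightarrow> g x \<in> Van (t - 1) (S - {x}) \<and> ev (g x) x \<noteq> 0"
      using i unfolding indep_def by metis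
    \<comment> \<open>The constant 1 has to lie in \<open>Pol (t - 1)\<close> for the
      interpolation.\<close>
    have "t - 1 \<ge> 0"
    proof (rule ccontr)
      assume "\<not> 0 \<le> t - 1"
      then have "Pol (t - 1) = {0}" by (intro Pol_neg) simp
      moreover obtain x where "x \<in> S" using ne by blast
      ultimately have "g x = 0" "ev (g x) x \<noteq> 0" using g[of x] by (auto simp: Van_def)
      then show False by simp
    qed
    have "\<exists>x\<in>S. ev (g x) s \<noteq> 0"
    proof (rule ccontr)
      assume n: "\<not> (\<exists>x\<in>S. ev (g x) s \<noteq> 0)"
      let ?h = "1 - (\<Sum>x\<in>S. cmul (1 / ev (g x) x) (g x))"
      have evs: "ev (\<Sum>x\<in>S. cmul (c x) (g x)) p = (\<Sum>x\<in>S. c x * ev (g x) p)" for c p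
        using fin by (induction S rule: finite_induct) auto
      have "?h \<in> Pol (t - 1)"
        using g one_Pol[OF \<open>t - 1 \<ge> 0\<close>]
        by (intro pv.subspace_diff[OF Pol_subspace] pv.subspace_sum[OF Pol_subspace] pv.subspace_scale[OF Pol_subspace]) (auto simp: Van_def)
      moreover have "ev ?h y = 0" if y: "y \<in> S" for y
      proof -
        have "(\<Sum>x\<in>S. 1 / ev (g x) x * ev (g x) y) = (\<Sum>x\<in>S. if x = y then 1 else 0)"
          using g y by (intro sum.cong) (auto simp: Van_def)
        then show ?thesis using fin y by (simp add: evs del: times_divide_eq_left)
      qed
      ultimately have "?h \<in> Van (t - 1) S" by (simp add: Van_def)
      then have "ev ?h s = 0" using False by blast
      moreover have "(\<Sum>x\<in>S. 1 / ev (g x) x * ev (g x) s) = 0" using n by (intro sum.neutral) auto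
      then have "ev ?h s = 1" by (simp add: evs del: times_divide_eq_left)
      ultimately show False by simp
    qed
    then obtain x where x: "x \<in> S" "ev (g x) s \<noteq> 0" by blast
    obtain l where l: "l \<in> Pol 1" "ev l x = 0" "ev l s \<noteq> 0"
      using linear_separate[of x s] x s by auto
    have "l * g x \<in> Van t S"
      using Pol_mult[OF l(1), of "g x" "t - 1"] g[OF x(1)] l(2) by (auto simp: Van_def)
    then show ?thesis using that[of "l * g x"] x l by simp
  qed
qed

lemma indep_card_minus1: "finite S \<Longrightarrow> indep (int (card S) - 1) S"
proof (induction S rule: finite_induct)
  case (insert s S)
  obtain f where "f \<in> Van (int (card S)) S" "ev f s \<noteq> 0"
    using indep_step[of "int (card S)" S s] insert by auto
  moreover have "indep (int (card S)) S" using indep_mono[OF insert.IH] by simp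
  ultimately show ?case using insert indep_insert by simp
qed simp

text \<open>The Hilbert function \<open>pd t - vdim t S\<close> of a finite point set grows strictly until it
  reaches the number of points.\<close>

lemma hilbert_step:
  assumes "finite S" "0 \<le> t"
  shows "pd t - vdim t S \<ge> min (card S) (pd (t - 1) - vdim (t - 1) S + 1)"
proof -
  obtain S0 where S0: "S0 \<subseteq> S" "indep (t - 1) S0" "Van (t - 1) S0 = Van (t - 1) S"
    using indep_extend[of "t - 1" "{}" S] assms by auto
  then have c: "pd (t - 1) - vdim (t - 1) S = card S0" using indep_vdim[OF S0(2)] by (simp add: vdim_def)
  have i0: "indep t S0" using indep_mono[OF S0(2)] by simp
  show ?thesis
  proof (cases "S0 = S")
    case True
    then show ?thesis using indep_vdim[OF i0] by simp
  next
    case False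
    then obtain s where s: "s \<in> S" "s \<notin> S0" using S0 by blast
    obtain f where "f \<in> Van t S0" "ev f s \<noteq> 0" using indep_step[OF S0(2) s(2) assms(2)] .
    then have "indep t (insert s S0)" using i0 indep_insert by blast
    from indep_vdim[OF this] have "vdim t (insert s S0) + (card S0 + 1) = pd t"
      using s i0 by (simp add: indep_def)
    moreover have "vdim t S \<le> vdim t (insert s S0)" using s S0 by (intro vdim_anti) auto
    ultimately show ?thesis using c by simp
  qed
qed

text \<open>Growth by 2 over two degrees is what a carrier curve of degree at least 2 buys in
  \<open>good_of_generic\<close>.\<close>

lemma hilbert_step2:
  assumes "finite S" "1 \<le> t"
  shows "pd t - vdim t S \<ge> min (card S) (pd (t - 2) - vdim (t - 2) S + 2)"
  using hilbert_step[OF assms(1), of t] hilbert_step[OF assms(1), of "t - 1"] assms(2)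
  by (auto simp: min_def split: if_splits)

lemma hilbert_mono:
  assumes "finite S" "s \<le> t"
  shows "pd s - vdim s S \<le> pd t - vdim t S"
proof -
  obtain S0 where S0: "S0 \<subseteq> S" "indep s S0" "Van s S0 = Van s S"
    using indep_extend[of s "{}" S] assms by auto
  then have "pd s - vdim s S = card S0" using indep_vdim[OF S0(2)] by (simp add: vdim_def)
  moreover have "vdim t S0 + card S0 = pd t" using indep_vdim indep_mono S0(2) assms(2) by blast
  ultimately show ?thesis using vdim_anti[OF S0(1), of t] by linarith
qed

section \<open>Bezout's bound\<close>

lemma mult_dim:
  assumes "h \<noteq> 0" "fin_dim U"
  shows "pv.dim ((*) h ` U) = pv.dim U" "fin_dim ((*) h ` U)"
  by (rule dim_injective_image[OF assms(2)]; use assms in \<open>simp add: algebra_simps cmul_def\<close>)+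

lemma mult_subspace: "pv.subspace U \<Longrightarrow> pv.subspace ((*) h ` U)"
proof -
  assume "pv.subspace U"
  moreover have "cmul r (h * x) = h * cmul r x" for r x by (simp add: cmul_def)
  moreover have "0 \<in> (*) h ` U" using \<open>pv.subspace U\<close> by (metis image_eqI mult_zero_right pv.subspace_0)
  ultimately show ?thesis unfolding pv.subspace_def
    by (auto simp flip: distrib_left)
qed

lemma pd_nat: "2 * pd (int n) = (n + 1) * (n + 2)"
  by (simp add: pd2 nat_add_distrib)

text \<open>In a large degree the multiples of \<open>f\<close> and those of \<open>g\<close> all
  vanish on \<open>S\<close>, meet only in multiples of \<open>f * g\<close> by coprimality, and
  \<open>S\<close> imposes \<open>card S\<close> conditions. On comparing dimensions everything
  cancels except \<open>card S\<close> and the product of the degrees.\<close>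

lemma bezout:
  assumes fg: "coprime f g" "f \<noteq> 0" "g \<noteq> 0" and S: "finite S" "\<And>s. s \<in> S \<Longrightarrow> ev f s = 0 \<and> ev g s = 0"
  shows "card S \<le> tdeg f * tdeg g"
proof -
  define m where "m = tdeg f"
  define n where "n = tdeg g"
  \<comment> \<open>Large enough for \<open>S\<close> to impose independent conditions and for the
    natural-number differences below to be exact.\<close>
  define t where "t = m + n + card S"
  let ?U = "(*) f ` Pol (int (t - m))" and ?V = "(*) g ` Pol (int (t - n))"
  let ?I = "(*) (f * g) ` Pol (int (t - m - n))"
  have f: "f \<in> Pol (int m)" and g: "g \<in> Pol (int n)" using fg Pol_iff m_def n_def by blast+
  have UV: "?U \<subseteq> Van (int t) S" "?V \<subseteq> Van (int t) S"
    using Pol_mult[OF f, of _ "int (t - m)"] Pol_mult[OF g, of _ "int (t - n)"] S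
    by (auto simp: Van_def t_def of_nat_diff add_ac)
  have I: "?U \<inter> ?V \<subseteq> ?I"
  proof
    fix x assume "x \<in> ?U \<inter> ?V"
    then obtain a b where a: "a \<in> Pol (int (t - m))" "x = f * a" and b: "x = g * b" by blast
    then have "g dvd a" using fg(1) by (metis coprime_commute coprime_dvd_mult_right_iff dvd_triv_left)
    then obtain c where c: "a = g * c" by blast
    have "c \<in> Pol (int (t - m) - int (tdeg g))" using Pol_div[OF fg(3), of c] a c by simp
    then have "c \<in> Pol (int (t - m - n))" by (simp add: t_def n_def of_nat_diff)
    then show "x \<in> ?I" using a c by (auto simp: mult.assoc)
  qed
  have "pv.dim ?U + pv.dim ?V \<le> pv.dim (Van (int t) S) + pv.dim ?I"
    using UV I fg by (intro dim_sum_ge Van_fin_dim mult_subspace Pol_subspace Van_subspace mult_dim Pol_dim) auto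
  then have 1: "pd (int (t - m)) + pd (int (t - n)) \<le> vdim (int t) S + pd (int (t - m - n))"
    using fg by (simp add: mult_dim Pol_dim vdim_def)
  have "indep (int t) S" using indep_mono[OF indep_card_minus1[OF S(1)]] by (simp add: t_def)
  then have "vdim (int t) S + card S = pd (int t)" by (rule indep_vdim)
  with 1 have 2: "2 * pd (int (n + card S)) + 2 * pd (int (m + card S)) + 2 * card S
      \<le> 2 * pd (int (m + n + card S)) + 2 * pd (int (card S))"
    by (simp add: t_def)
  have "2 * card S \<le> 2 * (m * n)"
    using 2 unfolding pd_nat by (simp add: algebra_simps)
  then show ?thesis by (simp add: m_def n_def)
qed

section \<open>Ordinary lines\<close>

text \<open>Vectors are homogeneous coordinates: \<open>c \<bullet> cross3 a b = 0\<close> says that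
  \<open>c\<close> lies on the projective line through \<open>a\<close> and
  \<open>b\<close>.\<close>

definition ordinary :: "(real^3) set \<Rightarrow> real^3 \<Rightarrow> real^3 \<Rightarrow> bool" where
  "ordinary P a b \<longleftrightarrow> a \<in> P \<and> b \<in> P \<and> a \<noteq> b \<and> (\<forall>c\<in>P - {a, b}. c \<bullet> cross3 a b \<noteq> 0)"

text \<open>Each plane contains only finitely many points of the moment curve \<open>g\<close>.
  Adding a small multiple of a suitable point of it to \<open>q\<close> reaches generic position and
  keeps the negative signs.\<close>

lemma perturb:
  fixes q :: "real^3"
  assumes "finite W" "0 \<notin> W"
  obtains c where "\<And>w. w \<in> W \<Longrightarrow> c \<bullet> w \<noteq> 0" "\<And>w. w \<in> W \<Longrightarrow> q \<bullet> w < 0 \<Longrightarrow> c \<bullet> w < 0"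
proof -
  define g :: "real \<Rightarrow> real^3" where "g t = vector [1, t, t^2]" for t
  have "finite {t. g t \<bullet> w = 0}" if "w \<in> W" for w
  proof -
    have "w \<noteq> 0" using assms that by auto
    then have "[:w$1, w$2, w$3:] \<noteq> 0" by (auto simp: vec_eq_iff forall_3)
    then have "finite {t. poly [:w$1, w$2, w$3:] t = 0}" by (rule poly_roots_finite)
    moreover have "g t \<bullet> w = poly [:w$1, w$2, w$3:] t" for t
      by (simp add: g_def inner_vec_def sum_3 power2_eq_square algebra_simps)
    ultimately show ?thesis by simp
  qed
  then have "finite (\<Union>w\<in>W. {t. g t \<bullet> w = 0})" using assms by auto
  then obtain t where t: "\<And>w. w \<in> W \<Longrightarrow> g t \<bullet> w \<noteq> 0"
    using infinite_UNIV_char_0[where 'a=real] by (metis (mono_tags, lifting) UN_iff UNIV_eq_I mem_Collect_eq)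
  have ev: "\<forall>\<^sub>F e in at_right (0 :: real). (q + e *\<^sub>R g t) \<bullet> w \<noteq> 0 \<and> (q \<bullet> w < 0 \<longrightarrow> (q + e *\<^sub>R g t) \<bullet> w < 0)"
    if w: "w \<in> W" for w
  proof -
    have lim: "((\<lambda>e. (q + e *\<^sub>R g t) \<bullet> w) \<longlongrightarrow> (q + 0 *\<^sub>R g t) \<bullet> w) (at_right 0)"
      by (intro tendsto_intros)
    consider "q \<bullet> w < 0" | "q \<bullet> w > 0" | "q \<bullet> w = 0" by linarith
    then show ?thesis
    proof cases
      case 1
      then have "\<forall>\<^sub>F e in at_right 0. (q + e *\<^sub>R g t) \<bullet> w < 0" using order_tendstoD(2)[OF lim, of 0] by simp
      then show ?thesis by eventually_elim auto
    next
      case 2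
      then have "\<forall>\<^sub>F e in at_right 0. (q + e *\<^sub>R g t) \<bullet> w > 0" using order_tendstoD(1)[OF lim, of 0] by simp
      then show ?thesis using 2 by (auto elim: eventually_mono)
    next
      case 3
      have "\<forall>\<^sub>F e in at_right (0 :: real). e > 0" by (simp add: eventually_at_right_less)
      then show ?thesis using 3 t[OF w] by (auto simp: inner_add_left elim!: eventually_mono)
    qed
  qed
  have "\<forall>\<^sub>F e in at_right (0 :: real). \<forall>w\<in>W. (q + e *\<^sub>R g t) \<bullet> w \<noteq> 0 \<and> (q \<bullet> w < 0 \<longrightarrow> (q + e *\<^sub>R g t) \<bullet> w < 0)"
    using ev assms(1) by (simp add: eventually_ball_finite)
  then obtain e :: real where "\<forall>w\<in>W. (q + e *\<^sub>R g t) \<bullet> w \<noteq> 0 \<and> (q \<bullet> w < 0 \<longrightarrow> (q + e *\<^sub>R g t) \<bullet> w < 0)"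
    using eventually_happens[of _ "at_right (0::real)"] by auto
  with that show thesis by blast
qed

lemma det3_cyc: "a \<bullet> cross3 b c = b \<bullet> cross3 c a" "a \<bullet> cross3 b c = - (a \<bullet> cross3 c b)" "a \<bullet> cross3 a b = 0" "a \<bullet> cross3 b a = 0"
  by (simp_all add: cross3_simps)

lemma in_plane:
  fixes a b c :: "real^3"
  assumes "cross3 a b \<noteq> 0" "c \<bullet> cross3 a b = 0"
  obtains x y where "c = x *\<^sub>R a + y *\<^sub>R b"
proof -
  let ?n = "cross3 a b"
  have n: "?n \<bullet> ?n \<noteq> 0" using assms by simp
  have "(?n \<bullet> ?n) *\<^sub>R c = (c \<bullet> cross3 b ?n) *\<^sub>R a + (c \<bullet> cross3 ?n a) *\<^sub>R b + (c \<bullet> ?n) *\<^sub>R ?n"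
    by (simp add: cross3_simps forall_3)
  then have "(1 / (?n \<bullet> ?n)) *\<^sub>R ((?n \<bullet> ?n) *\<^sub>R c)
      = (1 / (?n \<bullet> ?n)) *\<^sub>R ((c \<bullet> cross3 b ?n) *\<^sub>R a + (c \<bullet> cross3 ?n a) *\<^sub>R b)" using assms by simp
  then have "c = ((c \<bullet> cross3 b ?n) / (?n \<bullet> ?n)) *\<^sub>R a + ((c \<bullet> cross3 ?n a) / (?n \<bullet> ?n)) *\<^sub>R b"
    using n by (simp add: scaleR_add_right)
  with that show thesis by blast
qed

text \<open>Read in the dual plane: \<open>p\<close> is a line \<open>L\<close> of an arrangement and \<open>{a, b}\<close> is a simple
  vertex that is the apex of a triangular face with base on \<open>L\<close>; the signs of \<open>x\<close> and \<open>y\<close> select one of the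
  four sectors at that vertex.\<close>

definition apex :: "(real^3) set \<Rightarrow> real^3 \<Rightarrow> real^3 \<Rightarrow> real^3 \<Rightarrow> real \<Rightarrow> real \<Rightarrow> bool" where
  "apex P p a b x y \<longleftrightarrow> x \<noteq> 0 \<and> y \<noteq> 0 \<and> (\<forall>a'\<in>P. \<forall>b'\<in>P. p \<bullet> cross3 a' b' \<noteq> 0 \<longrightarrow>
     (\<forall>t. cross3 a' b' \<noteq> t *\<^sub>R cross3 a b) \<longrightarrow>
     ((x *\<^sub>R a + y *\<^sub>R b) \<bullet> cross3 a' b') * (p \<bullet> cross3 a' b') * (p \<bullet> cross3 a b) > 0)"

lemma apexD:
  assumes "apex P p a b x y" "a' \<in> P" "b' \<in> P" "p \<bullet> cross3 a' b' \<noteq> 0"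
    "\<And>t. cross3 a' b' \<noteq> t *\<^sub>R cross3 a b"
  shows "((x *\<^sub>R a + y *\<^sub>R b) \<bullet> cross3 a' b') * (p \<bullet> cross3 a' b') * (p \<bullet> cross3 a b) > 0"
  using assms unfolding apex_def by blast

text \<open>Test each base against the vertices where the other base meets \<open>a\<close> and
  \<open>b\<close>. The two strict inequalities would have a product equal to a negative number
  times a square, so each such vertex lies on both bases; two lines sharing two points
  coincide.\<close>

lemma apex_unique:
  assumes P: "\<And>a b. a \<in> P \<Longrightarrow> b \<in> P \<Longrightarrow> a \<noteq> b \<Longrightarrow> cross3 a b \<noteq> 0"
    and o: "ordinary P a b" and p: "p \<in> P - {a, b}" "p' \<in> P - {a, b}"
    and ap: "apex P p a b x y" "apex P p' a b x' y'" and s: "sgn x = sgn x'" "sgn y = sgn y'"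
  shows "p = p'"
proof (rule ccontr)
  assume ne: "p \<noteq> p'"
  let ?N = "cross3 a b"
  have ab: "a \<in> P" "b \<in> P" using o by (auto simp: ordinary_def)
  have N: "p \<bullet> ?N \<noteq> 0" "p' \<bullet> ?N \<noteq> 0" using o p by (auto simp: ordinary_def)
  define u where "u = p \<bullet> cross3 a p'"
  define v where "v = p \<bullet> cross3 b p'"
  have par: "cross3 a p' \<noteq> t *\<^sub>R ?N" "cross3 b p' \<noteq> t *\<^sub>R ?N" if "t *\<^sub>R ?N \<noteq> 0" for t
    using N(2) that det3_cyc(4)[of p'] by (metis inner_scaleR_right mult_eq_0_iff scaleR_eq_0_iff)+
  have par': "cross3 a p \<noteq> t *\<^sub>R ?N" "cross3 b p \<noteq> t *\<^sub>R ?N" if "t *\<^sub>R ?N \<noteq> 0" for t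
    using N(1) that det3_cyc(4)[of p] by (metis inner_scaleR_right mult_eq_0_iff scaleR_eq_0_iff)+
  have xs: "x * x' > 0" "y * y' > 0"
    using s ap by (auto simp: apex_def sgn_if zero_less_mult_iff split: if_splits)
  have e: "(x *\<^sub>R a + y *\<^sub>R b) \<bullet> cross3 a p' = - y * (p' \<bullet> ?N)"
    "(x *\<^sub>R a + y *\<^sub>R b) \<bullet> cross3 b p' = x * (p' \<bullet> ?N)"
    "(x' *\<^sub>R a + y' *\<^sub>R b) \<bullet> cross3 a p = - y' * (p \<bullet> ?N)"
    "(x' *\<^sub>R a + y' *\<^sub>R b) \<bullet> cross3 b p = x' * (p \<bullet> ?N)"
    "p' \<bullet> cross3 a p = - u" "p' \<bullet> cross3 b p = - v"
    by (simp_all add: u_def v_def cross3_simps)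
  have u0: "u = 0"
  proof (rule ccontr)
    assume "u \<noteq> 0"
    then have nt: "cross3 a p' \<noteq> t *\<^sub>R ?N" "cross3 a p \<noteq> t *\<^sub>R ?N" for t
      using par[of t] par'[of t] e(5) by (cases "t *\<^sub>R ?N = 0"; force simp: u_def)+
    have "(- y * (p' \<bullet> ?N)) * u * (p \<bullet> ?N) > 0" "(- y' * (p \<bullet> ?N)) * (- u) * (p' \<bullet> ?N) > 0"
      using apexD[OF ap(1) ab(1), of p'] apexD[OF ap(2) ab(1), of p] p \<open>u \<noteq> 0\<close> nt
      unfolding e(1,3,5) by (simp_all add: u_def)
    then have "((- y * (p' \<bullet> ?N)) * u * (p \<bullet> ?N)) * ((- y' * (p \<bullet> ?N)) * (- u) * (p' \<bullet> ?N)) > 0" by (rule mult_pos_pos)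
    also have "((- y * (p' \<bullet> ?N)) * u * (p \<bullet> ?N)) * ((- y' * (p \<bullet> ?N)) * (- u) * (p' \<bullet> ?N)) = - (y * y') * (u * (p' \<bullet> ?N) * (p \<bullet> ?N))\<^sup>2"
      by (simp add: power2_eq_square algebra_simps)
    also have "\<dots> \<le> 0" using xs by (simp add: mult_nonneg_nonneg)
    finally show False by simp
  qed
  have v0: "v = 0"
  proof (rule ccontr)
    assume "v \<noteq> 0"
    then have nt: "cross3 b p' \<noteq> t *\<^sub>R ?N" "cross3 b p \<noteq> t *\<^sub>R ?N" for t
      using par[of t] par'[of t] e(6) by (cases "t *\<^sub>R ?N = 0"; force simp: v_def)+
    have "(x * (p' \<bullet> ?N)) * v * (p \<bullet> ?N) > 0" "(x' * (p \<bullet> ?N)) * (- v) * (p' \<bullet> ?N) > 0"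
      using apexD[OF ap(1) ab(2), of p'] apexD[OF ap(2) ab(2), of p] p \<open>v \<noteq> 0\<close> nt
      unfolding e(2,4,6) by (simp_all add: v_def)
    then have "((x * (p' \<bullet> ?N)) * v * (p \<bullet> ?N)) * ((x' * (p \<bullet> ?N)) * (- v) * (p' \<bullet> ?N)) > 0" by (rule mult_pos_pos)
    also have "((x * (p' \<bullet> ?N)) * v * (p \<bullet> ?N)) * ((x' * (p \<bullet> ?N)) * (- v) * (p' \<bullet> ?N)) = - (x * x') * (v * (p' \<bullet> ?N) * (p \<bullet> ?N))\<^sup>2"
      by (simp add: power2_eq_square algebra_simps)
    also have "\<dots> \<le> 0" using xs by (simp add: mult_nonneg_nonneg)
    finally show False by simp
  qed
  have "(p \<bullet> ?N) *\<^sub>R cross3 p' p = (a \<bullet> cross3 p' p) *\<^sub>R cross3 b p + (b \<bullet> cross3 p' p) *\<^sub>R cross3 p a"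
    by (simp add: cross3_simps)
  moreover have "a \<bullet> cross3 p' p = u" "b \<bullet> cross3 p' p = v" by (simp_all add: u_def v_def cross3_simps)
  ultimately have "cross3 p' p = 0" using u0 v0 N(1) by simp
  then show False using P[of p' p] p ne by auto
qed

text \<open>Dually, the line \<open>p\<close> is sent to infinity by scaling vertices
  \<open>m\<close> to \<open>p \<bullet> m = 1\<close>, and a vertex is chosen that minimises a
  generic perturbation of \<open>q\<close> or \<open>- q\<close>. If just two lines pass through it,
  it is an apex over \<open>p\<close>; if three do, a sign contradiction produces an ordinary vertex
  on \<open>p\<close> itself.\<close>

lemma ordinary_near:
  assumes fin: "finite P" and P: "\<And>a b. a \<in> P \<Longrightarrow> b \<in> P \<Longrightarrow> a \<noteq> b \<Longrightarrow> cross3 a b \<noteq> 0"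
    and pq: "p \<in> P" "q \<in> P" "p \<noteq> q"
    and ab: "a \<in> P" "b \<in> P" "p \<bullet> cross3 a b \<noteq> 0" "q \<bullet> cross3 a b \<noteq> 0"
  shows "(\<exists>a\<in>P - {q}. ordinary P p a) \<or> (\<exists>a b x y. ordinary P a b \<and> q \<notin> {a, b} \<and> p \<notin> {a, b} \<and> apex P p a b x y)"
proof -
  define nrm where "nrm = (\<lambda>m::real^3. (1 / (p \<bullet> m)) *\<^sub>R m)"
  define M where "M = {m. \<exists>a\<in>P. \<exists>b\<in>P. m = cross3 a b \<and> p \<bullet> m \<noteq> 0}"
  define V where "V = nrm ` M"
  have "M \<subseteq> (\<lambda>(a, b). cross3 a b) ` (P \<times> P)" by (auto simp: M_def)
  then have finV: "finite V" unfolding V_def using fin finite_subset by blast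
  have pV: "p \<bullet> v = 1" if "v \<in> V" for v using that by (auto simp: V_def nrm_def M_def)
  \<comment> \<open>Differences of vertices make the minimiser unique; the vectors
    \<open>cross3 p a\<close> keep the level lines of the functional from being parallel to any line
    \<open>a\<close>.\<close>
  define W where "W = (\<lambda>(v, v'). v - v') ` (V \<times> V) - {0} \<union> (\<lambda>a. cross3 p a) ` (P - {p})"
  have W: "finite W" "0 \<notin> W" using fin finV P[OF pq(1)] by (auto simp: W_def) metis
  let ?v = "nrm (cross3 a b)"
  have vV: "?v \<in> V" using ab by (auto simp: V_def M_def)
  have qv: "q \<bullet> ?v \<noteq> 0" using ab by (simp add: nrm_def)
  \<comment> \<open>The sign makes the given vertex off \<open>q\<close> negative, so a vertex on
    \<open>q\<close>, where the value is 0, cannot be minimal.\<close>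
  define q' where "q' = (if q \<bullet> ?v < 0 then q else - q)"
  have q'v: "q' \<bullet> ?v < 0" using qv by (auto simp: q'_def)
  obtain c where c: "\<And>w. w \<in> W \<Longrightarrow> c \<bullet> w \<noteq> 0" "\<And>w. w \<in> W \<Longrightarrow> q' \<bullet> w < 0 \<Longrightarrow> c \<bullet> w < 0"
    using perturb[OF W] by blast
  obtain v0 where v0: "v0 \<in> V" "\<And>v. v \<in> V \<Longrightarrow> c \<bullet> v0 \<le> c \<bullet> v"
    using ex_min_if_finite[of "(\<lambda>v. c \<bullet> v) ` V"] finV vV
    by (metis (no_types, lifting) arg_min_if_finite(1) arg_min_least empty_iff)
  have lt: "c \<bullet> v0 < c \<bullet> v" if "v \<in> V" "v \<noteq> v0" for v
  proof -
    have "v - v0 \<in> W" using that v0 unfolding W_def by (intro UnI1 DiffI image_eqI[of _ _ "(v, v0)"]) auto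
    from c(1)[OF this] v0(2)[OF that(1)] show ?thesis by (simp add: inner_diff_right)
  qed
  have qv0: "q \<bullet> v0 \<noteq> 0"
  proof
    assume q0: "q \<bullet> v0 = 0"
    then have "?v \<noteq> v0" using qv by auto
    then have "?v - v0 \<in> W" using vV v0 unfolding W_def by (intro UnI1 DiffI image_eqI[of _ _ "(?v, v0)"]) auto
    moreover have "q' \<bullet> (?v - v0) < 0" using q0 q'v by (simp add: inner_diff_right q'_def split: if_splits)
    ultimately have "c \<bullet> (?v - v0) < 0" by (rule c(2))
    then show False using v0(2)[OF vV] by (simp add: inner_diff_right)
  qed
  \<comment> \<open>A multiple of \<open>p\<close> is constant on the chart
    \<open>p \<bullet> m = 1\<close>; the shifted functional vanishes at \<open>v0\<close> and is
    positive at all other vertices.\<close>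
  define c0 where "c0 = c - (c \<bullet> v0) *\<^sub>R p"
  have c0v: "c0 \<bullet> v0 = 0" "\<And>v. v \<in> V \<Longrightarrow> v \<noteq> v0 \<Longrightarrow> c0 \<bullet> v > 0"
    using pV v0 lt by (auto simp: c0_def inner_diff_left)
  obtain m where m: "m \<in> M" "v0 = nrm m" using v0 by (auto simp: V_def)
  have pm: "p \<bullet> m \<noteq> 0" using m by (simp add: M_def)
  have perp: "x \<bullet> v0 = 0 \<longleftrightarrow> x \<bullet> m = 0" for x using pm m by (simp add: nrm_def)
  obtain a1 a2 where a: "a1 \<in> P" "a2 \<in> P" "m = cross3 a1 a2" using m by (auto simp: M_def)
  have c0m: "c0 \<bullet> m = 0" using c0v perp by simp
  have mpos: "(c0 \<bullet> m') * (p \<bullet> m') > 0" if m': "m' \<in> M" "\<And>t. m' \<noteq> t *\<^sub>R m" for m'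
  proof -
    have "nrm m' \<noteq> v0"
    proof
      assume "nrm m' = v0"
      then have "(p \<bullet> m') *\<^sub>R nrm m' = (p \<bullet> m') *\<^sub>R nrm m" using m by simp
      then have "m' = ((p \<bullet> m') / (p \<bullet> m)) *\<^sub>R m" using m' by (simp add: nrm_def M_def)
      with m' show False by blast
    qed
    then have "c0 \<bullet> nrm m' > 0" using c0v m' by (simp add: V_def)
    then have "(c0 \<bullet> m') / (p \<bullet> m') > 0" by (simp add: nrm_def)
    then show ?thesis by (simp add: zero_less_divide_iff zero_less_mult_iff)
  qed
  have tau: "c0 \<bullet> cross3 x p \<noteq> 0" if "x \<in> P" "x \<noteq> p" for x
  proof -
    have "c \<bullet> cross3 p x \<noteq> 0" using that by (intro c(1)) (auto simp: W_def)
    then show ?thesis by (simp add: c0_def inner_diff_left det3_cyc(4)) (simp add: det3_cyc(2)[of c p x])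
  qed
  have a12: "a1 \<noteq> a2" "a1 \<noteq> p" "a2 \<noteq> p" using pm a(3) by (auto simp: det3_cyc(3,4))
  have m0: "a1 \<bullet> m = 0" "a2 \<bullet> m = 0" using a(3) by (simp_all add: det3_cyc(3,4))
  show ?thesis
  proof (cases "ordinary P a1 a2")
    case True
    have "q \<notin> {a1, a2}" using qv0 m0 perp by auto
    have "cross3 a1 a2 \<noteq> 0" using a(3) pm by auto
    then obtain x y where xy: "c0 = x *\<^sub>R a1 + y *\<^sub>R a2"
      using in_plane[of a1 a2 c0] c0m a(3) by metis
    have "x \<noteq> 0" using tau[OF a(2) a12(3)] xy by (auto simp: det3_cyc(3,4))
    have "y \<noteq> 0" using tau[OF a(1) a12(2)] xy by (auto simp: det3_cyc(3,4))
    \<comment> \<open>The factor \<open>p \<bullet> m\<close> fixes the orientation, as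
      \<open>apex\<close> refers to the vertex \<open>m\<close> before normalisation.\<close>
    have "apex P p a1 a2 ((p \<bullet> m) * x) ((p \<bullet> m) * y)"
      unfolding apex_def a(3)[symmetric]
    proof (intro conjI ballI impI)
      fix a' b' assume ab': "a' \<in> P" "b' \<in> P" "p \<bullet> cross3 a' b' \<noteq> 0" "\<forall>t. cross3 a' b' \<noteq> t *\<^sub>R m"
      let ?m = "cross3 a' b'"
      have "?m \<in> M" using ab' by (auto simp: M_def)
      then have "(c0 \<bullet> ?m) * (p \<bullet> ?m) * (p \<bullet> m)\<^sup>2 > 0" using mpos ab' pm by simp
      moreover have "((p \<bullet> m) * x) *\<^sub>R a1 + ((p \<bullet> m) * y) *\<^sub>R a2 = (p \<bullet> m) *\<^sub>R c0"
        using xy by (simp add: scaleR_add_right)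
      ultimately show "(((p \<bullet> m) * x) *\<^sub>R a1 + ((p \<bullet> m) * y) *\<^sub>R a2) \<bullet> ?m * (p \<bullet> ?m) * (p \<bullet> m) > 0"
        by (simp add: power2_eq_square algebra_simps)
    qed (use pm \<open>x \<noteq> 0\<close> \<open>y \<noteq> 0\<close> in auto)
    then show ?thesis using True \<open>q \<notin> {a1, a2}\<close> a12 by blast
  next
    case False
    then obtain a3 where a3: "a3 \<in> P" "a3 \<noteq> a1" "a3 \<noteq> a2" "a3 \<bullet> m = 0"
      using a a12 by (auto simp: ordinary_def)
    have a3p: "a3 \<noteq> p" using a3 pm by auto
    \<comment> \<open>A further point on the line through \<open>p\<close> and \<open>x\<close> makes \<open>c0 \<bullet> cross3 y p / p \<bullet> cross3 y x\<close>
      have the same sign for all other points \<open>y\<close> on the line of \<open>a1, a2, a3\<close>.\<close>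
    have key: "\<exists>r. \<forall>y\<in>P. y \<bullet> m = 0 \<longrightarrow> y \<noteq> x \<longrightarrow> r * ((c0 \<bullet> cross3 y p) * (p \<bullet> cross3 y x)) > 0"
      if x: "x \<in> P" "x \<bullet> m = 0" and no: "\<not> ordinary P p x" for x
    proof -
      have xp: "x \<noteq> p" using x pm by auto
      obtain x' where x': "x' \<in> P" "x' \<noteq> p" "x' \<noteq> x" "x' \<bullet> cross3 p x = 0"
        using no x xp pq by (auto simp: ordinary_def)
      have px: "cross3 p x \<noteq> 0" using P[OF pq(1) x(1)] xp by auto
      obtain \<beta> \<alpha> where e: "x' = \<beta> *\<^sub>R p + \<alpha> *\<^sub>R x" using in_plane[OF px x'(4)] by metis
      have "\<alpha> \<noteq> 0" using P[OF x'(1) pq(1) x'(2)] e by (auto simp: cross_mult_left)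
      have "\<beta> \<noteq> 0" using P[OF x'(1) x(1) x'(3)] e by (auto simp: cross_mult_left)
      have "\<alpha> * \<beta> * ((c0 \<bullet> cross3 y p) * (p \<bullet> cross3 y x)) > 0" if y: "y \<in> P" "y \<bullet> m = 0" "y \<noteq> x" for y
      proof -
        have yp: "y \<noteq> p" using y pm by auto
        have yx: "cross3 y x \<noteq> 0" using P y x by auto
        \<comment> \<open>both \<open>m\<close> and \<open>cross3 y x\<close> are normal to the plane of \<open>x\<close> and \<open>y\<close>\<close>
        have n: "(p \<bullet> m) *\<^sub>R cross3 y x = (p \<bullet> cross3 y x) *\<^sub>R m"
        proof -
          have "cross3 m (cross3 y x) = (m \<bullet> x) *\<^sub>R y - (m \<bullet> y) *\<^sub>R x"
            by (simp add: cross3_simps forall_3)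
          then have "cross3 m (cross3 y x) = 0" using y x by (simp add: inner_commute)
          moreover have "cross3 p (cross3 m (cross3 y x)) = (p \<bullet> cross3 y x) *\<^sub>R m - (p \<bullet> m) *\<^sub>R cross3 y x"
            by (simp add: cross3_simps) (metis exhaust_3)
          ultimately show ?thesis by simp
        qed
        have pyx: "p \<bullet> cross3 y x \<noteq> 0" using n pm yx by auto
        have "(p \<bullet> m) * (c0 \<bullet> cross3 y x) = c0 \<bullet> ((p \<bullet> cross3 y x) *\<^sub>R m)" using n by (metis inner_scaleR_right)
        then have cyx: "c0 \<bullet> cross3 y x = 0" using c0m pm by simp
        have c1: "c0 \<bullet> cross3 y x' = \<beta> * (c0 \<bullet> cross3 y p)" and p1: "p \<bullet> cross3 y x' = \<alpha> * (p \<bullet> cross3 y x)"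
          using cyx by (simp_all add: e cross_add_right cross_mult_right inner_add_right det3_cyc(4))
        have "cross3 y x' \<in> M" using y x' p1 pyx \<open>\<alpha> \<noteq> 0\<close> by (auto simp: M_def)
        moreover have "cross3 y x' \<noteq> t *\<^sub>R m" for t
          using c1 c0m tau[OF y(1) yp] \<open>\<beta> \<noteq> 0\<close> by auto
        ultimately have "(c0 \<bullet> cross3 y x') * (p \<bullet> cross3 y x') > 0" using mpos by blast
        then show ?thesis unfolding c1 p1 by (simp add: algebra_simps)
      qed
      then show ?thesis by blast
    qed
    have "\<exists>x\<in>{a1, a2, a3}. ordinary P p x"
    proof (rule ccontr)
      assume no: "\<not> ?thesis"
      define T where "T = (\<lambda>x. c0 \<bullet> cross3 x p)"
      define d where "d = (\<lambda>x y. p \<bullet> cross3 x y)"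
      have anti: "d x y = - d y x" for x y unfolding d_def by (rule det3_cyc)
      have prod: "(T y * d y x) * (T z * d z x) > 0"
        if "x \<in> {a1, a2, a3}" "y \<in> {a1, a2, a3}" "z \<in> {a1, a2, a3}" "y \<noteq> x" "z \<noteq> x" for x y z
      proof -
        have x: "x \<in> P" "x \<bullet> m = 0" and y: "y \<in> P" "y \<bullet> m = 0" and z: "z \<in> P" "z \<bullet> m = 0"
          using that a a3 m0 by auto
        have "\<not> ordinary P p x" using no that(1) by blast
        then obtain r where r: "\<forall>y\<in>P. y \<bullet> m = 0 \<longrightarrow> y \<noteq> x \<longrightarrow> r * (T y * d y x) > 0"
          using key[OF x] unfolding T_def d_def by blast
        have "r * (T y * d y x) > 0" "r * (T z * d z x) > 0" using r y z that(4,5) by blast+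
        then show ?thesis unfolding zero_less_mult_iff[of r] zero_less_mult_iff[of "T y * d y x"] by linarith
      qed
      \<comment> \<open>Any two of these three numbers will have a negative product, which is
        impossible for reals.\<close>
      let ?X = "T a1 * d a2 a3" and ?Y = "T a2 * d a3 a1" and ?Z = "T a3 * d a1 a2"
      have "?X * ?Z < 0" using prod[of a2 a1 a3] a3 a12 anti[of a3 a2] by (simp add: algebra_simps)
      moreover have "?Y * ?Z < 0" using prod[of a1 a2 a3] a3 a12 anti[of a2 a1] by (simp add: algebra_simps)
      moreover have "?X * ?Y < 0" using prod[of a3 a1 a2] a3 a12 anti[of a1 a3] by (simp add: algebra_simps)
      moreover have False if "X * Z < 0" "Y * Z < 0" "X * Y < 0" for X Y Z :: real
        using that by (auto simp: mult_less_0_iff)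
      ultimately show False by blast
    qed
    moreover have "q \<notin> {a1, a2, a3}" using qv0 m0 a3 perp by auto
    ultimately show ?thesis using a a3 by blast
  qed
qed

text \<open>Charge each point to a pair supplied by \<open>ordinary_near\<close>. A pair is charged
  at most 10 times: by its own two points, and by one base for each of four sectors, for both orders
  of the pair. The 4 accounts for \<open>a\<close>, \<open>b\<close>, \<open>c\<close>,
  \<open>q\<close>, for which no pair is sought.\<close>

lemma many_ordinary:
  assumes fin: "finite P" and P: "\<And>a b. a \<in> P \<Longrightarrow> b \<in> P \<Longrightarrow> a \<noteq> b \<Longrightarrow> cross3 a b \<noteq> 0"
    and q: "q \<in> P" and abc: "a \<in> P - {q}" "b \<in> P - {q}" "c \<in> P - {q}" "a \<bullet> cross3 b c \<noteq> 0"
  shows "card P \<le> 10 * card {e. \<exists>x y. e = {x, y} \<and> ordinary P x y \<and> q \<notin> e} + 4"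
proof -
  define E where "E = {e. \<exists>x y. e = {x, y} \<and> ordinary P x y \<and> q \<notin> e}"
  have finE: "finite E"
    by (rule finite_subset[of _ "Pow P"]) (use fin in \<open>auto simp: E_def ordinary_def\<close>)
  define R where "R e = {p \<in> P. p \<in> e \<or> (\<exists>x y u v. e = {x, y} \<and> p \<notin> e \<and> apex P p x y u v)}" for e
  have cardR: "card (R e) \<le> 10" if e: "e \<in> E" for e
  proof -
    obtain x y where xy: "e = {x, y}" "ordinary P x y" using e by (auto simp: E_def)
    have yx: "ordinary P y x" using xy(2) by (auto simp: ordinary_def det3_cyc(2)[of _ y x])
    define A where "A x y = {p \<in> P - {x, y}. \<exists>u v. apex P p x y u v}" for x y
    have A: "card (A x y) \<le> 4 \<and> finite (A x y)" if o: "ordinary P x y" for x y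
    proof -
      have "\<forall>p\<in>A x y. \<exists>uv. apex P p x y (fst uv) (snd uv)" by (auto simp: A_def)
      then obtain f where f: "\<And>p. p \<in> A x y \<Longrightarrow> apex P p x y (fst (f p)) (snd (f p))" by metis
      define g where "g p = (sgn (fst (f p)), sgn (snd (f p)))" for p
      have "inj_on g (A x y)"
        by (intro inj_onI apex_unique[OF P o _ _ f f]) (auto simp: g_def A_def)
      moreover have "g ` A x y \<subseteq> {-1, 1} \<times> {-1, 1}"
        using f by (force simp: g_def apex_def sgn_real_def)
      ultimately have "card (A x y) \<le> card ({-1, 1 :: real} \<times> {-1, 1 :: real})"
        by (intro card_inj_on_le[of g]) auto
      moreover have "finite (A x y)" using fin by (simp add: A_def)
      ultimately show ?thesis by (simp add: card_cartesian_product)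
    qed
    have "R e \<subseteq> {x, y} \<union> A x y \<union> A y x"
      by (auto simp: R_def A_def xy(1) doubleton_eq_iff)
    then have "card (R e) \<le> card ({x, y} \<union> A x y \<union> A y x)"
      using A[OF xy(2)] A[OF yx] by (intro card_mono) auto
    also have "\<dots> \<le> card {x, y} + card (A x y) + card (A y x)"
      by (meson add_mono card_Un_le le_trans order_refl)
    also have "card {x, y} \<le> 2" by (simp add: card_insert_if)
    finally show ?thesis using A[OF xy(2)] A[OF yx] by linarith
  qed
  have sub: "P \<subseteq> {a, b, c, q} \<union> (\<Union>e\<in>E. R e)"
  proof
    fix p assume p: "p \<in> P"
    show "p \<in> {a, b, c, q} \<union> (\<Union>e\<in>E. R e)"
    proof (cases "p \<in> {a, b, c, q}")
      case False
      \<comment> \<open>A point other than \<open>a\<close>, \<open>b\<close>, \<open>c\<close> lies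
        on at most one side of their triangle, so \<open>p\<close> and \<open>q\<close> together
        leave a side that contains neither.\<close>
      have ndet: "x \<bullet> cross3 a b \<noteq> 0 \<or> x \<bullet> cross3 b c \<noteq> 0"
        "x \<bullet> cross3 a b \<noteq> 0 \<or> x \<bullet> cross3 c a \<noteq> 0" "x \<bullet> cross3 b c \<noteq> 0 \<or> x \<bullet> cross3 c a \<noteq> 0"
        if x: "x \<in> P - {a, b, c}" for x
      proof -
        have i: "cross3 b (cross3 (cross3 a b) (cross3 b c)) = 0"
          "(a \<bullet> cross3 b c) *\<^sub>R cross3 x b = (x \<bullet> cross3 b c) *\<^sub>R cross3 a b - (x \<bullet> cross3 a b) *\<^sub>R cross3 b c"
          "(a \<bullet> cross3 b c) *\<^sub>R cross3 x a = (x \<bullet> cross3 a b) *\<^sub>R cross3 c a - (x \<bullet> cross3 c a) *\<^sub>R cross3 a b"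
          "(a \<bullet> cross3 b c) *\<^sub>R cross3 x c = (x \<bullet> cross3 c a) *\<^sub>R cross3 b c - (x \<bullet> cross3 b c) *\<^sub>R cross3 c a"
          by (simp_all add: cross3_simps)
        have "cross3 x a \<noteq> 0" "cross3 x b \<noteq> 0" "cross3 x c \<noteq> 0" using P x abc by auto
        then show "x \<bullet> cross3 a b \<noteq> 0 \<or> x \<bullet> cross3 b c \<noteq> 0"
          "x \<bullet> cross3 a b \<noteq> 0 \<or> x \<bullet> cross3 c a \<noteq> 0" "x \<bullet> cross3 b c \<noteq> 0 \<or> x \<bullet> cross3 c a \<noteq> 0"
          using i abc(4) by auto
      qed
      have "\<exists>x\<in>P. \<exists>y\<in>P. p \<bullet> cross3 x y \<noteq> 0 \<and> q \<bullet> cross3 x y \<noteq> 0"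
        using ndet[of p] ndet[of q] False p q abc by blast
      then obtain x y where "x \<in> P" "y \<in> P" "p \<bullet> cross3 x y \<noteq> 0" "q \<bullet> cross3 x y \<noteq> 0" by blast
      moreover have "p \<noteq> q" using False by simp
      ultimately have "(\<exists>a\<in>P - {q}. ordinary P p a) \<or> (\<exists>a b x y. ordinary P a b \<and> q \<notin> {a, b} \<and> p \<notin> {a, b} \<and> apex P p a b x y)"
        using ordinary_near[OF fin P p q] by blast
      then have "\<exists>e\<in>E. p \<in> R e"
      proof (elim disjE exE bexE conjE)
        fix a assume "ordinary P p a" "a \<in> P - {q}"
        then have "{p, a} \<in> E" "p \<in> R {p, a}" using False p by (auto simp: E_def R_def)
        then show ?thesis by blast
      next
        fix a b x y assume "ordinary P a b" "q \<notin> {a, b}" "p \<notin> {a, b}" "apex P p a b x y"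
        then have "{a, b} \<in> E" "p \<in> R {a, b}" using False p unfolding E_def R_def by blast+
        then show ?thesis by blast
      qed
      then show ?thesis by blast
    qed blast
  qed
  have "finite (\<Union>e\<in>E. R e)" using finE fin by (auto simp: R_def)
  then have "card P \<le> card ({a, b, c, q} \<union> (\<Union>e\<in>E. R e))" using sub by (intro card_mono) auto
  also have "\<dots> \<le> card {a, b, c, q} + card (\<Union>e\<in>E. R e)" by (rule card_Un_le)
  also have "card {a, b, c, q} \<le> 4" by (simp add: card_insert_if)
  also have "card (\<Union>e\<in>E. R e) \<le> (\<Sum>e\<in>E. card (R e))" by (rule card_UN_le[OF finE])
  also have "(\<Sum>e\<in>E. card (R e)) \<le> 10 * card E" using sum_bounded_above[of E "\<lambda>e. card (R e)" 10] cardR by simp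
  finally show ?thesis by (simp add: E_def)
qed

section \<open>The net of curves through a set of points\<close>

lemma ev_sum: "ev f (x, y) = (\<Sum>i\<le>degree f. poly (coeff f i) y * x ^ i)"
  by (simp add: ev_def poly_altdef[of f] poly_sum poly_mult poly_power)

lemma ev_poly2:
  assumes "f \<in> Pol (int d)"
  shows "poly2_eval d (cf f) p = ev f p"
proof -
  obtain x y where p: "p = (x, y)" by (cases p)
  have z: "cf f i j = 0" if "d < i + j" for i j using assms that unfolding Pol_def by force
  have "coeff f i = 0" if "d < i" for i
    by (rule poly_eqI) (use z that in simp)
  then have di: "degree f \<le> d" by (intro degree_le) auto
  have dj: "degree (coeff f i) \<le> d" for i by (rule degree_le) (use z in auto)
  have "ev f p = (\<Sum>i\<le>d. poly (coeff f i) y * x ^ i)"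
    unfolding p ev_sum by (rule sum.mono_neutral_left) (use di in \<open>auto simp: coeff_eq_0\<close>)
  also have "\<dots> = (\<Sum>i\<le>d. \<Sum>j\<le>d. cf f i j * x ^ i * y ^ j)"
  proof (rule sum.cong)
    fix i
    have "poly (coeff f i) y = (\<Sum>j\<le>d. cf f i j * y ^ j)"
      unfolding poly_altdef by (rule sum.mono_neutral_left) (use dj in \<open>auto simp: coeff_eq_0\<close>)
    then show "poly (coeff f i) y * x ^ i = (\<Sum>j\<le>d. cf f i j * x ^ i * y ^ j)"
      by (simp add: sum_distrib_left sum_distrib_right algebra_simps)
  qed simp
  finally show ?thesis by (simp add: poly2_eval_def p)
qed

lemma curves_iff:
  "C \<in> curves d \<longleftrightarrow> (\<exists>f\<in>Pol (int d). f \<notin> Pol (int d - 1) \<and> C = {p. ev f p = 0})"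
proof
  assume "C \<in> curves d"
  then obtain c where c: "poly2_deg d c" "C = {p. poly2_eval d c p = 0}" by (auto simp: curves_def)
  define f :: bipoly where "f = (\<Sum>i\<le>d. monom (\<Sum>j\<le>d. monom (c i j) j) i)"
  have z: "c i j = 0" if "d < i + j" for i j using c(1) that by (simp add: poly2_deg_def)
  have cf: "cf f i j = c i j" for i j
    using z[of i j] by (auto simp: f_def coeff_sum)
  have f: "f \<in> Pol (int d)" using z by (auto simp: Pol_def cf not_less simp flip: of_nat_add intro: ccontr)
  obtain i j where "i + j = d" "c i j \<noteq> 0" using c(1) by (auto simp: poly2_deg_def)
  then have "\<not> (cf f i j \<noteq> 0 \<longrightarrow> int i + int j \<le> int d - 1)" unfolding cf by auto
  then have "f \<notin> Pol (int d - 1)" unfolding Pol_def by blast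
  moreover have "cf f = c" using cf by blast
  then have "C = {p. ev f p = 0}" using c(2) ev_poly2[OF f] by simp
  ultimately show "\<exists>f\<in>Pol (int d). f \<notin> Pol (int d - 1) \<and> C = {p. ev f p = 0}" using f by blast
next
  assume "\<exists>f\<in>Pol (int d). f \<notin> Pol (int d - 1) \<and> C = {p. ev f p = 0}"
  then obtain f where f: "f \<in> Pol (int d)" "f \<notin> Pol (int d - 1)" "C = {p. ev f p = 0}" by blast
  then have "\<exists>i j. cf f i j \<noteq> 0 \<and> int i + int j \<le> int d \<and> \<not> int i + int j \<le> int d - 1"
    unfolding Pol_def by blast
  then have "\<exists>i j. i + j = d \<and> cf f i j \<noteq> 0" by force
  moreover have "\<forall>i j. d < i + j \<longrightarrow> cf f i j = 0" using f(1) unfolding Pol_def by force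
  ultimately have "poly2_deg d (cf f)" by (simp add: poly2_deg_def)
  moreover have "C = {p. poly2_eval d (cf f) p = 0}" using f(3) ev_poly2[OF f(1)] by simp
  ultimately show "C \<in> curves d" unfolding curves_def by blast
qed

lemma ex_tdeg: "\<exists>g. g \<noteq> 0 \<and> tdeg g = k"
proof -
  let ?g = "monom 1 k :: bipoly"
  have c: "cf ?g i j = (if i = k \<and> j = 0 then 1 else 0)" for i j by (simp add: coeff_1)
  have g: "?g \<noteq> 0" by simp
  have "?g \<in> Pol (int k)" "?g \<notin> Pol (int k - 1)" unfolding Pol_def c by auto
  then show ?thesis using Pol_iff[OF g] by (intro exI[of _ ?g]) auto
qed

text \<open>A nonzero polynomial of smaller degree vanishing on \<open>A\<close> can be padded with
  a factor to degree exactly \<open>d\<close>, so excluding exact degree \<open>d\<close> excludes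
  all lower degrees as well.\<close>

lemma Van_zero_of_no_curve:
  assumes "\<not> (\<exists>C\<in>curves d. A \<subseteq> C)"
  shows "Van (int d) A = {0}"
proof (rule ccontr)
  assume "Van (int d) A \<noteq> {0}"
  then obtain f where f: "f \<in> Van (int d) A" "f \<noteq> 0" using zero_Van by blast
  then have le: "tdeg f \<le> d" using Pol_iff by (auto simp: Van_def)
  obtain g where g: "g \<noteq> 0" "tdeg g = d - tdeg f" using ex_tdeg by blast
  have fg: "f * g \<noteq> 0" "tdeg (f * g) = d" using f g le by (auto simp: tdeg_mult)
  then have "f * g \<in> Pol (int d)" "f * g \<notin> Pol (int d - 1)" using Pol_iff[OF fg(1)] by auto
  then have "{p. ev (f * g) p = 0} \<in> curves d" using curves_iff by blast
  moreover have "A \<subseteq> {p. ev (f * g) p = 0}" using f by (auto simp: Van_def)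
  ultimately show False using assms by blast
qed

section \<open>Traces of determined curves on the point set\<close>

definition zs :: "(real \<times> real) set \<Rightarrow> bipoly \<Rightarrow> (real \<times> real) set" where
  "zs A f = {a \<in> A. ev f a = 0}"

text \<open>The trace on \<open>A\<close> of a determined curve with at most \<open>(3 d\<^sup>2 - 3 d + 4) / 2\<close> points.
  Degree less than \<open>d\<close> is excluded by \<open>vdim (int d) T = 1\<close>, as multiples of such a polynomial
  would vanish on \<open>T\<close> as well.\<close>

definition ordset :: "nat \<Rightarrow> (real \<times> real) set \<Rightarrow> (real \<times> real) set \<Rightarrow> bool" where
  "ordset d A T \<longleftrightarrow> (\<exists>f\<in>Pol (int d). f \<noteq> 0 \<and> T = zs A f) \<and> vdim (int d) T = 1 \<and> 2 * card T + 3 * d \<le> 3 * d ^ 2 + 4"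

text \<open>A determined curve is recovered from its trace on \<open>A\<close>.\<close>

lemma finite_O_curves: "finite A \<Longrightarrow> finite (O_curves d n A)"
proof -
  assume "finite A"
  have "inj_on (\<lambda>C. C \<inter> A) (O_curves d n A)"
    by (intro inj_onI) (auto simp: O_curves_def determined_curves_def)
  moreover have "(\<lambda>C. C \<inter> A) ` O_curves d n A \<subseteq> Pow A" by auto
  ultimately show ?thesis using \<open>finite A\<close> by (meson finite_Pow_iff finite_imageD finite_subset)
qed

lemma ordset_curve:
  assumes "ordset d A T"
  shows "\<exists>C\<in>O_curves d ((3 * real d ^ 2 - 3 * real d + 4) / 2) A. C \<inter> A = T"
proof -
  obtain f where f: "f \<in> Pol (int d)" "f \<noteq> 0" "T = zs A f" and T: "vdim (int d) T = 1"
    "2 * card T + 3 * d \<le> 3 * d ^ 2 + 4"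
    using assms by (auto simp: ordset_def)
  have fT: "f \<in> Van (int d) T" using f by (auto simp: Van_def zs_def)
  have ex: "f \<notin> Pol (int d - 1)"
  proof
    assume low: "f \<in> Pol (int d - 1)"
    obtain g where g: "g \<noteq> 0" "tdeg g = 1" using ex_tdeg by blast
    have "g * f \<in> Pol (int d)" using Pol_mult[of g 1 f "int d - 1"] Pol_iff[OF g(1)] g low by simp
    then have "g * f \<in> Van (int d) T" using f by (auto simp: Van_def zs_def)
    from vdim_1_unique[OF T(1) fT f(2) this] obtain r where "g * f = cmul r f" by blast
    then have "(g - [:[:r:]:]) * f = 0" by (simp add: cmul_def algebra_simps)
    then have "g = [:[:r:]:]" using f(2) by simp
    then have "g \<in> Pol 0" by (auto simp: Pol_def coeff_pCons split: nat.splits)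
    then show False using Pol_iff[OF g(1)] g(2) by simp
  qed
  let ?C = "{p. ev f p = 0}"
  have CT: "?C \<inter> A = T" using f by (auto simp: zs_def)
  have "?C = C2" if C2: "C2 \<in> curves d" "?C \<inter> A \<subseteq> C2 \<inter> A" for C2
  proof -
    obtain g where g: "g \<in> Pol (int d)" "g \<notin> Pol (int d - 1)" "C2 = {p. ev g p = 0}"
      using C2(1) curves_iff by blast
    have "g \<in> Van (int d) T" using g C2(2) CT by (auto simp: Van_def)
    from vdim_1_unique[OF T(1) fT f(2) this] obtain r where r: "g = cmul r f" by blast
    then have "r \<noteq> 0" using g(2) by (auto simp: cmul_def)
    then show ?thesis using g r by simp
  qed
  moreover have "?C \<in> curves d" using curves_iff f ex by blast
  ultimately have "?C \<in> determined_curves d A" by (simp add: determined_curves_def)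
  moreover have "real (2 * card T + 3 * d) \<le> real (3 * d ^ 2 + 4)" using T(2) of_nat_le_iff by blast
  then have "real (card T) \<le> (3 * real d ^ 2 - 3 * real d + 4) / 2" by simp
  ultimately show ?thesis using CT by (auto simp: O_curves_def)
qed

lemma ordset_subset: "ordset d A T \<Longrightarrow> T \<subseteq> A" by (auto simp: ordset_def zs_def)

lemma finite_ordset: "finite A \<Longrightarrow> finite {T. ordset d A T}"
  by (rule finite_subset[of _ "Pow A"]) (auto dest: ordset_subset)

lemma card_ordset_le:
  assumes "finite A"
  shows "card {T. ordset d A T} \<le> card (O_curves d ((3 * real d ^ 2 - 3 * real d + 4) / 2) A)"
proof -
  let ?O = "O_curves d ((3 * real d ^ 2 - 3 * real d + 4) / 2) A"
  have "{T. ordset d A T} \<subseteq> (\<lambda>C. C \<inter> A) ` ?O" using ordset_curve by fastforce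
  then have "card {T. ordset d A T} \<le> card ((\<lambda>C. C \<inter> A) ` ?O)"
    using finite_O_curves[OF assms] by (intro card_mono) auto
  also have "\<dots> \<le> card ?O" using finite_O_curves[OF assms] by (rule card_image_le)
  finally show ?thesis .
qed

text \<open>For \<open>a\<close> off the base locus this is the fibre through \<open>a\<close> of
  the map given by the net, enlarged by \<open>B\<close> and any other point of \<open>A\<close> at
  which the whole net vanishes.\<close>

definition netcl :: "nat \<Rightarrow> (real \<times> real) set \<Rightarrow> (real \<times> real) set \<Rightarrow> real \<times> real \<Rightarrow> (real \<times> real) set" where
  "netcl d A B a = {x \<in> A. \<forall>f\<in>Van (int d) (insert a B). ev f x = 0}"

text \<open>Encodes that the net curve through both points, seen as a line of the projective plane,
  meets the image of \<open>A\<close> only in the images of \<open>a\<close> and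
  \<open>b\<close>.\<close>

definition netpair :: "nat \<Rightarrow> (real \<times> real) set \<Rightarrow> (real \<times> real) set \<Rightarrow> real \<times> real \<Rightarrow> real \<times> real \<Rightarrow> bool" where
  "netpair d A B a b \<longleftrightarrow> vdim (int d) (netcl d A B a \<union> netcl d A B b) = 1 \<and>
     (\<exists>f\<in>Pol (int d). f \<noteq> 0 \<and> netcl d A B a \<union> netcl d A B b = zs A f)"

lemma spanning_triple:
  fixes S :: "(real^3) set"
  assumes sp: "\<And>c. (\<And>v. v \<in> S \<Longrightarrow> c \<bullet> v = 0) \<Longrightarrow> c = 0"
  obtains a b c where "a \<in> S" "b \<in> S" "c \<in> S" "a \<bullet> cross3 b c \<noteq> 0"
proof -
  have "axis 1 1 \<noteq> (0 :: real^3)" by (simp add: axis_eq_0_iff)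
  then obtain b where b: "b \<in> S" "b \<noteq> 0" using sp[of "axis 1 1"] by (metis inner_zero_right)
  have "\<exists>c\<in>S. cross3 b c \<noteq> 0"
  proof (rule ccontr)
    assume no: "\<not> ?thesis"
    have "\<exists>e. cross3 b e \<noteq> 0"
    proof (rule ccontr)
      assume "\<not> ?thesis"
      then have "cross3 b (axis 1 1) = 0" "cross3 b (axis 2 1) = 0" by auto
      then show False using b(2) by (simp add: cross3_simps forall_3 axis_def)
    qed
    then obtain e where e: "cross3 b e \<noteq> 0" by blast
    have "cross3 b e \<bullet> v = 0" if "v \<in> S" for v
    proof -
      have "cross3 b e \<bullet> v = - (e \<bullet> cross3 b v)" by (simp add: cross3_simps)
      then show ?thesis using no that by simp
    qed
    then show False using sp e by blast
  qed
  then obtain c where c: "c \<in> S" "cross3 b c \<noteq> 0" by blast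
  then obtain a where "a \<in> S" "cross3 b c \<bullet> a \<noteq> 0" using sp[of "cross3 b c"] by blast
  then show thesis using that b c by (simp add: inner_commute)
qed

text \<open>The three-dimensional space of curves through \<open>B\<close> maps the plane to a projective plane in
  which these curves become lines; \<open>R\<close> represents the image of \<open>A\<close>.\<close>

lemma net_representatives:
  assumes fin: "finite A" and B: "B \<subseteq> A" "indep (int d) B" "card B + 3 = pd (int d)"
  obtains R where "R \<subseteq> A"
    "\<And>a. a \<in> R \<Longrightarrow> \<exists>f\<in>Van (int d) B. ev f a \<noteq> 0"
    "\<And>x f. x \<in> A \<Longrightarrow> f \<in> Van (int d) B \<Longrightarrow> ev f x \<noteq> 0 \<Longrightarrow> \<exists>a\<in>R. x \<in> netcl d A B a"
    "\<And>a b. a \<in> R \<Longrightarrow> b \<in> R \<Longrightarrow> a \<noteq> b \<Longrightarrow> b \<notin> netcl d A B a"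
    "\<And>q. q \<in> R \<Longrightarrow> Van (int d) (B \<union> (R - {q})) = {0} \<Longrightarrow>
       card R \<le> 10 * card {e. \<exists>a b. e = {a, b} \<and> a \<in> R \<and> b \<in> R \<and> a \<noteq> b \<and> q \<notin> e \<and> netpair d A B a b} + 4"
proof -
  let ?V = "Van (int d) B"
  have v3: "vdim (int d) B = 3" using indep_vdim[OF B(2)] B(3) by simp
  obtain Bs where Bs: "finite Bs" "Bs \<subseteq> ?V" "pv.independent Bs" "?V \<subseteq> pv.span Bs" "card Bs = 3"
    using fin_dim_basis[OF Van_fin_dim, of "int d" B] v3 unfolding vdim_def by metis
  obtain f1 f2 f3 where f: "Bs = {f1, f2, f3}" "f1 \<noteq> f2" "f1 \<noteq> f3" "f2 \<noteq> f3"
    using Bs(5) by (auto simp: card_3_iff)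
  define \<Phi> :: "real \<times> real \<Rightarrow> real^3" where "\<Phi> a = vector [ev f1 a, ev f2 a, ev f3 a]" for a
  define F where "F c = cmul (c$1) f1 + cmul (c$2) f2 + cmul (c$3) f3" for c :: "real^3"
  have evF: "ev (F c) a = c \<bullet> \<Phi> a" for c a
    by (simp add: F_def \<Phi>_def inner_vec_def sum_3)
  have FV: "F c \<in> ?V" for c
    using Bs(2) f Van_subspace[of "int d" B] unfolding F_def by (intro pv.subspace_add pv.subspace_scale) auto
  have VF: "\<exists>c. g = F c" if g: "g \<in> ?V" for g
  proof -
    have "g \<in> pv.span {f1, f2, f3}" using g Bs(4) f(1) by auto
    then obtain u where "g = (\<Sum>v\<in>{f1, f2, f3}. cmul (u v) v)" by (auto simp: pv.span_finite)
    then have "g = F (vector [u f1, u f2, u f3])" using f by (simp add: F_def add.assoc)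
    then show ?thesis by blast
  qed
  have F0: "c = 0" if "F c = 0" for c
  proof -
    let ?u = "\<lambda>v. if v = f1 then c$1 else if v = f2 then c$2 else c$3"
    have "(\<Sum>v\<in>Bs. cmul (?u v) v) = 0" using that f by (simp add: F_def add.assoc)
    then have "?u f1 = 0" "?u f2 = 0" "?u f3 = 0"
      using pv.independentD[OF Bs(3) Bs(1) order_refl, of ?u] f(1) by blast+
    then show ?thesis using f by (simp add: vec_eq_iff forall_3)
  qed
  have \<Phi>0: "\<Phi> a = 0 \<longleftrightarrow> (\<forall>g\<in>?V. ev g a = 0)" for a
  proof
    assume "\<forall>g\<in>?V. ev g a = 0"
    then have "\<Phi> a \<bullet> \<Phi> a = 0" using FV evF by metis
    then show "\<Phi> a = 0" by simp
  next
    assume "\<Phi> a = 0"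
    then have "ev (F c) a = 0" for c by (simp add: evF)
    then show "\<forall>g\<in>?V. ev g a = 0" using VF by blast
  qed
  have cl: "x \<in> netcl d A B a \<longleftrightarrow> x \<in> A \<and> cross3 (\<Phi> a) (\<Phi> x) = 0" if "\<Phi> a \<noteq> 0" for a x
  proof -
    have "(\<forall>f\<in>Van (int d) (insert a B). ev f x = 0) \<longleftrightarrow> (\<forall>c. c \<bullet> \<Phi> a = 0 \<longrightarrow> c \<bullet> \<Phi> x = 0)"
    proof
      assume *: "\<forall>f\<in>Van (int d) (insert a B). ev f x = 0"
      show "\<forall>c. c \<bullet> \<Phi> a = 0 \<longrightarrow> c \<bullet> \<Phi> x = 0"
      proof (intro allI impI)
        fix c assume "c \<bullet> \<Phi> a = 0"
        then have "F c \<in> Van (int d) (insert a B)" using FV[of c] evF by (simp add: Van_insert)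
        then show "c \<bullet> \<Phi> x = 0" using * evF by metis
      qed
    next
      assume *: "\<forall>c. c \<bullet> \<Phi> a = 0 \<longrightarrow> c \<bullet> \<Phi> x = 0"
      show "\<forall>f\<in>Van (int d) (insert a B). ev f x = 0"
      proof
        fix f assume f: "f \<in> Van (int d) (insert a B)"
        then obtain c where "f = F c" using VF[of f] by (auto simp: Van_insert)
        then show "ev f x = 0" using * f evF by (simp add: Van_insert)
      qed
    qed
    also have "\<dots> \<longleftrightarrow> cross3 (\<Phi> a) (\<Phi> x) = 0"
    proof
      assume *: "\<forall>c. c \<bullet> \<Phi> a = 0 \<longrightarrow> c \<bullet> \<Phi> x = 0"
      let ?n = "cross3 (\<Phi> a) (\<Phi> x)"
      have "cross3 (\<Phi> a) ?n \<bullet> \<Phi> a = 0" by (simp add: dot_cross_self)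
      then have "cross3 (\<Phi> a) ?n \<bullet> \<Phi> x = 0" using * by blast
      moreover have "cross3 (\<Phi> a) ?n \<bullet> \<Phi> x = - (?n \<bullet> ?n)" by (simp add: cross3_simps)
      ultimately show "?n = 0" by simp
    next
      assume n: "cross3 (\<Phi> a) (\<Phi> x) = 0"
      show "\<forall>c. c \<bullet> \<Phi> a = 0 \<longrightarrow> c \<bullet> \<Phi> x = 0"
      proof (intro allI impI)
        fix c assume c: "c \<bullet> \<Phi> a = 0"
        have "cross3 c (cross3 (\<Phi> a) (\<Phi> x)) = (c \<bullet> \<Phi> x) *\<^sub>R \<Phi> a - (c \<bullet> \<Phi> a) *\<^sub>R \<Phi> x"
          by (simp add: cross3_simps) (metis exhaust_3)
        then show "c \<bullet> \<Phi> x = 0" using c n that by simp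
      qed
    qed
    finally show ?thesis by (simp add: netcl_def)
  qed
  \<comment> \<open>A largest set of pairwise non-proportional nonzero images picks exactly one
    point from each fibre.\<close>
  let ?Q = "\<lambda>R. R \<subseteq> {a \<in> A. \<Phi> a \<noteq> 0} \<and> (\<forall>a\<in>R. \<forall>b\<in>R. a \<noteq> b \<longrightarrow> cross3 (\<Phi> a) (\<Phi> b) \<noteq> 0)"
  have "\<exists>R. ?Q R \<and> (\<forall>T. ?Q T \<longrightarrow> card T \<le> card R)"
  proof (rule ex_has_greatest_nat[of ?Q "{}" card "card A + 1"])
    show "\<forall>T. ?Q T \<longrightarrow> card T < card A + 1"
    proof (intro allI impI)
      fix T assume "?Q T"
      then have "T \<subseteq> A" by auto
      then show "card T < card A + 1" using card_mono[OF fin] by (simp add: less_Suc_eq_le)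
    qed
  qed simp
  then obtain R where R: "?Q R" and Rmax: "\<And>T. ?Q T \<Longrightarrow> card T \<le> card R" by blast
  have "R \<subseteq> A" using R by auto
  then have finR: "finite R" using fin finite_subset by blast
  have near: "\<exists>a\<in>R. cross3 (\<Phi> a) (\<Phi> x) = 0" if x: "x \<in> A" "\<Phi> x \<noteq> 0" for x
  proof (rule ccontr)
    assume no: "\<not> ?thesis"
    then have "x \<notin> R" using cross_refl by blast
    moreover have "cross3 (\<Phi> x) (\<Phi> a) \<noteq> 0" if "a \<in> R" for a
      using no that cross_skew[of "\<Phi> x" "\<Phi> a"] by auto
    then have "?Q (insert x R)" using R no x by auto
    from Rmax[OF this] \<open>x \<notin> R\<close> finR show False by simp
  qed
  show thesis
  proof (rule that[of R])
    show "R \<subseteq> A" using R by auto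
    show "\<exists>f\<in>?V. ev f a \<noteq> 0" if "a \<in> R" for a using \<Phi>0 R that by auto
    show "\<exists>a\<in>R. x \<in> netcl d A B a" if x: "x \<in> A" "f \<in> ?V" "ev f x \<noteq> 0" for x f
    proof -
      have "\<Phi> x \<noteq> 0" using x \<Phi>0 by blast
      then obtain a where "a \<in> R" "cross3 (\<Phi> a) (\<Phi> x) = 0" using near[of x] x(1) by blast
      then show ?thesis using cl[of a x] R x by auto
    qed
    show "b \<notin> netcl d A B a" if "a \<in> R" "b \<in> R" "a \<noteq> b" for a b
      using cl[of a b] R that by auto
    fix q assume q: "q \<in> R" "Van (int d) (B \<union> (R - {q})) = {0}"
    let ?P = "\<Phi> ` R"
    have injR: "inj_on \<Phi> R" using R by (intro inj_onI) (metis cross_refl)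
    have "\<exists>a b c. a \<in> ?P - {\<Phi> q} \<and> b \<in> ?P - {\<Phi> q} \<and> c \<in> ?P - {\<Phi> q} \<and> a \<bullet> cross3 b c \<noteq> 0"
    proof -
      have "c = 0" if c: "\<And>v. v \<in> ?P - {\<Phi> q} \<Longrightarrow> c \<bullet> v = 0" for c
      proof -
        have "\<Phi> r \<in> ?P - {\<Phi> q}" if "r \<in> R - {q}" for r using that q injR by (auto dest: inj_onD)
        then have "ev (F c) r = 0" if "r \<in> R - {q}" for r using c that evF by auto
        then have "F c \<in> Van (int d) (B \<union> (R - {q}))" using FV[of c] by (auto simp: Van_def)
        then show "c = 0" using q F0 by auto
      qed
      then obtain a b c where "a \<in> ?P - {\<Phi> q}" "b \<in> ?P - {\<Phi> q}" "c \<in> ?P - {\<Phi> q}" "a \<bullet> cross3 b c \<noteq> 0"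
        by (rule spanning_triple)
      then show ?thesis by blast
    qed
    then obtain a b c where abc: "a \<in> ?P - {\<Phi> q}" "b \<in> ?P - {\<Phi> q}" "c \<in> ?P - {\<Phi> q}" "a \<bullet> cross3 b c \<noteq> 0"
      by blast
    let ?E = "{e. \<exists>x y. e = {x, y} \<and> ordinary ?P x y \<and> \<Phi> q \<notin> e}"
    let ?G = "{e. \<exists>a b. e = {a, b} \<and> a \<in> R \<and> b \<in> R \<and> a \<noteq> b \<and> q \<notin> e \<and> netpair d A B a b}"
    have "card ?P \<le> 10 * card ?E + 4"
    proof (rule many_ordinary[of ?P "\<Phi> q" a b c])
      show "finite ?P" using finR by simp
      show "\<Phi> q \<in> ?P" using q by simp
      show "cross3 x y \<noteq> 0" if "x \<in> ?P" "y \<in> ?P" "x \<noteq> y" for x y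
        using that R by auto
    qed (use abc in auto)
    moreover have "card ?P = card R" by (rule card_image[OF injR])
    moreover have "?E \<subseteq> (\<lambda>e. \<Phi> ` e) ` ?G"
    proof
      fix e assume "e \<in> ?E"
      then obtain x y where e: "e = {x, y}" "ordinary ?P x y" "\<Phi> q \<notin> e" by blast
      then obtain a b where ab: "a \<in> R" "b \<in> R" "x = \<Phi> a" "y = \<Phi> b" "a \<noteq> b"
        by (auto simp: ordinary_def)
      \<comment> \<open>The line through the two images has normal \<open>?n\<close>, so the net
        curve behind it is \<open>F ?n\<close>.\<close>
      let ?n = "cross3 (\<Phi> a) (\<Phi> b)" and ?T = "netcl d A B a \<union> netcl d A B b"
      have n0: "?n \<noteq> 0" using R ab by blast
      then have Fn: "F ?n \<noteq> 0" using F0 by blast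
      have \<Phi>ab: "\<Phi> a \<noteq> 0" "\<Phi> b \<noteq> 0" using R ab by auto
      have van: "ev (F ?n) a = 0" "ev (F ?n) b = 0" by (simp_all add: evF dot_cross_self)
      have T: "?T = zs A (F ?n)"
      proof (intro equalityI subsetI)
        fix z assume "z \<in> ?T"
        then show "z \<in> zs A (F ?n)"
          using van FV[of ?n] by (auto simp: netcl_def zs_def Van_insert)
      next
        fix z assume z: "z \<in> zs A (F ?n)"
        show "z \<in> ?T"
        proof (cases "\<Phi> z = 0")
          case True
          then show ?thesis using cl[OF \<Phi>ab(1), of z] z by (simp add: zs_def)
        next
          case False
          then obtain r where r: "r \<in> R" "cross3 (\<Phi> r) (\<Phi> z) = 0" using near[of z] z by (auto simp: zs_def)
          have zr: "z \<in> netcl d A B r" using cl[of r z] r R z by (auto simp: zs_def)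
          have "\<Phi> r \<bullet> ?n = 0"
          proof -
            have "cross3 ?n (cross3 (\<Phi> r) (\<Phi> z)) = (?n \<bullet> \<Phi> z) *\<^sub>R \<Phi> r - (?n \<bullet> \<Phi> r) *\<^sub>R \<Phi> z"
              by (simp add: cross3_simps) (metis exhaust_3)
            moreover have "?n \<bullet> \<Phi> z = 0" using z evF by (simp add: zs_def)
            ultimately show ?thesis using r(2) False by (simp add: inner_commute)
          qed
          then have "\<Phi> r \<in> {x, y}" using e(2) r(1) ab by (auto simp: ordinary_def)
          then have "r = a \<or> r = b" using ab r injR by (auto dest: inj_onD)
          then show ?thesis using zr by auto
        qed
      qed
      have aT: "a \<in> ?T" "b \<in> ?T" using ab R by (auto simp: netcl_def Van_insert)
      have BT: "B \<subseteq> ?T" using B(1) by (auto simp: netcl_def Van_def)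
      obtain fa where "fa \<in> ?V" "ev fa a \<noteq> 0" using \<Phi>ab \<Phi>0 by blast
      from vdim_insert_new[OF this] have v2: "vdim (int d) (insert a B) = 2" using v3 by simp
      have "b \<notin> netcl d A B a" using cl[OF \<Phi>ab(1)] n0 by simp
      then obtain fb where "fb \<in> Van (int d) (insert a B)" "ev fb b \<noteq> 0"
        using ab R by (auto simp: netcl_def)
      from vdim_insert_new[OF this] have "vdim (int d) (insert b (insert a B)) = 1" using v2 by simp
      then have "vdim (int d) ?T \<le> 1" using vdim_anti[of "insert b (insert a B)" ?T "int d"] aT BT by auto
      moreover have "F ?n \<in> Van (int d) ?T" unfolding T using FV[of ?n] by (auto simp: Van_def zs_def)
      then have "vdim (int d) ?T \<noteq> 0" using Fn vdim_0_iff by blast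
      ultimately have "netpair d A B a b"
        unfolding netpair_def using T Fn FV[of ?n] Van_Pol by (intro conjI bexI[of _ "F ?n"]) auto
      moreover have "q \<notin> {a, b}" using ab(3,4) e(1,3) by blast
      ultimately have "{a, b} \<in> ?G" using ab(1,2,5) by blast
      moreover have "e = \<Phi> ` {a, b}" using e ab by simp
      ultimately show "e \<in> (\<lambda>e. \<Phi> ` e) ` ?G" by blast
    qed
    moreover have "finite ?G" by (rule finite_subset[of _ "Pow R"]) (use finR in auto)
    ultimately have "card ?E \<le> card ?G"
      by (meson card_image_le card_mono finite_imageI le_trans)
    then show "card R \<le> 10 * card ?G + 4" using \<open>card ?P \<le> 10 * card ?E + 4\<close> \<open>card ?P = card R\<close> by linarith
  qed
qed

lemma netcl_contains: "B \<subseteq> A \<Longrightarrow> B \<subseteq> netcl d A B a" "a \<in> A \<Longrightarrow> a \<in> netcl d A B a" "netcl d A B a \<subseteq> A"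
  by (auto simp: netcl_def Van_def)

text \<open>Distinct pairs yield distinct traces because \<open>R\<close> meets a fibre only in its
  representative. The size bound is inclusion and exclusion, as \<open>B\<close> lies in both
  fibres.\<close>

lemma card_netpairs_le:
  assumes fin: "finite A" and B: "B \<subseteq> A" "card B + 3 = pd (int d)"
    and R: "R \<subseteq> A" "\<And>a b. a \<in> R \<Longrightarrow> b \<in> R \<Longrightarrow> a \<noteq> b \<Longrightarrow> b \<notin> netcl d A B a"
    and E: "\<And>e. e \<in> E \<Longrightarrow> \<exists>a b. e = {a, b} \<and> a \<in> R \<and> b \<in> R \<and> netpair d A B a b \<and>
      card (netcl d A B a) \<le> d ^ 2 \<and> card (netcl d A B b) \<le> d ^ 2"
  shows "card E \<le> card {T. ordset d A T \<and> B \<subseteq> T}"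
proof -
  let ?c = "netcl d A B"
  define h where "h e = (\<Union>a\<in>e. ?c a)" for e
  have "h e \<inter> R = e" if e: "e \<in> E" for e
  proof -
    obtain a b where ab: "e = {a, b}" "a \<in> R" "b \<in> R" using E[OF e] by blast
    have "a \<in> ?c a" "b \<in> ?c b" using ab R(1) netcl_contains(2) by blast+
    moreover have "x = a" if "x \<in> R" "x \<in> ?c a" for x using R(2)[of a x] ab that by blast
    moreover have "x = b" if "x \<in> R" "x \<in> ?c b" for x using R(2)[of b x] ab that by blast
    ultimately show ?thesis using ab unfolding h_def by blast
  qed
  then have "inj_on h E" by (metis (no_types, lifting) inj_onI)
  moreover have "h ` E \<subseteq> {T. ordset d A T \<and> B \<subseteq> T}"
  proof (intro subsetI, elim imageE)
    fix T e assume e: "e \<in> E" "T = h e"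
    obtain a b where ab: "e = {a, b}" "netpair d A B a b" "card (?c a) \<le> d ^ 2" "card (?c b) \<le> d ^ 2"
      using E[OF e(1)] by blast
    have T: "T = ?c a \<union> ?c b" using e ab by (simp add: h_def)
    have f: "finite (?c x)" for x using finite_subset[OF netcl_contains(3) fin] .
    have "card B \<le> card (?c a \<inter> ?c b)" using f netcl_contains(1)[OF B(1)] by (intro card_mono) auto
    then have "card T + card B \<le> d ^ 2 + d ^ 2"
      using card_Un_Int[OF f f, of a b] ab(3,4) unfolding T by linarith
    then have "card T + pd (int d) \<le> 2 * d ^ 2 + 3" using B(2) by linarith
    then have "2 * card T + (d + 1) * (d + 2) \<le> 4 * d ^ 2 + 6" using pd_nat[of d] by linarith
    then have "2 * card T + 3 * d \<le> 3 * d ^ 2 + 4" by (simp add: power2_eq_square algebra_simps)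
    then show "T \<in> {T. ordset d A T \<and> B \<subseteq> T}"
      using ab(2) T netcl_contains(1)[OF B(1), of d a] unfolding ordset_def netpair_def by blast
  qed
  moreover have "finite {T. ordset d A T \<and> B \<subseteq> T}" using finite_ordset[OF fin] by (rule finite_subset[rotated]) auto
  ultimately show ?thesis by (rule card_inj_on_le)
qed

text \<open>Count incidences between base sets and traces: a trace has at most 3 d^2 + 4 points and
  so contains boundedly many base sets.\<close>

lemma ordset_double_count:
  assumes fin: "finite A" and BB: "\<And>B. B \<in> BB \<Longrightarrow> B \<subseteq> A"
    and k: "\<And>B. B \<in> BB \<Longrightarrow> k \<le> card {T. ordset d A T \<and> B \<subseteq> T}"
  shows "card BB * k \<le> card {T. ordset d A T} * 2 ^ (3 * d ^ 2 + 4)"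
proof -
  let ?O = "{T. ordset d A T}"
  have fO: "finite ?O" by (rule finite_ordset[OF fin])
  have fB: "finite BB" by (rule finite_subset[of _ "Pow A"]) (use BB fin in auto)
  have "card BB * k \<le> (\<Sum>B\<in>BB. card {T. ordset d A T \<and> B \<subseteq> T})"
    using sum_bounded_below[of BB k "\<lambda>B. card {T. ordset d A T \<and> B \<subseteq> T}"] k by simp
  also have "\<dots> = (\<Sum>B\<in>BB. \<Sum>T\<in>?O. if B \<subseteq> T then 1 else 0)"
    using fO by (intro sum.cong refl) (simp add: sum.If_cases Collect_conj_eq)
  also have "\<dots> = (\<Sum>T\<in>?O. \<Sum>B\<in>BB. if B \<subseteq> T then 1 else 0)" by (rule sum.swap)
  also have "\<dots> = (\<Sum>T\<in>?O. card {B \<in> BB. B \<subseteq> T})"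
    using fB by (intro sum.cong refl) (simp add: sum.If_cases Int_def)
  also have "\<dots> \<le> (\<Sum>T\<in>?O. 2 ^ (3 * d ^ 2 + 4))"
  proof (rule sum_mono)
    fix T assume "T \<in> ?O"
    then have T: "finite T" "2 * card T + 3 * d \<le> 3 * d ^ 2 + 4"
      using finite_subset[OF ordset_subset fin] by (auto simp: ordset_def)
    have "card {B \<in> BB. B \<subseteq> T} \<le> card (Pow T)" using T by (intro card_mono) auto
    also have "\<dots> = 2 ^ card T" using T by (simp add: card_Pow)
    also have "\<dots> \<le> 2 ^ (3 * d ^ 2 + 4)" using T by (intro power_increasing) auto
    finally show "card {B \<in> BB. B \<subseteq> T} \<le> 2 ^ (3 * d ^ 2 + 4)" .
  qed
  finally show ?thesis by simp
qed

section \<open>Zeros on irreducible curves and bases off a curve\<close>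

lemma tdeg_unit: "is_unit f \<Longrightarrow> tdeg f = 0"
proof -
  assume "is_unit f"
  then obtain g where g: "1 = f * g" by blast
  have "tdeg 1 = 0" using Pol_iff[of 1 0] one_Pol[of 0] by simp
  moreover have "tdeg (f * g) = tdeg f + tdeg g" using g by (intro tdeg_mult) auto
  ultimately show ?thesis using g by simp
qed

lemma prime_elem_tdeg1: "tdeg l = 1 \<Longrightarrow> l \<noteq> 0 \<Longrightarrow> prime_elem l"
proof -
  assume l: "tdeg l = 1" "l \<noteq> 0"
  have "irreducible l"
  proof (rule irreducibleI)
    show "l \<noteq> 0" "\<not> is_unit l" using l tdeg_unit by auto
    fix a b assume ab: "l = a * b"
    then have ab0: "a \<noteq> 0" "b \<noteq> 0" using l by auto
    then have "tdeg a + tdeg b = 1" using l ab tdeg_mult[of a b] by simp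
    then have "tdeg a = 0 \<or> tdeg b = 0" by linarith
    then show "is_unit a \<or> is_unit b" using ab0 tdeg_0_unit by blast
  qed
  then show ?thesis by (simp add: prime_elem_iff_irreducible)
qed

lemma prime_zeros_le:
  assumes "prime_elem \<eta>" "f \<in> Pol (int d)" "\<not> \<eta> dvd f" "finite X" "\<And>x. x \<in> X \<Longrightarrow> ev \<eta> x = 0"
  shows "card {x \<in> X. ev f x = 0} \<le> d * tdeg \<eta>"
proof -
  have f: "f \<noteq> 0" using assms(3) by auto
  have "coprime \<eta> f" using assms by (simp add: prime_elem_imp_coprime)
  then have "card {x \<in> X. ev f x = 0} \<le> tdeg \<eta> * tdeg f"
    using assms f by (intro bezout) auto
  also have "\<dots> \<le> tdeg \<eta> * d" using assms(2) f Pol_iff by (intro mult_left_mono) auto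
  finally show ?thesis by (simp add: mult.commute)
qed

text \<open>Multiplication by \<open>\<eta>\<close> supplies the zeros on the curve, so a nonzero
  polynomial of the reduced degree would lead to one vanishing on all of \<open>A\<close>.\<close>

lemma Van_avoid:
  assumes "Van (int d) A = {0}" "\<eta> \<noteq> 0"
  shows "Van (int d - int (tdeg \<eta>)) {a \<in> A. ev \<eta> a \<noteq> 0} = {0}"
proof -
  have "g = 0" if g: "g \<in> Van (int d - int (tdeg \<eta>)) {a \<in> A. ev \<eta> a \<noteq> 0}" for g
  proof -
    have "\<eta> * g \<in> Pol (int d)"
      using Pol_mult[of \<eta> "int (tdeg \<eta>)" g "int d - int (tdeg \<eta>)"] assms g Pol_iff by (simp add: Van_def)
    then have "\<eta> * g \<in> Van (int d) A" using g by (auto simp: Van_def)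
    then show "g = 0" using assms by auto
  qed
  then show ?thesis using zero_Van by blast
qed

lemma indep_spanning_card: "indep t S \<Longrightarrow> Van t S = {0} \<Longrightarrow> card S = pd t"
  using indep_vdim[of t S] vdim_0_iff[of t S] by simp

lemma ex_basis_avoid:
  assumes "Van (int d) A = {0}" "\<eta> \<noteq> 0" "finite A"
    and "indep (int d - int (tdeg \<eta>)) S1" "S1 \<subseteq> {a \<in> A. ev \<eta> a \<noteq> 0}"
  obtains S where "S1 \<subseteq> S" "S \<subseteq> {a \<in> A. ev \<eta> a \<noteq> 0}" "indep (int d - int (tdeg \<eta>)) S"
    "Van (int d - int (tdeg \<eta>)) S = {0}" "card S = pd (int d - int (tdeg \<eta>))"
proof -
  have "finite {a \<in> A. ev \<eta> a \<noteq> 0}" using assms(3) by simp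
  from indep_extend[OF assms(4,5) this] obtain S where S: "S1 \<subseteq> S" "S \<subseteq> {a \<in> A. ev \<eta> a \<noteq> 0}"
    "indep (int d - int (tdeg \<eta>)) S"
    "Van (int d - int (tdeg \<eta>)) S = Van (int d - int (tdeg \<eta>)) {a \<in> A. ev \<eta> a \<noteq> 0}" .
  then have "Van (int d - int (tdeg \<eta>)) S = {0}" using Van_avoid[OF assms(1,2)] by simp
  with S that indep_spanning_card show thesis by blast
qed

text \<open>\<open>\<eta>\<close> is nonzero on \<open>S\<close>, so the quotient inherits the
  zeros, which \<open>S\<close> forbids in the reduced degree. This is how a basis off a curve
  prevents net curves from containing that curve.\<close>

lemma Van_basis_dvd:
  assumes "\<And>s. s \<in> S \<Longrightarrow> ev \<eta> s \<noteq> 0" "Van (t - int (tdeg \<eta>)) S = {0}" "\<eta> \<noteq> 0"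
    and "\<eta> * g \<in> Van t S"
  shows "g = 0"
proof -
  have "g \<in> Pol (t - int (tdeg \<eta>))" using Pol_div assms by (auto simp: Van_def)
  then have "g \<in> Van (t - int (tdeg \<eta>)) S" using assms by (auto simp: Van_def)
  then show ?thesis using assms by auto
qed

section \<open>Counting tuples in general position\<close>

abbreviation tuples :: "nat \<Rightarrow> 'a set \<Rightarrow> 'a list set" where
  "tuples k X \<equiv> {xs. set xs \<subseteq> X \<and> length xs = k}"

lemma finite_tuples: "finite X \<Longrightarrow> finite (tuples k X)"
  by (rule finite_lists_length_eq)

lemma finite_tuples_Collect [simp]: "finite X \<Longrightarrow> finite {xs. set xs \<subseteq> X \<and> length xs = k \<and> Q xs}"
  by (rule finite_subset[OF _ finite_tuples[of X k]]) auto

lemma card_tuples_Cons_le: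
  assumes X: "finite X" and X0: "X0 \<subseteq> X" "card X0 \<le> a"
    and b: "\<And>x. x \<in> X - X0 \<Longrightarrow> card {xs \<in> tuples k X. Q x xs} \<le> b"
  shows "card {ys \<in> tuples (Suc k) X. \<exists>x xs. ys = x # xs \<and> (x \<in> X0 \<or> Q x xs)} \<le> a * card X ^ k + card X * b"
proof -
  let ?L = "(\<lambda>(x, xs). x # xs) ` (X0 \<times> tuples k X)"
  let ?M = "\<Union>x\<in>X - X0. (\<lambda>xs. x # xs) ` {xs \<in> tuples k X. Q x xs}"
  have "{ys \<in> tuples (Suc k) X. \<exists>x xs. ys = x # xs \<and> (x \<in> X0 \<or> Q x xs)} \<subseteq> ?L \<union> ?M"
    by (auto simp: image_iff)
  moreover have fX0: "finite X0" using X X0 finite_subset by blast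
  moreover have ft: "finite {xs \<in> tuples k X. Q x xs}" for x using X by simp
  ultimately have "card {ys \<in> tuples (Suc k) X. \<exists>x xs. ys = x # xs \<and> (x \<in> X0 \<or> Q x xs)} \<le> card (?L \<union> ?M)"
    using X finite_tuples[OF X, of k] by (intro card_mono) auto
  also have "\<dots> \<le> card ?L + card ?M" by (rule card_Un_le)
  also have "card ?L \<le> card (X0 \<times> tuples k X)" using fX0 finite_tuples[OF X] by (intro card_image_le) auto
  also have "\<dots> \<le> a * card X ^ k" using X0 by (simp add: card_cartesian_product card_lists_length_eq[OF X])
  also have "card ?M \<le> (\<Sum>x\<in>X - X0. card ((\<lambda>xs. x # xs) ` {xs \<in> tuples k X. Q x xs}))"
    using X by (intro card_UN_le) auto
  also have "\<dots> \<le> (\<Sum>x\<in>X - X0. b)" using order.trans[OF card_image_le[OF ft] b] by (intro sum_mono)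
  also have "\<dots> \<le> card X * b" using X by (simp add: card_mono)
  finally show ?thesis by simp
qed

text \<open>Both sides are multiplied by \<open>card X\<close>, since the natural bound k^2 |X|^(k -
  1) would involve a predecessor.\<close>

lemma card_not_distinct_le:
  assumes "finite X"
  shows "card {xs \<in> tuples k X. \<not> distinct xs} * card X \<le> k ^ 2 * card X ^ k"
proof (induction k)
  case (Suc k)
  let ?N = "\<lambda>k. {xs \<in> tuples k X. \<not> distinct xs}"
  have "?N (Suc k) \<subseteq> (\<lambda>(i, xs). xs ! i # xs) ` ({..<k} \<times> tuples k X) \<union> (\<lambda>(x, xs). x # xs) ` (X \<times> ?N k)"
  proof
    fix ys assume "ys \<in> ?N (Suc k)"
    then obtain x xs where ys: "ys = x # xs" "x \<in> X" "xs \<in> tuples k X" "\<not> distinct (x # xs)"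
      by (auto simp: length_Suc_conv)
    then show "ys \<in> (\<lambda>(i, xs). xs ! i # xs) ` ({..<k} \<times> tuples k X) \<union> (\<lambda>(x, xs). x # xs) ` (X \<times> ?N k)"
    proof (cases "x \<in> set xs")
      case True
      then obtain i where "i < k" "x = xs ! i" using ys by (auto simp: in_set_conv_nth)
      then show ?thesis using ys by auto
    qed auto
  qed
  then have "card (?N (Suc k)) \<le> card ((\<lambda>(i, xs). xs ! i # xs) ` ({..<k} \<times> tuples k X) \<union> (\<lambda>(x, xs). x # xs) ` (X \<times> ?N k))"
    using finite_tuples[OF assms, of k] assms by (intro card_mono) auto
  also have "\<dots> \<le> card ({..<k} \<times> tuples k X) + card (X \<times> ?N k)"
    using finite_tuples[OF assms, of k] assms
    by (intro order.trans[OF card_Un_le] add_mono card_image_le) auto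
  also have "\<dots> = k * card X ^ k + card X * card (?N k)"
    by (simp add: card_cartesian_product card_lists_length_eq[OF assms])
  finally have "card (?N (Suc k)) * card X \<le> (k * card X ^ k + card X * card (?N k)) * card X" by simp
  also have "\<dots> = k * card X ^ Suc k + card X * (card (?N k) * card X)" by (simp add: algebra_simps)
  also have "\<dots> \<le> k * card X ^ Suc k + card X * (k ^ 2 * card X ^ k)" using Suc by (intro add_mono mult_left_mono) auto
  also have "\<dots> = (k + k ^ 2) * card X ^ Suc k" by (simp add: algebra_simps)
  also have "\<dots> \<le> Suc k ^ 2 * card X ^ Suc k" by (intro mult_right_mono) (auto simp: power2_eq_square)
  finally show ?case .
qed simp

text \<open>Choose the entries one at a time. A point outside the common zeros \<open>X0\<close>
  lowers the dimension by one, and \<open>k\<close> such steps reach 0. The exceptions at each step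
  number at most \<open>a\<close>, because \<open>X0\<close> lies in the zero set of one nonzero
  polynomial.\<close>

lemma card_vanishing_tuples_le:
  assumes X: "finite X" and z: "\<And>f. f \<in> Van t S \<Longrightarrow> f \<noteq> 0 \<Longrightarrow> card {x \<in> X. ev f x = 0} \<le> a"
    and k: "vdim t S = k"
  shows "card {xs \<in> tuples k X. \<exists>f\<in>Van t (S \<union> set xs). f \<noteq> 0} * card X \<le> k * a * card X ^ k"
  using k z
proof (induction k arbitrary: S)
  case 0
  then have "Van t S = {0}" using vdim_0_iff by blast
  then have "{xs \<in> tuples 0 X. \<exists>f\<in>Van t (S \<union> set xs). f \<noteq> 0} = {}" by auto
  then show ?case by simp
next
  case (Suc k)
  let ?Q = "\<lambda>x xs. \<exists>f\<in>Van t (insert x S \<union> set xs). f \<noteq> 0"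
  let ?N = "\<lambda>x. {xs \<in> tuples k X. ?Q x xs}"
  define X0 where "X0 = {x \<in> X. \<forall>f\<in>Van t S. ev f x = 0}"
  obtain f where f: "f \<in> Van t S" "f \<noteq> 0" using vdim_pos[of t S] Suc.prems by auto
  have "X0 \<subseteq> {x \<in> X. ev f x = 0}" using f by (auto simp: X0_def)
  then have "card X0 \<le> card {x \<in> X. ev f x = 0}" using X by (intro card_mono) auto
  then have X0: "X0 \<subseteq> X" "card X0 \<le> a" using Suc.prems(2)[OF f] by (auto simp: X0_def)
  show ?case
  proof (cases "card X = 0")
    case False
    have b: "card (?N x) \<le> k * a * card X ^ k div card X" if x: "x \<in> X - X0" for x
    proof -
      obtain g where "g \<in> Van t S" "ev g x \<noteq> 0" using x by (auto simp: X0_def)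
      then have "vdim t (insert x S) = k" using vdim_insert_new[of g t S x] Suc.prems(1) by simp
      then have "card (?N x) * card X \<le> k * a * card X ^ k"
        using Suc.prems(2) by (intro Suc.IH) (auto simp: Van_insert)
      then show ?thesis using False by (simp add: less_eq_div_iff_mult_less_eq)
    qed
    have "{xs \<in> tuples (Suc k) X. \<exists>f\<in>Van t (S \<union> set xs). f \<noteq> 0}
        \<subseteq> {ys \<in> tuples (Suc k) X. \<exists>x xs. ys = x # xs \<and> (x \<in> X0 \<or> ?Q x xs)}"
      by (auto simp: length_Suc_conv)
    then have "card {xs \<in> tuples (Suc k) X. \<exists>f\<in>Van t (S \<union> set xs). f \<noteq> 0}
        \<le> card {ys \<in> tuples (Suc k) X. \<exists>x xs. ys = x # xs \<and> (x \<in> X0 \<or> ?Q x xs)}"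
      using X by (intro card_mono) simp_all
    also have "\<dots> \<le> a * card X ^ k + card X * (k * a * card X ^ k div card X)"
      by (rule card_tuples_Cons_le[OF X X0 b])
    also have "\<dots> \<le> a * card X ^ k + k * a * card X ^ k"
      by (metis add_left_mono mult.commute times_div_less_eq_dividend)
    finally have "card {xs \<in> tuples (Suc k) X. \<exists>f\<in>Van t (S \<union> set xs). f \<noteq> 0} * card X
        \<le> (a * card X ^ k + k * a * card X ^ k) * card X" by simp
    then show ?thesis by (simp add: algebra_simps)
  qed simp
qed

text \<open>A set of at most k elements is the range of at most k^k lists of length k, so passing
  from lists to sets costs only a constant factor.\<close>

lemma card_lists_with_set:
  assumes "finite \<T>" "\<And>xs. xs \<in> L \<Longrightarrow> length xs = k \<and> set xs \<in> \<T> \<and> card (set xs) \<le> k"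
  shows "card L \<le> card \<T> * k ^ k"
proof -
  have "L \<subseteq> (\<Union>S\<in>{S \<in> \<T>. finite S \<and> card S \<le> k}. tuples k S)" using assms(2) by auto
  then have "card L \<le> card (\<Union>S\<in>{S \<in> \<T>. finite S \<and> card S \<le> k}. tuples k S)"
    using assms(1) by (intro card_mono) (auto intro!: finite_tuples)
  also have "\<dots> \<le> (\<Sum>S\<in>{S \<in> \<T>. finite S \<and> card S \<le> k}. card (tuples k S))"
    using assms(1) by (intro card_UN_le) auto
  also have "\<dots> \<le> (\<Sum>S\<in>{S \<in> \<T>. finite S \<and> card S \<le> k}. k ^ k)"
    by (intro sum_mono) (auto simp: card_lists_length_eq power_mono)
  also have "\<dots> \<le> card \<T> * k ^ k" using assms(1) by (auto intro!: mult_right_mono card_mono)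
  finally show ?thesis .
qed

text \<open>If almost all of \<open>A\<close> lies on a line, take the curves through \<open>d\<close> points of the line and
  a fixed basis \<open>S\<close> of the curves of degree \<open>d - 1\<close> off the line.\<close>

lemma count_near_line:
  assumes d: "1 \<le> d" and fin: "finite A" and A: "Van (int d) A = {0}" and l: "l \<noteq> 0" "tdeg l = 1"
    and X: "X = {a \<in> A. ev l a = 0}" "d < card X"
    and Y: "2 * d ^ 2 * (card (A - X) + 1) \<le> card X"
  shows "card X ^ d \<le> 2 * card {T. ordset d A T} * d ^ d"
proof -
  have finX: "finite X" using fin X by simp
  obtain S where S: "S \<subseteq> {a \<in> A. ev l a \<noteq> 0}" "indep (int d - 1) S" "Van (int d - 1) S = {0}"
    "card S = pd (int d - 1)"
    using ex_basis_avoid[OF A l(1) fin, of "{}"] l by auto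
  have pd: "pd (int d) = pd (int d - 1) + (d + 1)"
  proof -
    have "2 * pd (int d) = (d + 1) * (d + 2)" "2 * pd (int (d - 1)) = (d - 1 + 1) * (d - 1 + 2)"
      by (rule pd_nat)+
    then show ?thesis using d by (simp add: of_nat_diff algebra_simps)
  qed
  have Sd: "indep (int d) S" using indep_mono[OF S(2)] by simp
  have vS: "vdim (int d) S = d + 1" using indep_vdim[OF Sd] S(4) pd by simp
  have z: "card {x \<in> X. ev f x = 0} \<le> d" if f: "f \<in> Van (int d) S" "f \<noteq> 0" for f
  proof -
    have "\<not> l dvd f"
    proof
      assume "l dvd f"
      then obtain g where g: "f = l * g" by blast
      then have "g = 0" using Van_basis_dvd[of S l "int d" g] S l f by auto
      then show False using f g by simp
    qed
    moreover have "f \<in> Pol (int d)" "\<And>x. x \<in> X \<Longrightarrow> ev l x = 0" using f X by (auto simp: Van_def)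
    ultimately have "card {x \<in> X. ev f x = 0} \<le> d * tdeg l"
      by (intro prime_zeros_le[OF prime_elem_tdeg1[OF l(2,1)] _ _ finX])
    then show ?thesis using l by simp
  qed
  have drop: "vdim (int d) S' \<le> vdim (int d) (S' \<union> set xs) + length xs" for S' xs
  proof (induction xs arbitrary: S')
    case (Cons x xs)
    show ?case using vdim_insert_le[of "int d" S' x] Cons[of "insert x S'"] by simp
  qed simp
  \<comment> \<open>Two independent curves through \<open>S\<close> and \<open>d\<close> distinct
    points of \<open>X\<close> would allow one more zero on the line, which exceeds the bound
    \<open>z\<close>.\<close>
  have f1: "vdim (int d) (S \<union> set xs) = 1 \<and> (\<forall>f\<in>Van (int d) (S \<union> set xs). f \<noteq> 0 \<longrightarrow> {x \<in> X. ev f x = 0} = set xs)"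
    if xs: "xs \<in> tuples d X" "distinct xs" for xs
  proof -
    have c: "card (set xs) = d" using xs distinct_card by auto
    obtain x where x: "x \<in> X" "x \<notin> set xs"
    proof -
      have "\<not> X \<subseteq> set xs" using X(2) c card_mono[of "set xs" X] by auto
      then show thesis using that by blast
    qed
    have "\<not> 2 \<le> vdim (int d) (S \<union> set xs)"
    proof
      assume "2 \<le> vdim (int d) (S \<union> set xs)"
      then have "0 < vdim (int d) (insert x (S \<union> set xs))" using vdim_insert_le[of "int d" "S \<union> set xs" x] by simp
      then obtain f where f: "f \<in> Van (int d) (insert x (S \<union> set xs))" "f \<noteq> 0" using vdim_pos by blast
      have "insert x (set xs) \<subseteq> {x \<in> X. ev f x = 0}" using f xs x by (auto simp: Van_def)
      then have "card (insert x (set xs)) \<le> card {x \<in> X. ev f x = 0}" using finX by (intro card_mono) auto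
      also have "\<dots> \<le> d" using f by (intro z) (auto simp: Van_def)
      finally show False using x c by simp
    qed
    moreover have "1 \<le> vdim (int d) (S \<union> set xs)" using drop[of S xs] vS xs by simp
    moreover have "{x \<in> X. ev f x = 0} = set xs" if f: "f \<in> Van (int d) (S \<union> set xs)" "f \<noteq> 0" for f
    proof (rule card_seteq[symmetric])
      show "finite {x \<in> X. ev f x = 0}" using finX by simp
      show "set xs \<subseteq> {x \<in> X. ev f x = 0}" using f xs by (auto simp: Van_def)
      show "card {x \<in> X. ev f x = 0} \<le> card (set xs)" unfolding c using f by (intro z) (auto simp: Van_def)
    qed
    ultimately show ?thesis by auto
  qed
  \<comment> \<open>Tuples whose curve also passes through a stray point \<open>y\<close>; avoiding
    them all makes the trace exactly \<open>S \<union> set xs\<close>.\<close>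
  define bad where "bad y = {xs \<in> tuples d X. \<exists>f\<in>Van (int d) (insert y S \<union> set xs). f \<noteq> 0}" for y
  have bad: "card (bad y) * card X \<le> d * d * card X ^ d" if y: "y \<notin> S" for y
  proof -
    obtain f where "f \<in> Van (int d) S" "ev f y \<noteq> 0" using indep_step[of "int d" S y] S(2) y by auto
    then have "vdim (int d) (insert y S) = d" using vdim_insert_new[of f "int d" S y] vS by simp
    then show ?thesis unfolding bad_def
      using z by (intro card_vanishing_tuples_le finX) (auto simp: Van_insert)
  qed
  define G where "G = {xs \<in> tuples d X. distinct xs \<and> (\<forall>y\<in>A - X - S. xs \<notin> bad y)}"
  have "tuples d X \<subseteq> G \<union> {xs \<in> tuples d X. \<not> distinct xs} \<union> (\<Union>y\<in>A - X - S. bad y)" by (auto simp: G_def)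
  moreover have "finite (G \<union> {xs \<in> tuples d X. \<not> distinct xs} \<union> (\<Union>y\<in>A - X - S. bad y))"
    using finX fin unfolding G_def bad_def by simp
  ultimately have "card (tuples d X) \<le> card (G \<union> {xs \<in> tuples d X. \<not> distinct xs} \<union> (\<Union>y\<in>A - X - S. bad y))"
    by (rule card_mono[rotated])
  also have "\<dots> \<le> card G + card {xs \<in> tuples d X. \<not> distinct xs} + (\<Sum>y\<in>A - X - S. card (bad y))"
    using card_UN_le[of "A - X - S" bad] fin
    by (intro order.trans[OF card_Un_le] add_mono card_Un_le) auto
  finally have "card X ^ d * card X \<le> (card G + card {xs \<in> tuples d X. \<not> distinct xs} + (\<Sum>y\<in>A - X - S. card (bad y))) * card X"
    by (simp add: card_lists_length_eq[OF finX])
  also have "\<dots> = card G * card X + card {xs \<in> tuples d X. \<not> distinct xs} * card X + (\<Sum>y\<in>A - X - S. card (bad y) * card X)"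
    by (simp add: algebra_simps sum_distrib_left)
  also have "(\<Sum>y\<in>A - X - S. card (bad y) * card X) \<le> (\<Sum>y\<in>A - X - S. d ^ 2 * card X ^ d)"
    using bad by (intro sum_mono) (auto simp: power2_eq_square)
  also have "\<dots> \<le> card (A - X) * (d ^ 2 * card X ^ d)"
    using fin by (auto intro!: mult_right_mono card_mono)
  also have "card {xs \<in> tuples d X. \<not> distinct xs} * card X \<le> d ^ 2 * card X ^ d" by (rule card_not_distinct_le[OF finX])
  finally have "card X ^ d * card X \<le> card G * card X + (card (A - X) + 1) * d ^ 2 * card X ^ d"
    by (simp add: algebra_simps)
  then have "2 * card X ^ d * card X \<le> 2 * card G * card X + (2 * d ^ 2 * (card (A - X) + 1)) * card X ^ d"
    by (simp add: algebra_simps)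
  also have "\<dots> \<le> 2 * card G * card X + card X * card X ^ d" using Y by (intro add_left_mono mult_right_mono) auto
  finally have "card X ^ d * card X \<le> 2 * card G * card X" by (simp add: algebra_simps)
  then have 1: "card X ^ d \<le> 2 * card G" using X(2) by simp
  \<comment> \<open>Intersecting with \<open>X\<close> returns \<open>set xs\<close>, so different
    point sets give different traces.\<close>
  have "card G \<le> card ((\<lambda>T. T \<inter> X) ` {T. ordset d A T}) * d ^ d"
  proof (rule card_lists_with_set)
    show "finite ((\<lambda>T. T \<inter> X) ` {T. ordset d A T})" using finite_ordset[OF fin] by simp
    fix xs assume "xs \<in> G"
    then have xs: "xs \<in> tuples d X" "distinct xs" "\<And>y. y \<in> A - X - S \<Longrightarrow> xs \<notin> bad y" by (auto simp: G_def)
    have c: "card (set xs) = d" using xs distinct_card by auto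
    have v1: "vdim (int d) (S \<union> set xs) = 1" using f1[OF xs(1,2)] by blast
    then obtain f where f: "f \<in> Van (int d) (S \<union> set xs)" "f \<noteq> 0" using vdim_pos[of "int d" "S \<union> set xs"] by auto
    have fX: "{x \<in> X. ev f x = 0} = set xs" using f1[OF xs(1,2)] f by blast
    have "S \<union> set xs = zs A f"
    proof (intro equalityI subsetI)
      fix y assume "y \<in> S \<union> set xs"
      then show "y \<in> zs A f" using S(1) xs(1) X f by (auto simp: Van_def zs_def)
    next
      fix y assume y: "y \<in> zs A f"
      show "y \<in> S \<union> set xs"
      proof (rule ccontr)
        assume n: "y \<notin> S \<union> set xs"
        then have "y \<in> A - X - S" using y fX by (auto simp: zs_def)
        moreover have "f \<in> Van (int d) (insert y S \<union> set xs)" using f y by (auto simp: Van_def zs_def)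
        then have "xs \<in> bad y" using f xs by (auto simp: bad_def)
        ultimately show False using xs by blast
      qed
    qed
    moreover have "2 * card (S \<union> set xs) + 3 * d \<le> 3 * d ^ 2 + 4"
    proof -
      have "card (S \<union> set xs) \<le> pd (int d - 1) + d" using card_Un_le[of S "set xs"] S c by simp
      then have "2 * card (S \<union> set xs) + 2 \<le> 2 * pd (int d)" using pd by simp
      then have "2 * card (S \<union> set xs) + 2 \<le> (d + 1) * (d + 2)" using pd_nat[of d] by simp
      moreover obtain e where e: "d = Suc e" using d by (cases d) auto
      \<comment> \<open>Half the difference of the two sides is (d - 1) (d - 2).\<close>
      have "6 * d \<le> 2 * d ^ 2 + 4" unfolding e power2_eq_square by (cases e) auto
      ultimately show ?thesis by (simp add: power2_eq_square algebra_simps)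
    qed
    ultimately have "ordset d A (S \<union> set xs)"
      unfolding ordset_def using v1 f by (auto simp: Van_def)
    moreover have "(S \<union> set xs) \<inter> X = set xs" using S(1) X xs by auto
    ultimately show "length xs = d \<and> set xs \<in> (\<lambda>T. T \<inter> X) ` {T. ordset d A T} \<and> card (set xs) \<le> d"
      using xs c by (metis (mono_tags, lifting) image_eqI mem_Collect_eq order_refl)
  qed
  also have "\<dots> \<le> card {T. ordset d A T} * d ^ d"
    using finite_ordset[OF fin] by (intro mult_right_mono card_image_le) auto
  finally show ?thesis using 1 by linarith
qed

section \<open>Generic base points\<close>

definition lin_indep2 :: "bipoly \<Rightarrow> bipoly \<Rightarrow> bool" where
  "lin_indep2 f g \<longleftrightarrow> (\<forall>r s. cmul r f + cmul s g = 0 \<longrightarrow> r = 0 \<and> s = 0)"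

lemma cmul_mult: "cmul r (h * f) = h * cmul r f"
  by (simp add: cmul_def)

lemma lin_indep2_mult: "lin_indep2 (h * f) (h * g) \<longleftrightarrow> h \<noteq> 0 \<and> lin_indep2 f g"
proof -
  have "lin_indep2 (h * f) (h * g) \<longleftrightarrow> (\<forall>r s. h * (cmul r f + cmul s g) = 0 \<longrightarrow> r = 0 \<and> s = 0)"
    by (simp add: lin_indep2_def cmul_mult distrib_left)
  then show ?thesis by (auto simp: lin_indep2_def)
qed

lemma lin_indep2_nonzero: "lin_indep2 f g \<Longrightarrow> f \<noteq> 0" "lin_indep2 f g \<Longrightarrow> g \<noteq> 0"
  unfolding lin_indep2_def by (metis add_0 add_0_right pv.scale_zero_left pv.scale_zero_right zero_neq_one)+

lemma vdim_ge2:
  assumes "2 \<le> vdim t S"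
  obtains f g where "f \<in> Van t S" "g \<in> Van t S" "lin_indep2 f g"
  using dim_two[OF Van_fin_dim Van_subspace, of t S] assms unfolding vdim_def lin_indep2_def by metis

lemma lin_indep2_vdim:
  assumes "f \<in> Van t S" "g \<in> Van t S" "lin_indep2 f g"
  shows "2 \<le> vdim t S"
proof -
  have "pv.dim {0} + 2 \<le> pv.dim (Van t S)"
    using assms by (intro dim_insert2_ge[OF Van_fin_dim Van_subspace, of "{0}" t S f g])
      (auto simp: lin_indep2_def)
  then show ?thesis by (simp add: vdim_def)
qed

text \<open>The cofactors stay linearly independent, hence cannot both be constant; this keeps the
  degree of the common factor below \<open>d\<close>.\<close>

lemma not_coprime_factor:
  assumes f: "f \<in> Pol (int d)" "g \<in> Pol (int d)" "lin_indep2 f g" and nc: "\<not> coprime f g"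
  obtains h w1 w2 where "f = h * w1" "g = h * w2" "lin_indep2 w1 w2" "1 \<le> tdeg h" "tdeg h < d"
    "w1 \<in> Pol (int d - int (tdeg h))" "w2 \<in> Pol (int d - int (tdeg h))"
proof -
  obtain h where h: "h dvd f" "h dvd g" "\<not> is_unit h" using nc by (auto simp: coprime_def)
  then obtain w1 w2 where w: "f = h * w1" "g = h * w2" by (auto elim!: dvdE)
  have i: "h \<noteq> 0" "lin_indep2 w1 w2" using f(3) unfolding w lin_indep2_mult by auto
  have p: "w1 \<in> Pol (int d - int (tdeg h))" "w2 \<in> Pol (int d - int (tdeg h))"
    using f(1,2) Pol_div[OF i(1)] unfolding w by auto
  have "2 \<le> vdim (int d - int (tdeg h)) {}" using p i(2) by (intro lin_indep2_vdim) auto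
  moreover have "pd t \<le> 1" if "t \<le> 0" for t
  proof (cases "t = 0")
    case True then show ?thesis by (simp add: pd_def)
  next
    case False then show ?thesis using that pd_neg[of t] by simp
  qed
  ultimately have "\<not> int d - int (tdeg h) \<le> 0" by fastforce
  then have "tdeg h < d" by simp
  then show thesis using that w i p tdeg_pos[OF i(1) h(3)] by blast
qed

text \<open>Curves of the net through \<open>B\<close> have no common component, so by Bezout a point of the
  associated projective plane comes from at most \<open>d\<^sup>2 - card B\<close> points outside \<open>B\<close>.\<close>

definition good :: "nat \<Rightarrow> (real \<times> real) set \<Rightarrow> bool" where
  "good d B \<longleftrightarrow> indep (int d) B \<and> card B + 3 = pd (int d) \<and>
     (\<forall>f\<in>Van (int d) B. \<forall>g\<in>Van (int d) B. lin_indep2 f g \<longrightarrow> coprime f g)"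

text \<open>The net curves through \<open>a\<close> form a pencil, and Bezout applies to two
  independent members. Coprimality is asked only of this pencil, since the whole net of conics
  through a triangle fails to have it.\<close>

lemma card_netcl_le:
  assumes fin: "finite A" and B: "indep (int d) B" "card B + 3 = pd (int d)"
    and cop: "\<And>f g. f \<in> Van (int d) (insert a B) \<Longrightarrow> g \<in> Van (int d) (insert a B) \<Longrightarrow> lin_indep2 f g \<Longrightarrow> coprime f g"
    and f: "f \<in> Van (int d) B" "ev f a \<noteq> 0"
  shows "card (netcl d A B a) \<le> d ^ 2"
proof -
  have "vdim (int d) B = 3" using indep_vdim[OF B(1)] B(2) by simp
  then have "vdim (int d) (insert a B) = 2" using vdim_insert_new[OF f] by simp
  then obtain g h where gh: "g \<in> Van (int d) (insert a B)" "h \<in> Van (int d) (insert a B)" "lin_indep2 g h"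
    using vdim_ge2[of "int d" "insert a B"] by auto
  have nz: "g \<noteq> 0" "h \<noteq> 0" using lin_indep2_nonzero gh(3) by auto
  have "finite (netcl d A B a)" using finite_subset[OF netcl_contains(3) fin] .
  then have "card (netcl d A B a) \<le> tdeg g * tdeg h"
    using gh by (intro bezout[OF cop[OF gh] nz]) (auto simp: netcl_def)
  also have "\<dots> \<le> d * d" using gh nz Pol_iff by (intro mult_mono) (auto simp: Van_def)
  finally show ?thesis by (simp add: power2_eq_square)
qed

lemma netcl_cover:
  assumes R: "\<And>x f. x \<in> A \<Longrightarrow> f \<in> Van (int d) B \<Longrightarrow> ev f x \<noteq> 0 \<Longrightarrow> \<exists>a\<in>R. x \<in> netcl d A B a"
    and f: "f \<in> Van (int d) (B \<union> R)" and x: "x \<in> A"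
  shows "ev f x = 0"
proof (rule ccontr)
  assume n: "ev f x \<noteq> 0"
  then obtain a where "a \<in> R" "x \<in> netcl d A B a" using R[OF x, of f] f by (auto simp: Van_def)
  then show False using f n by (auto simp: netcl_def Van_def)
qed

text \<open>Extending \<open>B\<close> to a basis inside \<open>B \<union> R\<close> takes exactly
  three points of \<open>R\<close>; any further representative can be left out. It serves as the
  point to be avoided, with the others still non-collinear.\<close>

lemma ex_superfluous_rep:
  assumes B: "indep (int d) B" "card B + 3 = pd (int d)" and R: "finite R" "R \<inter> B = {}" and V: "Van (int d) (B \<union> R) = {0}"
  shows "card R \<le> 3 \<or> (\<exists>q\<in>R. Van (int d) (B \<union> (R - {q})) = {0})"
proof -
  have fBR: "finite (B \<union> R)" using R B(1) by (simp add: indep_def)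
  obtain S0 where S0: "B \<subseteq> S0" "S0 \<subseteq> B \<union> R" "indep (int d) S0" "Van (int d) S0 = {0}"
    using indep_extend[OF B(1) _ fBR] V by auto
  have cS0: "card S0 = card B + 3" using indep_spanning_card[OF S0(3,4)] B(2) by simp
  have finS0: "finite S0" using S0 by (simp add: indep_def)
  show ?thesis
  proof (cases "R \<subseteq> S0")
    case True
    then have "R \<subseteq> S0 - B" using R by blast
    then have "card R \<le> card (S0 - B)" using finS0 by (intro card_mono) auto
    also have "\<dots> = 3" using S0(1) cS0 finS0 by (simp add: card_Diff_subset finite_subset)
    finally show ?thesis by simp
  next
    case False
    then obtain q where q: "q \<in> R" "q \<notin> S0" by blast
    have "Van (int d) (B \<union> (R - {q})) \<subseteq> Van (int d) S0" using S0(2) q by (intro Van_anti) auto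
    then have "Van (int d) (B \<union> (R - {q})) = {0}"
      using S0(4) zero_Van[of "int d" "B \<union> (R - {q})"] by blast
    then show ?thesis using q(1) by blast
  qed
qed

text \<open>The fibres cover \<open>A\<close> with at most d^2 points each, so there are many
  representatives, hence many ordinary lines.\<close>

lemma good_count:
  assumes fin: "finite A" and A: "Van (int d) A = {0}" and B: "B \<subseteq> A" "good d B"
  shows "card A \<le> d ^ 2 * (10 * card {T. ordset d A T \<and> B \<subseteq> T} + 4)"
proof -
  have Bi: "indep (int d) B" "card B + 3 = pd (int d)"
    and cop: "\<And>f g. f \<in> Van (int d) B \<Longrightarrow> g \<in> Van (int d) B \<Longrightarrow> lin_indep2 f g \<Longrightarrow> coprime f g"
    using B(2) by (auto simp: good_def)
  obtain R where R: "R \<subseteq> A" "\<And>a. a \<in> R \<Longrightarrow> \<exists>f\<in>Van (int d) B. ev f a \<noteq> 0"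
    "\<And>x f. x \<in> A \<Longrightarrow> f \<in> Van (int d) B \<Longrightarrow> ev f x \<noteq> 0 \<Longrightarrow> \<exists>a\<in>R. x \<in> netcl d A B a"
    "\<And>a b. a \<in> R \<Longrightarrow> b \<in> R \<Longrightarrow> a \<noteq> b \<Longrightarrow> b \<notin> netcl d A B a"
    "\<And>q. q \<in> R \<Longrightarrow> Van (int d) (B \<union> (R - {q})) = {0} \<Longrightarrow>
       card R \<le> 10 * card {e. \<exists>a b. e = {a, b} \<and> a \<in> R \<and> b \<in> R \<and> a \<noteq> b \<and> q \<notin> e \<and> netpair d A B a b} + 4"
    by (rule net_representatives[OF fin B(1) Bi]) (rule that; assumption)
  have finR: "finite R" using R(1) fin finite_subset by blast
  have c: "card (netcl d A B a) \<le> d ^ 2" if a: "a \<in> R" for a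
  proof -
    obtain f where "f \<in> Van (int d) B" "ev f a \<noteq> 0" using R(2)[OF a] by blast
    then show ?thesis using cop by (intro card_netcl_le[OF fin Bi]) (auto simp: Van_insert)
  qed
  have "f \<in> Van (int d) A" if "f \<in> Van (int d) (B \<union> R)" for f
    using netcl_cover[of A d B R f, OF R(3) that] that by (simp add: Van_def)
  then have V0: "Van (int d) (B \<union> R) = {0}" using A zero_Van[of "int d" "B \<union> R"] by blast
  have "vdim (int d) B \<noteq> 0" using indep_vdim[OF Bi(1)] Bi(2) by simp
  then have "R \<noteq> {}" using V0 vdim_0_iff by auto
  then have "A \<subseteq> (\<Union>a\<in>R. netcl d A B a)"
  proof -
    obtain a where a: "a \<in> R" using \<open>R \<noteq> {}\<close> by blast
    have "x \<in> (\<Union>a\<in>R. netcl d A B a)" if x: "x \<in> A" for x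
    proof (cases "\<exists>f\<in>Van (int d) B. ev f x \<noteq> 0")
      case False
      then have "x \<in> netcl d A B a" using x by (auto simp: netcl_def Van_insert)
      then show ?thesis using a by blast
    qed (use R(3) x in blast)
    then show ?thesis by blast
  qed
  then have "card A \<le> card (\<Union>a\<in>R. netcl d A B a)"
    using finR finite_subset[OF netcl_contains(3) fin] by (intro card_mono) auto
  also have "\<dots> \<le> (\<Sum>a\<in>R. card (netcl d A B a))" using finR by (rule card_UN_le)
  also have "\<dots> \<le> d ^ 2 * card R" using sum_bounded_above[of R "\<lambda>a. card (netcl d A B a)" "d ^ 2"] c by (simp add: mult.commute)
  also have "card R \<le> 10 * card {T. ordset d A T \<and> B \<subseteq> T} + 4"
  proof -
    have RB: "R \<inter> B = {}" using R(2) by (auto simp: Van_def)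
    from ex_superfluous_rep[OF Bi finR RB V0] show ?thesis
    proof
      assume "\<exists>q\<in>R. Van (int d) (B \<union> (R - {q})) = {0}"
      then obtain q where q: "q \<in> R" "Van (int d) (B \<union> (R - {q})) = {0}" by blast
      let ?E = "{e. \<exists>a b. e = {a, b} \<and> a \<in> R \<and> b \<in> R \<and> a \<noteq> b \<and> q \<notin> e \<and> netpair d A B a b}"
      have "card R \<le> 10 * card ?E + 4" by (rule R(5)[OF q])
      moreover have "card ?E \<le> card {T. ordset d A T \<and> B \<subseteq> T}"
      proof (rule card_netpairs_le[OF fin B(1) Bi(2) R(1,4)])
        fix e assume "e \<in> ?E"
        then obtain a b where ab: "e = {a, b}" "a \<in> R" "b \<in> R" "netpair d A B a b" by blast
        then show "\<exists>a b. e = {a, b} \<and> a \<in> R \<and> b \<in> R \<and> netpair d A B a b \<and>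
            card (netcl d A B a) \<le> d ^ 2 \<and> card (netcl d A B b) \<le> d ^ 2"
          using c by blast
      qed
      ultimately show ?thesis by simp
    qed simp
  qed
  finally show ?thesis by simp
qed

text \<open>For d = 1 the net is the space of all lines, and two independent linear polynomials
  share no factor of positive degree.\<close>

lemma good_empty: "good 1 {}"
proof -
  have "coprime f g" if fg: "f \<in> Pol (int 1)" "g \<in> Pol (int 1)" "lin_indep2 f g" for f g
  proof (rule ccontr)
    assume "\<not> coprime f g"
    then obtain h w1 w2 where "f = h * w1" "g = h * w2" "lin_indep2 w1 w2" "1 \<le> tdeg h" "tdeg h < 1"
      by (rule not_coprime_factor[OF fg]) (rule that; assumption)
    then show False by simp
  qed
  moreover have "pd 1 = 3" by (simp add: pd_def)
  ultimately show ?thesis by (auto simp: good_def)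
qed

section \<open>Arithmetic of the dimension function\<close>

lemma pd_Suc: "pd (t + 1) = pd t + nat (t + 2)"
proof (cases "t < -1")
  case False
  then have "t = int (nat (t + 1)) - 1" by simp
  then obtain n where n: "t = int n - 1" by blast
  have "2 * pd (t + 1) = (n + 1) * (n + 2)" using pd_nat[of n] n by simp
  moreover have "2 * pd t = n * (n + 1)" using pd2[of t] n by (simp add: nat_add_distrib)
  moreover have "nat (t + 2) = n + 1" using n by simp
  ultimately show ?thesis by (simp add: algebra_simps)
qed (auto simp: pd_def)

lemma pd_mono: "s \<le> t \<Longrightarrow> pd s \<le> pd t"
proof (induction t rule: int_ge_induct)
  case (step i) then show ?case by (simp add: pd_Suc)
qed simp

lemma pd_split: "pd (int (u + v)) + 1 = pd (int u) + pd (int v) + u * v"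
  using pd_nat[of "u + v"] pd_nat[of u] pd_nat[of v] by (simp add: algebra_simps)

text \<open>Companion of \<open>pd_split\<close> in degrees lowered by e: in the difference of the
  two relations the terms u v cancel. Truncation of \<open>pd\<close> at negative degrees works in
  the right direction.\<close>

lemma pd_superadd: "pd (int (u + v) - e) \<le> pd (int u - e) + pd (int v - e) + u * v" if "1 \<le> e"
proof (induction u)
  case 0 then show ?case by simp
next
  case (Suc u)
  have "pd (int (Suc u + v) - e) = pd (int (u + v) - e) + nat (int (u + v) - e + 2)"
    using pd_Suc[of "int (u + v) - e"] by (simp add: algebra_simps)
  moreover have "pd (int (Suc u) - e) = pd (int u - e) + nat (int u - e + 2)"
    using pd_Suc[of "int u - e"] by (simp add: algebra_simps)
  moreover have "nat (int (u + v) - e + 2) \<le> nat (int u - e + 2) + v" by linarith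
  ultimately show ?case using Suc by simp
qed

text \<open>\<open>\<pi> x\<close> stands for the component on which \<open>x\<close> is chosen:
  \<open>x\<close> imposes a new condition on the curves through \<open>T\<close> unless all of them
  contain that component. All degrees and all subsets are quantified over, because a common factor
  splits the degree and the base set in an unforeseen way.\<close>

definition generic :: "nat \<Rightarrow> (real \<times> real \<Rightarrow> bipoly) \<Rightarrow> (real \<times> real) set \<Rightarrow> real \<times> real \<Rightarrow> bool" where
  "generic d \<pi> S x \<longleftrightarrow> x \<notin> S \<and> (\<forall>t\<le>d. \<forall>T\<subseteq>S. (\<exists>f\<in>Van (int t) T. \<not> \<pi> x dvd f) \<longrightarrow> (\<exists>f\<in>Van (int t) T. ev f x \<noteq> 0))"

definition generic_list :: "nat \<Rightarrow> (real \<times> real \<Rightarrow> bipoly) \<Rightarrow> (real \<times> real) set \<Rightarrow> (real \<times> real) list \<Rightarrow> bool" where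
  "generic_list d \<pi> S xs \<longleftrightarrow> (\<forall>i<length xs. generic d \<pi> (S \<union> set (take i xs)) (xs ! i))"

lemma generic_list_Nil [simp]: "generic_list d \<pi> S []"
  by (simp add: generic_list_def)

lemma generic_list_snoc:
  "generic_list d \<pi> S (xs @ [x]) \<longleftrightarrow> generic_list d \<pi> S xs \<and> generic d \<pi> (S \<union> set xs) x"
  by (auto simp: generic_list_def nth_append less_Suc_eq)

lemma generic_list_distinct: "generic_list d \<pi> S xs \<Longrightarrow> distinct xs \<and> set xs \<inter> S = {}"
proof (induction xs rule: rev_induct)
  case (snoc x xs) then show ?case by (auto simp: generic_list_snoc generic_def)
qed simp

text \<open>Induct by removing the last point, which is generic over all earlier ones. Removing
  points enlarges the vanishing space, so a polynomial not divisible by \<open>\<pi> c\<close>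
  remains available.\<close>

lemma generic_vdim:
  assumes "generic_list d \<pi> S xs" "t \<le> d" "T0 \<subseteq> S" "D \<subseteq> set xs"
    and "\<And>c. c \<in> D \<Longrightarrow> \<exists>f\<in>Van (int t) (T0 \<union> D). \<not> \<pi> c dvd f"
  shows "vdim (int t) (T0 \<union> D) + card D = vdim (int t) T0"
  using assms
proof (induction xs arbitrary: D rule: rev_induct)
  case (snoc x xs)
  have g: "generic_list d \<pi> S xs" "generic d \<pi> (S \<union> set xs) x" using snoc.prems(1) by (auto simp: generic_list_snoc)
  have sub: "Van (int t) (T0 \<union> D) \<subseteq> Van (int t) (T0 \<union> (D - {x}))" by (rule Van_anti) auto
  have IH: "vdim (int t) (T0 \<union> (D - {x})) + card (D - {x}) = vdim (int t) T0"
  proof (rule snoc.IH[OF g(1)])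
    show "\<exists>f\<in>Van (int t) (T0 \<union> (D - {x})). \<not> \<pi> c dvd f" if "c \<in> D - {x}" for c
      using snoc.prems(5)[of c] sub that by blast
  qed (use snoc.prems in auto)
  show ?case
  proof (cases "x \<in> D")
    case False then show ?thesis using IH by simp
  next
    case True
    have ex: "\<exists>f\<in>Van (int t) (T0 \<union> (D - {x})). \<not> \<pi> x dvd f" using snoc.prems(5)[OF True] sub by blast
    obtain f where "f \<in> Van (int t) (T0 \<union> (D - {x}))" "ev f x \<noteq> 0"
    proof -
      have "T0 \<union> (D - {x}) \<subseteq> S \<union> set xs" using snoc.prems(3,4) by auto
      then show thesis using g(2) snoc.prems(2) ex that unfolding generic_def by blast
    qed
    from vdim_insert_new[OF this] have "vdim (int t) (T0 \<union> (D - {x})) = vdim (int t) (T0 \<union> D) + 1"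
      using True by (simp add: insert_absorb flip: Un_insert_right)
    moreover have "card D = card (D - {x}) + 1"
      using card_Suc_Diff1[OF finite_subset[OF snoc.prems(4) finite_set] True] by simp
    ultimately show ?thesis using IH by simp
  qed
qed simp

lemma card_split: "finite S \<Longrightarrow> T \<subseteq> S \<Longrightarrow> card T + card (S - T) = card S"
  by (metis card_Diff_subset card_mono finite_subset le_add_diff_inverse)

text \<open>Suppose two independent net curves share a factor h. Its zeros divide the base points
  into those it carries and those left to the cofactors. Multiples of \<open>\<eta>\<close> together
  with h, or with both cofactors, bound the two vanishing spaces from below; genericity bounds them
  from above, and the Hilbert functions of the two parts of \<open>S\<close> make the bounds
  incompatible. For \<open>d < e\<close> the curve \<open>\<eta>\<close> is a dummy that has no
  multiples in these degrees, and the generic points may lie anywhere.\<close>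

lemma good_of_generic:
  assumes d: "3 \<le> d" and \<eta>: "\<eta> \<noteq> 0" "e = tdeg \<eta>" "2 \<le> e"
    and S: "\<And>s. s \<in> S \<Longrightarrow> ev \<eta> s \<noteq> 0" "indep (int d - int e) S" "Van (int d - int e) S = {0}"
    and xs: "generic_list d \<pi> S xs" "length xs + pd (int d - int e) + 3 = pd (int d)"
    and on: "\<And>x. x \<in> set xs \<Longrightarrow> ev \<eta> x = 0 \<or> d < e"
    and \<pi>: "\<And>x f g. x \<in> set xs \<Longrightarrow> \<pi> x * f \<in> Van (int d) (S \<union> set xs) \<Longrightarrow>
       \<pi> x * g \<in> Van (int d) (S \<union> set xs) \<Longrightarrow> \<not> lin_indep2 f g"
  shows "good d (S \<union> set xs)"
proof -
  define C where "C = set xs"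
  have dis: "distinct xs" "C \<inter> S = {}" using generic_list_distinct[OF xs(1)] by (auto simp: C_def)
  have finS: "finite S" using S(2) by (simp add: indep_def)
  have finC: "finite C" by (simp add: C_def)
  have cS: "card S = pd (int d - int e)" using indep_spanning_card S by blast
  have cC: "card C = length xs" using dis distinct_card by (auto simp: C_def)
  have cSC: "card (S \<union> C) + 3 = pd (int d)"
    using card_Un_disjoint[OF finS finC] dis(2) cS cC xs(2) by (simp add: Int_commute)
  have \<pi>C: "\<not> lin_indep2 f g" if "x \<in> C" "\<pi> x * f \<in> Van (int d) (S \<union> C)" "\<pi> x * g \<in> Van (int d) (S \<union> C)" for x f g
    using \<pi> that unfolding C_def by blast
  have "indep (int d) S" using indep_mono[OF S(2)] by simp
  then have vS: "vdim (int d) S + card S = pd (int d)" by (rule indep_vdim)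
  have le: "vdim (int d) S \<le> vdim (int d) (S \<union> D) + card D" if "finite D" for D
    using that
  proof (induction D)
    case (insert x D)
    then show ?case using vdim_insert_le[of "int d" "S \<union> D" x] by simp
  qed simp
  \<comment> \<open>The dimension is at least 3, but two independent curves suffice to exclude that
    every curve contains some \<open>\<pi> c\<close>.\<close>
  have "2 \<le> vdim (int d) (S \<union> C)" using le[OF finC] vS cS cC xs(2) by simp
  then obtain f0 g0 where fg0: "f0 \<in> Van (int d) (S \<union> C)" "g0 \<in> Van (int d) (S \<union> C)" "lin_indep2 f0 g0"
    by (rule vdim_ge2)
  have "\<exists>f\<in>Van (int d) (S \<union> C). \<not> \<pi> c dvd f" if c: "c \<in> C" for c
  proof (rule ccontr)
    assume "\<not> ?thesis"
    then have "\<pi> c dvd f0" "\<pi> c dvd g0" using fg0 by auto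
    then obtain f g where "f0 = \<pi> c * f" "g0 = \<pi> c * g" by (auto elim!: dvdE)
    then show False using \<pi>C[OF c, of f g] fg0 lin_indep2_mult by blast
  qed
  then have vSC: "vdim (int d) (S \<union> C) + card C = vdim (int d) S"
    using generic_vdim[OF xs(1), of d S C] by (simp add: C_def)
  have "indep (int d) (S \<union> C)"
  proof -
    obtain S0 where S0: "S0 \<subseteq> S \<union> C" "indep (int d) S0" "Van (int d) S0 = Van (int d) (S \<union> C)"
      using indep_extend[of "int d" "{}" "S \<union> C"] finS finC by auto
    have "vdim (int d) (S \<union> C) + card S0 = pd (int d)" using indep_vdim[OF S0(2)] S0(3) by (simp add: vdim_def)
    then have "card S0 = card S + card C" using vSC vS by linarith
    then have "S0 = S \<union> C" using S0(1) finS finC dis(2)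
      by (intro card_subset_eq) (auto simp: card_Un_disjoint Int_commute)
    then show ?thesis using S0(2) by simp
  qed
  moreover have "coprime f g" if fg: "f \<in> Van (int d) (S \<union> C)" "g \<in> Van (int d) (S \<union> C)" "lin_indep2 f g" for f g
  proof (rule ccontr)
    assume nc: "\<not> coprime f g"
    obtain h w1 w2 where h: "f = h * w1" "g = h * w2" "lin_indep2 w1 w2" "1 \<le> tdeg h" "tdeg h < d"
      and w: "w1 \<in> Pol (int d - int (tdeg h))" "w2 \<in> Pol (int d - int (tdeg h))"
    proof (rule not_coprime_factor[OF _ _ fg(3) nc])
      show "f \<in> Pol (int d)" "g \<in> Pol (int d)" using fg Van_Pol by blast+
    qed (rule that; assumption)
    define u where "u = tdeg h"
    define v where "v = d - u"
    have uv: "1 \<le> u" "1 \<le> v" "u + v = d" "int d - int u = int v" using h by (auto simp: u_def v_def)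
    have h0: "h \<noteq> 0" using lin_indep2_nonzero(1)[OF fg(3)] h(1) by auto
    have hP: "h \<in> Pol (int u)" using Pol_iff[OF h0] by (simp add: u_def)
    have wP: "w1 \<in> Pol (int v)" "w2 \<in> Pol (int v)" using w uv by (auto simp: u_def)
    define S1 where "S1 = {s \<in> S. ev h s = 0}"
    define C1 where "C1 = {s \<in> C. ev h s = 0}"
    define S2 where "S2 = S - S1"
    define C2 where "C2 = C - C1"
    have hV: "h \<in> Van (int u) (S1 \<union> C1)" using hP by (auto simp: Van_def S1_def C1_def)
    have wV: "w1 \<in> Van (int v) (S2 \<union> C2)" "w2 \<in> Van (int v) (S2 \<union> C2)"
      using wP fg(1,2) unfolding h by (auto simp: Van_def S1_def C1_def S2_def C2_def)
    have nh: "\<not> \<pi> c dvd h" if c: "c \<in> C" for c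
    proof
      assume "\<pi> c dvd h"
      then obtain k where k: "h = \<pi> c * k" by blast
      then have "f = \<pi> c * (k * w1)" "g = \<pi> c * (k * w2)" using h by (auto simp: mult.assoc)
      moreover have "lin_indep2 (k * w1) (k * w2)" using h(3) h0 k by (auto simp: lin_indep2_mult)
      ultimately show False using \<pi>C[OF c] fg by metis
    qed
    have nw: "\<not> \<pi> c dvd w1 \<or> \<not> \<pi> c dvd w2" if c: "c \<in> C" for c
    proof (rule ccontr)
      assume "\<not> ?thesis"
      then obtain k1 k2 where k: "w1 = \<pi> c * k1" "w2 = \<pi> c * k2" by (auto elim!: dvdE)
      have "f = \<pi> c * (h * k1)" "g = \<pi> c * (h * k2)" using h k by (auto simp: ac_simps)
      moreover have "lin_indep2 (h * k1) (h * k2)" using h(3) h0 k by (auto simp: lin_indep2_mult)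
      ultimately show False using \<pi>C[OF c] fg by metis
    qed
    have 1: "vdim (int u) (S1 \<union> C1) + card C1 = vdim (int u) S1"
      using hV nh uv by (intro generic_vdim[OF xs(1)]) (auto simp: S1_def C1_def C_def)
    have 2: "vdim (int v) (S2 \<union> C2) + card C2 = vdim (int v) S2"
    proof (rule generic_vdim[OF xs(1)])
      show "\<exists>f\<in>Van (int v) (S2 \<union> C2). \<not> \<pi> c dvd f" if "c \<in> C2" for c
        using nw[of c] wV that unfolding C2_def by blast
    qed (use uv in \<open>auto simp: S2_def C2_def C_def\<close>)
    have cancel: "k = 0" if "\<eta> * k \<in> Van (int d) S" for k
      using Van_basis_dvd[of S \<eta> "int d" k] S \<eta> that by simp
    have \<eta>sub: "(*) \<eta> ` Van (int t - int e) S' \<subseteq> Van (int t) (S' \<union> C')" if "t < d" "C' \<subseteq> C" for t S' C'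
    proof (cases "d < e")
      case True
      then have "Van (int t - int e) S' \<subseteq> {0}" using that Pol_neg[of "int t - int e"] Van_Pol[of "int t - int e" S'] by simp
      then show ?thesis by auto
    next
      case False
      have "\<eta> * k \<in> Van (int t) (S' \<union> C')" if k: "k \<in> Van (int t - int e) S'" for k
      proof -
        have "\<eta> * k \<in> Pol (int t)"
          using Pol_mult[of \<eta> "int e" k "int t - int e"] Pol_iff[OF \<eta>(1)] \<eta>(2) k by (simp add: Van_def)
        moreover have "ev \<eta> x = 0" if "x \<in> C'" for x using on[of x] False \<open>C' \<subseteq> C\<close> that by (auto simp: C_def)
        ultimately show ?thesis using k by (auto simp: Van_def)
      qed
      then show ?thesis by blast
    qed
    have \<eta>dim: "pv.dim ((*) \<eta> ` Van t S') = vdim t S'" for t S'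
      using mult_dim(1)[OF \<eta>(1) Van_fin_dim] by (simp add: vdim_def)
    have fS: "f \<in> Van (int d) S" "g \<in> Van (int d) S" using fg Van_anti[of S "S \<union> C"] by auto
    \<comment> \<open>Besides the multiples of \<open>\<eta>\<close> the space contains h, which is
      none of them, as no nonzero curve through \<open>S\<close> is divisible by
      \<open>\<eta>\<close>. The two cofactors contribute 2 in the same way.\<close>
    have 3: "vdim (int u - int e) S1 + 1 \<le> vdim (int u) (S1 \<union> C1)"
      unfolding \<eta>dim[of "int u - int e" S1, symmetric] vdim_def[of "int u" "S1 \<union> C1"]
    proof (rule dim_insert_ge[OF Van_fin_dim _ _ hV])
      show "pv.subspace ((*) \<eta> ` Van (int u - int e) S1)" by (rule mult_subspace[OF Van_subspace])
      show "(*) \<eta> ` Van (int u - int e) S1 \<subseteq> Van (int u) (S1 \<union> C1)" using uv by (intro \<eta>sub) (auto simp: C1_def)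
      show "h \<notin> (*) \<eta> ` Van (int u - int e) S1"
      proof
        assume "h \<in> (*) \<eta> ` Van (int u - int e) S1"
        then obtain k where k: "h = \<eta> * k" by blast
        then have "k * w1 = 0" using cancel[of "k * w1"] fS h by (simp add: mult.assoc)
        then show False using h0 k lin_indep2_nonzero(1)[OF h(3)] by auto
      qed
    qed
    have 4: "vdim (int v - int e) S2 + 2 \<le> vdim (int v) (S2 \<union> C2)"
      unfolding \<eta>dim[of "int v - int e" S2, symmetric] vdim_def[of "int v" "S2 \<union> C2"]
    proof (rule dim_insert2_ge[OF Van_fin_dim Van_subspace _ _ wV])
      show "pv.subspace ((*) \<eta> ` Van (int v - int e) S2)" by (rule mult_subspace[OF Van_subspace])
      show "(*) \<eta> ` Van (int v - int e) S2 \<subseteq> Van (int v) (S2 \<union> C2)" using uv by (intro \<eta>sub) (auto simp: C2_def)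
      fix r s assume "cmul r w1 + cmul s w2 \<in> (*) \<eta> ` Van (int v - int e) S2"
      then obtain k where k: "cmul r w1 + cmul s w2 = \<eta> * k" by blast
      have "cmul r f + cmul s g = \<eta> * (h * k)"
        using k by (simp add: h cmul_mult mult.left_commute flip: distrib_left)
      moreover have "cmul r f + cmul s g \<in> Van (int d) S"
        using fS by (intro pv.subspace_add pv.subspace_scale Van_subspace)
      ultimately have "h * k = 0" using cancel by metis
      then have "cmul r w1 + cmul s w2 = 0" using k h0 by simp
      then show "r = 0 \<and> s = 0" using h(3) by (auto simp: lin_indep2_def)
    qed
    have fin12: "finite S1" "finite S2" using finS by (auto simp: S1_def S2_def)
    have cS12: "card S1 + card S2 = pd (int d - int e)"
      using card_split[OF finS, of S1] cS by (auto simp: S1_def S2_def)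
    have cC12: "card C1 + card C2 = card C"
      using card_split[OF finC, of C1] by (auto simp: C1_def C2_def)
    have H1: "pd (int u) - vdim (int u) S1 \<ge> min (card S1) (pd (int u - int e) - vdim (int u - int e) S1 + 2)"
      using hilbert_step2[OF fin12(1), of "int u"] hilbert_mono[OF fin12(1), of "int u - int e" "int u - 2"] uv \<eta>(3)
      by linarith
    have H2: "pd (int v) - vdim (int v) S2 \<ge> min (card S2) (pd (int v - int e) - vdim (int v - int e) S2 + 2)"
      using hilbert_step2[OF fin12(2), of "int v"] hilbert_mono[OF fin12(2), of "int v - int e" "int v - 2"] uv \<eta>(3)
      by linarith
    have M1: "pd (int u) - vdim (int u) S1 \<ge> pd (int u - int e) - vdim (int u - int e) S1"
      "pd (int v) - vdim (int v) S2 \<ge> pd (int v - int e) - vdim (int v - int e) S2"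
      using hilbert_mono[OF fin12(1)] hilbert_mono[OF fin12(2)] by auto
    have N1: "pd (int d) + 1 = pd (int u) + pd (int v) + u * v" using pd_split[of u v] uv by simp
    have N2: "pd (int d - int e) \<le> pd (int u - int e) + pd (int v - int e) + u * v"
      using pd_superadd[of "int e" u v] \<eta>(3) uv by simp
    \<comment> \<open>This rests on \<open>d \<ge> 3\<close>: for conics u = v = 1 gives the product
      1.\<close>
    have N3: "2 \<le> u * v"
    proof -
      have "(u - 1) * (v - 1) + (u + v) = u * v + 1" using uv by (cases u; cases v) auto
      then show ?thesis using d uv by linarith
    qed
    have V: "vdim (int u) S1 \<le> pd (int u)" "vdim (int v) S2 \<le> pd (int v)"
      "vdim (int u - int e) S1 \<le> pd (int u - int e)" "vdim (int v - int e) S2 \<le> pd (int v - int e)"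
      using vdim_le by blast+
    \<comment> \<open>By 1 to 4, \<open>N1\<close> and \<open>N2\<close>, the two Hilbert functions
      gain at most 1 in total between the lowered and the full degree. By \<open>H1\<close> and
      \<open>H2\<close> each therefore counts all points of its part of \<open>S\<close>. Then 1 to
      4 give pd d <= pd u + pd v, against \<open>N1\<close> and \<open>N3\<close>.\<close>
    show False
      using 1 2 3 4 H1 H2 M1 N1 N2 N3 V cS12 cC12 cC xs(2) by linarith
  qed
  ultimately show ?thesis using cSC by (auto simp: good_def C_def)
qed

lemma card_greedy_lists:
  assumes "P []" and pre: "\<And>xs x. P (xs @ [x]) \<Longrightarrow> P xs"
    and m: "\<And>xs. P xs \<Longrightarrow> length xs < k \<Longrightarrow> finite {x. P (xs @ [x])} \<and> m \<le> card {x. P (xs @ [x])}"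
  shows "finite {xs. length xs = k \<and> P xs} \<and> m ^ k \<le> card {xs. length xs = k \<and> P xs}"
  using m
proof (induction k)
  case 0
  have "{xs. length xs = 0 \<and> P xs} = {[]}" using assms(1) by auto
  then show ?case by simp
next
  case (Suc k)
  let ?L = "\<lambda>k. {xs. length xs = k \<and> P xs}"
  have IH: "finite (?L k)" "m ^ k \<le> card (?L k)" using Suc by auto
  let ?S = "Sigma (?L k) (\<lambda>xs. {x. P (xs @ [x])})"
  have eq: "?L (Suc k) = (\<lambda>(xs, x). xs @ [x]) ` ?S"
  proof (intro equalityI subsetI)
    fix ys assume ys: "ys \<in> ?L (Suc k)"
    then have "ys \<noteq> []" by auto
    then obtain xs x where "ys = xs @ [x]" by (metis append_butlast_last_id)
    then show "ys \<in> (\<lambda>(xs, x). xs @ [x]) ` ?S" using ys pre[of xs x] by auto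
  qed auto
  have inj: "inj_on (\<lambda>(xs, x). xs @ [x]) ?S" by (auto simp: inj_on_def)
  have fin: "finite ?S" using IH(1) Suc.prems by (intro finite_SigmaI) auto
  have "m ^ k * m \<le> card (?L k) * m" using IH(2) by (rule mult_right_mono) simp
  also have "\<dots> = (\<Sum>xs\<in>?L k. m)" by simp
  also have "\<dots> \<le> (\<Sum>xs\<in>?L k. card {x. P (xs @ [x])})" using Suc.prems by (intro sum_mono) auto
  also have "\<dots> = card ?S" using IH(1) Suc.prems by (subst card_SigmaI) auto
  also have "\<dots> = card (?L (Suc k))" unfolding eq by (rule card_image[OF inj, symmetric])
  finally show ?case using fin eq by (simp add: mult.commute)
qed

text \<open>A non-generic point lies in \<open>S\<close> or is a zero of a polynomial not divisible
  by \<open>\<rho>\<close>; one such polynomial for each pair of a degree and a subset of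
  \<open>S\<close> suffices, which explains the factor
  \<open>(d + 1) * 2 ^ pd (int d)\<close>.\<close>

lemma card_not_generic_le:
  assumes S: "finite S" "card S \<le> pd (int d)" and X: "finite X" and \<pi>: "\<And>x. x \<in> X \<Longrightarrow> \<pi> x = \<rho>"
    and \<theta>: "\<And>f. f \<in> Pol (int d) \<Longrightarrow> \<not> \<rho> dvd f \<Longrightarrow> card {x \<in> X. ev f x = 0} \<le> \<theta>"
  shows "card {x \<in> X. \<not> generic d \<pi> S x} \<le> pd (int d) + (d + 1) * 2 ^ pd (int d) * \<theta>"
proof -
  let ?I = "{(t, T). t \<le> d \<and> T \<subseteq> S \<and> (\<exists>f\<in>Van (int t) T. \<not> \<rho> dvd f)}"
  let ?Z = "\<lambda>(t, T). {x \<in> X. \<forall>f\<in>Van (int t) T. ev f x = 0}"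
  have sub: "?I \<subseteq> {..d} \<times> Pow S" by auto
  have fI: "finite ?I" using S(1) by (intro finite_subset[OF sub]) auto
  have "card ?I \<le> card ({..d} \<times> Pow S)" using S(1) by (intro card_mono[OF _ sub]) auto
  also have "\<dots> = (d + 1) * 2 ^ card S" using S(1) by (simp add: card_cartesian_product card_Pow)
  also have "\<dots> \<le> (d + 1) * 2 ^ pd (int d)" using S(2) by (intro mult_left_mono power_increasing) auto
  finally have cI: "card ?I \<le> (d + 1) * 2 ^ pd (int d)" .
  have "{x \<in> X. \<not> generic d \<pi> S x} \<subseteq> S \<union> (\<Union>i\<in>?I. ?Z i)"
  proof
    fix x assume x: "x \<in> {x \<in> X. \<not> generic d \<pi> S x}"
    show "x \<in> S \<union> (\<Union>i\<in>?I. ?Z i)"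
    proof (cases "x \<in> S")
      case False
      then obtain t T where t: "t \<le> d" "T \<subseteq> S" "\<exists>f\<in>Van (int t) T. \<not> \<pi> x dvd f" "\<forall>f\<in>Van (int t) T. ev f x = 0"
        using x by (auto simp: generic_def)
      then have "(t, T) \<in> ?I" "x \<in> ?Z (t, T)" using x \<pi>[of x] by auto
      then show ?thesis by blast
    qed simp
  qed
  then have "card {x \<in> X. \<not> generic d \<pi> S x} \<le> card (S \<union> (\<Union>i\<in>?I. ?Z i))"
    using S(1) fI X by (intro card_mono) auto
  also have "\<dots> \<le> card S + card (\<Union>i\<in>?I. ?Z i)" by (rule card_Un_le)
  also have "card (\<Union>i\<in>?I. ?Z i) \<le> (\<Sum>i\<in>?I. card (?Z i))" by (rule card_UN_le[OF fI])
  also have "\<dots> \<le> (\<Sum>i\<in>?I. \<theta>)"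
  proof (intro sum_mono, clarify)
    fix t T f assume "t \<le> d" "f \<in> Van (int t) T" "\<not> \<rho> dvd f"
    then have "f \<in> Pol (int d)" using Pol_mono[of "int t" "int d"] by (auto simp: Van_def)
    have "card {x \<in> X. \<forall>f\<in>Van (int t) T. ev f x = 0} \<le> card {x \<in> X. ev f x = 0}"
      using X \<open>f \<in> Van (int t) T\<close> by (intro card_mono) auto
    also have "\<dots> \<le> \<theta>" using \<theta> \<open>f \<in> Pol (int d)\<close> \<open>\<not> \<rho> dvd f\<close> by blast
    finally show "card {x \<in> X. \<forall>f\<in>Van (int t) T. ev f x = 0} \<le> \<theta>" .
  qed
  also have "\<dots> \<le> (d + 1) * 2 ^ pd (int d) * \<theta>" using cI by (simp add: mult_right_mono)
  finally show ?thesis using S(2) by simp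
qed

text \<open>The sets \<open>Xs i\<close> may depend on the position, because two lines have to share
  the generic points evenly. At every step \<open>M\<close> minus the number of non-generic points
  bounds the choices from below.\<close>

lemma good_sets_count:
  assumes d: "3 \<le> d" and fin: "finite A" and \<eta>: "\<eta> \<noteq> 0" "e = tdeg \<eta>" "2 \<le> e"
    and S: "S \<subseteq> A" "\<And>s. s \<in> S \<Longrightarrow> ev \<eta> s \<noteq> 0" "indep (int d - int e) S" "Van (int d - int e) S = {0}"
    and k: "k + pd (int d - int e) + 3 = pd (int d)"
    and Xs: "\<And>i. i < k \<Longrightarrow> Xs i \<subseteq> A" "\<And>i. i < k \<Longrightarrow> M \<le> card (Xs i)"
    and \<rho>: "\<And>i x. i < k \<Longrightarrow> x \<in> Xs i \<Longrightarrow> \<pi> x = \<rho> i"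
    and on: "\<And>i x. i < k \<Longrightarrow> x \<in> Xs i \<Longrightarrow> ev \<eta> x = 0 \<or> d < e"
    and \<theta>: "\<And>i f. i < k \<Longrightarrow> f \<in> Pol (int d) \<Longrightarrow> \<not> \<rho> i dvd f \<Longrightarrow> card {x \<in> Xs i. ev f x = 0} \<le> \<theta>"
    and \<pi>: "\<And>xs x f g. length xs = k \<Longrightarrow> generic_list d \<pi> S xs \<Longrightarrow> (\<And>i. i < k \<Longrightarrow> xs ! i \<in> Xs i) \<Longrightarrow>
      x \<in> set xs \<Longrightarrow> \<pi> x * f \<in> Van (int d) (S \<union> set xs) \<Longrightarrow> \<pi> x * g \<in> Van (int d) (S \<union> set xs) \<Longrightarrow> \<not> lin_indep2 f g"
  shows "(M - (pd (int d) + (d + 1) * 2 ^ pd (int d) * \<theta>)) ^ k \<le> card {B. B \<subseteq> A \<and> good d B} * k ^ k"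
proof -
  let ?K = "pd (int d) + (d + 1) * 2 ^ pd (int d) * \<theta>"
  let ?G = "{B. B \<subseteq> A \<and> good d B}"
  define P where "P xs \<longleftrightarrow> length xs \<le> k \<and> generic_list d \<pi> S xs \<and> (\<forall>i<length xs. xs ! i \<in> Xs i)" for xs
  have finS: "finite S" using S(3) by (simp add: indep_def)
  have cS: "card S = pd (int d - int e)" using indep_spanning_card S by blast
  have Psnoc: "P (xs @ [x]) \<longleftrightarrow> P xs \<and> length xs < k \<and> generic d \<pi> (S \<union> set xs) x \<and> x \<in> Xs (length xs)" for xs x
    by (auto simp: P_def generic_list_snoc nth_append less_Suc_eq)
  have cnt: "finite {xs. length xs = k \<and> P xs} \<and> (M - ?K) ^ k \<le> card {xs. length xs = k \<and> P xs}"
  proof (rule card_greedy_lists)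
    show "P []" by (simp add: P_def)
    show "P xs" if "P (xs @ [x])" for xs x using that Psnoc by blast
    fix xs assume xs: "P xs" "length xs < k"
    let ?X = "Xs (length xs)"
    have fX: "finite ?X" using Xs(1) xs(2) fin finite_subset by blast
    have "card (S \<union> set xs) \<le> card S + length xs"
      using card_Un_le[of S "set xs"] card_length[of xs] by linarith
    then have c: "card (S \<union> set xs) \<le> pd (int d)" using cS k xs(2) by linarith
    have bad: "card {x \<in> ?X. \<not> generic d \<pi> (S \<union> set xs) x} \<le> ?K"
      using finS \<rho>[OF xs(2)] \<theta>[OF xs(2)] by (intro card_not_generic_le[OF _ c fX, of \<pi> "\<rho> (length xs)"]) auto
    have "card {x \<in> ?X. \<not> generic d \<pi> (S \<union> set xs) x} + card {x \<in> ?X. generic d \<pi> (S \<union> set xs) x} = card ?X"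
    proof -
      have "?X - {x \<in> ?X. \<not> generic d \<pi> (S \<union> set xs) x} = {x \<in> ?X. generic d \<pi> (S \<union> set xs) x}" by blast
      then show ?thesis using card_split[OF fX, of "{x \<in> ?X. \<not> generic d \<pi> (S \<union> set xs) x}"] by simp
    qed
    then have "M - ?K \<le> card {x \<in> ?X. generic d \<pi> (S \<union> set xs) x}" using bad Xs(2)[OF xs(2)] by linarith
    moreover have "{x. P (xs @ [x])} = {x \<in> ?X. generic d \<pi> (S \<union> set xs) x}" using Psnoc xs by auto
    ultimately show "finite {x. P (xs @ [x])} \<and> M - ?K \<le> card {x. P (xs @ [x])}" using fX by simp
  qed
  have fG: "finite ?G" using fin by simp
  have "card {xs. length xs = k \<and> P xs} \<le> card ((\<lambda>B. B - S) ` ?G) * k ^ k"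
  proof (rule card_lists_with_set)
    show "finite ((\<lambda>B. B - S) ` ?G)" using fG by simp
    fix xs assume "xs \<in> {xs. length xs = k \<and> P xs}"
    then have xs: "length xs = k" "generic_list d \<pi> S xs" "\<And>i. i < k \<Longrightarrow> xs ! i \<in> Xs i" by (auto simp: P_def)
    have "good d (S \<union> set xs)"
    proof (rule good_of_generic[OF d \<eta> S(2-4) xs(2)])
      show "length xs + pd (int d - int e) + 3 = pd (int d)" using xs(1) k by simp
      show "ev \<eta> x = 0 \<or> d < e" if "x \<in> set xs" for x
        using that xs on by (metis in_set_conv_nth)
      show "\<not> lin_indep2 f g" if "x \<in> set xs" "\<pi> x * f \<in> Van (int d) (S \<union> set xs)" "\<pi> x * g \<in> Van (int d) (S \<union> set xs)" for x f g
        using \<pi>[OF xs] that by blast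
    qed
    moreover have "S \<union> set xs \<subseteq> A"
    proof -
      have "x \<in> A" if "x \<in> set xs" for x
        using that xs(1) xs(3) Xs(1) by (metis in_set_conv_nth subsetD)
      then show ?thesis using S(1) by blast
    qed
    moreover have "S \<union> set xs - S = set xs" using generic_list_distinct[OF xs(2)] by auto
    ultimately have "set xs \<in> (\<lambda>B. B - S) ` ?G" by (metis (mono_tags, lifting) image_eqI mem_Collect_eq)
    then show "length xs = k \<and> set xs \<in> (\<lambda>B. B - S) ` ?G \<and> card (set xs) \<le> k"
      using xs(1) card_length[of xs] by simp
  qed
  also have "\<dots> \<le> card ?G * k ^ k" using fG by (intro mult_right_mono card_image_le) auto
  finally show ?thesis using cnt by linarith
qed

lemma ev_unit: "is_unit f \<Longrightarrow> ev f x \<noteq> 0"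
proof -
  assume "is_unit f"
  then obtain g where "1 = f * g" by blast
  then have "ev f x * ev g x = 1" by (metis ev_simps(3,6))
  then show ?thesis by auto
qed

lemma zeros_le_of_primes:
  assumes R: "finite R" and b: "\<And>\<eta>. prime_elem \<eta> \<Longrightarrow> tdeg \<eta> \<le> d \<Longrightarrow> card {x \<in> R. ev \<eta> x = 0} \<le> b"
  shows "f \<noteq> 0 \<Longrightarrow> tdeg f \<le> d \<Longrightarrow> card {x \<in> R. ev f x = 0} \<le> tdeg f * b"
proof (induction "tdeg f" arbitrary: f rule: less_induct)
  case less
  show ?case
  proof (cases "is_unit f")
    case True
    then have "{x \<in> R. ev f x = 0} = {}" using ev_unit by auto
    then show ?thesis by (simp only: card.empty le0)
  next
    case nu: False
    show ?thesis
    proof (cases "irreducible f")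
      case True
      then have "prime_elem f" by (simp add: prime_elem_iff_irreducible)
      then have "card {x \<in> R. ev f x = 0} \<le> 1 * b" using b less.prems by simp
      also have "\<dots> \<le> tdeg f * b" using tdeg_pos[OF less.prems(1) nu] by (intro mult_right_mono) auto
      finally show ?thesis .
    next
      case False
      then obtain g h where gh: "f = g * h" "\<not> is_unit g" "\<not> is_unit h"
        using nu less.prems(1) unfolding irreducible_def by blast
      have nz: "g \<noteq> 0" "h \<noteq> 0" using gh less.prems by auto
      have t: "tdeg f = tdeg g + tdeg h" using gh nz tdeg_mult by simp
      have "1 \<le> tdeg g" "1 \<le> tdeg h" using tdeg_pos nz gh by auto
      then have "card {x \<in> R. ev g x = 0} \<le> tdeg g * b" "card {x \<in> R. ev h x = 0} \<le> tdeg h * b"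
        using less.hyps nz t less.prems by auto
      moreover have "{x \<in> R. ev f x = 0} = {x \<in> R. ev g x = 0} \<union> {x \<in> R. ev h x = 0}" using gh by auto
      ultimately show ?thesis
        using card_Un_le[of "{x \<in> R. ev g x = 0}" "{x \<in> R. ev h x = 0}"] t by (simp add: distrib_right)
    qed
  qed
qed

text \<open>The number \<open>k\<close> of free points varies with the case; bounding it by
  \<open>D\<close> gives one constant for all cases, and surplus powers of \<open>n\<close> are
  discarded.\<close>

lemma pow_transfer:
  assumes "n \<le> c * m" "m ^ k \<le> G * k ^ k" "1 \<le> n" "j \<le> k" "k \<le> D" "1 \<le> c * D"
  shows "n ^ j \<le> (c * D) ^ D * (G :: nat)"
proof -
  have "n ^ j \<le> n ^ k" using assms by (intro power_increasing) auto
  also have "\<dots> \<le> (c * m) ^ k" using assms by (intro power_mono) auto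
  also have "\<dots> = c ^ k * m ^ k" by (simp add: power_mult_distrib)
  also have "\<dots> \<le> c ^ k * (G * k ^ k)" using assms by (intro mult_left_mono) auto
  also have "\<dots> = (c * k) ^ k * G" by (simp add: power_mult_distrib)
  also have "\<dots> \<le> (c * D) ^ k * G" using assms by (intro mult_right_mono power_mono mult_left_mono) auto
  also have "\<dots> \<le> (c * D) ^ D * G" using assms by (intro mult_right_mono power_increasing) auto
  finally show ?thesis .
qed

text \<open>The extreme case is e = 2, where pd d - pd (d - 2) = 2 d + 1.\<close>

lemma pd_diff_ge: "2 \<le> e \<Longrightarrow> 2 * d - 2 + pd (int d - int e) + 3 \<le> pd (int d)" if "3 \<le> d"
proof -
  assume e: "2 \<le> e"
  have "pd (int d) = pd (int d - 2) + d + (d + 1)"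
    using pd_Suc[of "int d - 1"] pd_Suc[of "int d - 2"] that by (simp add: nat_add_distrib)
  moreover have "pd (int d - int e) \<le> pd (int d - 2)" using e by (intro pd_mono) auto
  ultimately show ?thesis using that by linarith
qed

section \<open>Rich irreducible curves, rich pairs of lines, and the remaining case\<close>

definition heavy :: "nat \<Rightarrow> (real \<times> real) set \<Rightarrow> bipoly \<Rightarrow> bool" where
  "heavy E A \<eta> \<longleftrightarrow> card A \<le> E * card {x \<in> A. ev \<eta> x = 0}"

text \<open>The irreducible curve \<open>\<eta>\<close> is both the carrier of all free points and
  their component; the basis \<open>S\<close> off it rules out net curves containing it.\<close>

lemma many_good_prime:
  assumes d: "3 \<le> d" and fin: "finite A" and A: "Van (int d) A = {0}"
    and \<eta>: "prime_elem \<eta>" "2 \<le> tdeg \<eta>" "tdeg \<eta> \<le> d" "heavy E A \<eta>"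
    and n: "2 * E * (pd (int d) + (d + 1) * 2 ^ pd (int d) * d ^ 2) \<le> card A" "1 \<le> card A"
  shows "card A ^ (d - 1) \<le> (2 * E * pd (int d)) ^ pd (int d) * card {B. B \<subseteq> A \<and> good d B}"
proof -
  define X where "X = {x \<in> A. ev \<eta> x = 0}"
  let ?K = "pd (int d) + (d + 1) * 2 ^ pd (int d) * d ^ 2"
  define k where "k = pd (int d) - pd (int d - int (tdeg \<eta>)) - 3"
  have k: "k + pd (int d - int (tdeg \<eta>)) + 3 = pd (int d)" "2 * d - 2 \<le> k"
    using pd_diff_ge[OF d \<eta>(2)] by (auto simp: k_def)
  have \<eta>0: "\<eta> \<noteq> 0" using \<eta>(1) by auto
  obtain S where S: "S \<subseteq> {a \<in> A. ev \<eta> a \<noteq> 0}" "indep (int d - int (tdeg \<eta>)) S" "Van (int d - int (tdeg \<eta>)) S = {0}"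
    by (rule ex_basis_avoid[OF A \<eta>0 fin indep_empty empty_subsetI])
  have "(card X - ?K) ^ k \<le> card {B. B \<subseteq> A \<and> good d B} * k ^ k"
  proof (rule good_sets_count[OF d fin \<eta>0 refl \<eta>(2) _ _ S(2,3) k(1), of "\<lambda>_. X" _ "\<lambda>_. \<eta>" "\<lambda>_. \<eta>"])
    show "card {x \<in> X. ev f x = 0} \<le> d ^ 2" if "f \<in> Pol (int d)" "\<not> \<eta> dvd f" for f
    proof -
      have "card {x \<in> X. ev f x = 0} \<le> d * tdeg \<eta>"
        using that fin by (intro prime_zeros_le[OF \<eta>(1)]) (auto simp: X_def)
      also have "\<dots> \<le> d ^ 2" using \<eta>(3) by (simp add: power2_eq_square)
      finally show ?thesis .
    qed
    show "\<not> lin_indep2 f g" if "\<eta> * f \<in> Van (int d) (S \<union> set xs)" for f g and xs :: "(real \<times> real) list"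
    proof -
      have "\<eta> * f \<in> Van (int d) S" using that by (auto simp: Van_def)
      then have "f = 0" using Van_basis_dvd[of S \<eta> "int d" f] S \<eta>0 by auto
      then show ?thesis using lin_indep2_nonzero(1) by blast
    qed
  qed (use S in \<open>auto simp: X_def\<close>)
  moreover have "card A \<le> 2 * E * (card X - ?K)"
  proof -
    have "card A \<le> E * card X" using \<eta>(4) by (simp add: heavy_def X_def)
    then have "2 * card A \<le> 2 * E * card X" by simp
    then show ?thesis using n(1) by (simp add: diff_mult_distrib2)
  qed
  moreover have "1 \<le> 2 * E * pd (int d)"
  proof -
    have "E \<noteq> 0"
    proof
      assume "E = 0"
      then show False using \<eta>(4) n(2) by (simp add: heavy_def)
    qed
    moreover have "1 \<le> pd (int d)" using k by simp
    ultimately show ?thesis by (simp add: Suc_le_eq)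
  qed
  ultimately show ?thesis using k n(2) by (intro pow_transfer[where k = k and m = "card X - ?K"]) auto
qed

text \<open>The carrier is the reducible conic \<open>l1 * l2\<close>, with d - 1 free points on
  each line. If net curves contained \<open>l1\<close>, their quotients would pass through
  \<open>S\<close> and the d - 1 points on \<open>l2\<close>, which leaves at most one curve of
  degree d - 1 up to scaling; likewise with the lines exchanged.\<close>

lemma many_good_lines:
  assumes d: "3 \<le> d" and fin: "finite A" and A: "Van (int d) A = {0}"
    and l1: "l1 \<noteq> 0" "tdeg l1 = 1" "heavy E A l1" and l2: "l2 \<noteq> 0" "tdeg l2 = 1" "heavy E A l2"
    and ne: "\<not> l1 dvd l2" "\<not> l2 dvd l1"
    and n: "2 * E * (pd (int d) + (d + 1) * 2 ^ pd (int d) * d + 1) \<le> card A" "1 \<le> card A"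
  shows "card A ^ (d - 1) \<le> (2 * E * pd (int d)) ^ pd (int d) * card {B. B \<subseteq> A \<and> good d B}"
proof -
  let ?K = "pd (int d) + (d + 1) * 2 ^ pd (int d) * d"
  define X1 where "X1 = {x \<in> A. ev l1 x = 0 \<and> ev l2 x \<noteq> 0}"
  define X2 where "X2 = {x \<in> A. ev l2 x = 0 \<and> ev l1 x \<noteq> 0}"
  define \<eta> where "\<eta> = l1 * l2"
  have \<eta>: "\<eta> \<noteq> 0" "2 = tdeg \<eta>" "(2::nat) \<le> 2" using l1 l2 by (auto simp: \<eta>_def tdeg_mult)
  define k where "k = 2 * d - 2"
  define \<pi> where "\<pi> x = (if ev l1 x = 0 then l1 else l2)" for x
  define Xs where "Xs i = (if i < d - 1 then X1 else X2)" for i :: nat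
  have k: "k + pd (int d - int 2) + 3 = pd (int d)"
    using pd_Suc[of "int d - 1"] pd_Suc[of "int d - 2"] d by (simp add: k_def nat_add_distrib)
  obtain S where S: "S \<subseteq> {a \<in> A. ev \<eta> a \<noteq> 0}" "indep (int d - int 2) S" "Van (int d - int 2) S = {0}"
    "card S = pd (int d - int 2)"
    unfolding \<eta>(2) by (rule ex_basis_avoid[OF A \<eta>(1) fin indep_empty empty_subsetI])
  have S12: "ev l1 s \<noteq> 0" "ev l2 s \<noteq> 0" if "s \<in> S" for s using S(1) that by (auto simp: \<eta>_def)
  have inter: "card {x \<in> A. ev l1 x = 0 \<and> ev l2 x = 0} \<le> 1"
  proof -
    have "coprime l1 l2" using ne(1) prime_elem_tdeg1[OF l1(2,1)] by (simp add: prime_elem_imp_coprime)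
    then have "card {x \<in> A. ev l1 x = 0 \<and> ev l2 x = 0} \<le> tdeg l1 * tdeg l2"
      using fin l1(1) l2(1) by (intro bezout) auto
    then show ?thesis using l1 l2 by simp
  qed
  have cX: "card {x \<in> A. ev l1 x = 0} \<le> card X1 + 1" "card {x \<in> A. ev l2 x = 0} \<le> card X2 + 1"
  proof -
    have "{x \<in> A. ev l1 x = 0} = X1 \<union> {x \<in> A. ev l1 x = 0 \<and> ev l2 x = 0}"
      "{x \<in> A. ev l2 x = 0} = X2 \<union> {x \<in> A. ev l1 x = 0 \<and> ev l2 x = 0}" by (auto simp: X1_def X2_def)
    then show "card {x \<in> A. ev l1 x = 0} \<le> card X1 + 1" "card {x \<in> A. ev l2 x = 0} \<le> card X2 + 1"
      using inter card_Un_le[of X1 "{x \<in> A. ev l1 x = 0 \<and> ev l2 x = 0}"]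
        card_Un_le[of X2 "{x \<in> A. ev l1 x = 0 \<and> ev l2 x = 0}"] by simp_all
  qed
  define M where "M = min (card X1) (card X2)"
  have M: "card A \<le> E * (M + 1)"
  proof -
    have "card A \<le> E * (card X1 + 1)" "card A \<le> E * (card X2 + 1)"
      using l1(3) l2(3) cX unfolding heavy_def by (meson le_trans mult_le_mono2)+
    then show ?thesis by (simp add: M_def min_def)
  qed
  \<comment> \<open>\<open>d - 1\<close> generic points on one of the lines cut the \<open>d\<close>-dimensional space \<open>Van (d - 1) S\<close>
    down to dimension one.\<close>
  have line_part: "vdim (int (d - 1)) (S \<union> T) \<le> 1"
    if xs: "generic_list d \<pi> S xs" and T: "T \<subseteq> set xs" "card T = d - 1" and l: "l \<noteq> 0" "tdeg l = 1"
      "\<And>s. s \<in> S \<Longrightarrow> ev l s \<noteq> 0" "\<And>x. x \<in> T \<Longrightarrow> \<pi> x = l" for xs T l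
  proof (rule ccontr)
    assume gt: "\<not> ?thesis"
    then obtain f where f: "f \<in> Van (int (d - 1)) (S \<union> T)" "f \<noteq> 0"
      using vdim_pos[of "int (d - 1)" "S \<union> T"] by auto
    have "\<not> l dvd f"
    proof
      assume "l dvd f"
      then obtain g where g: "f = l * g" by blast
      have "l * g \<in> Van (int (d - 1)) S" using f g by (auto simp: Van_def)
      moreover have "int (d - 1) - int (tdeg l) = int d - int 2" using d l by simp
      ultimately have "g = 0" using Van_basis_dvd[of S l "int (d - 1)" g] S(3) l by simp
      then show False using f g by simp
    qed
    then have "vdim (int (d - 1)) (S \<union> T) + card T = vdim (int (d - 1)) S"
      using f(1) l(4) T(1) by (intro generic_vdim[OF xs]) auto
    moreover have "vdim (int (d - 1)) S + card S = pd (int (d - 1))"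
      using d by (intro indep_vdim indep_mono[OF S(2)]) auto
    moreover have "pd (int (d - 1)) = pd (int d - int 2) + d"
      using pd_Suc[of "int d - 2"] d by (simp add: nat_add_distrib of_nat_diff)
    ultimately have "vdim (int (d - 1)) (S \<union> T) = 1" using S(4) T(2) d by simp
    then show False using gt by simp
  qed
  have "(M - ?K) ^ k \<le> card {B. B \<subseteq> A \<and> good d B} * k ^ k"
  proof (rule good_sets_count[OF d fin \<eta> _ _ S(2,3) k, of Xs _ \<pi> "\<lambda>i. if i < d - 1 then l1 else l2"])
    show "card {x \<in> Xs i. ev f x = 0} \<le> d"
      if "f \<in> Pol (int d)" "\<not> (if i < d - 1 then l1 else l2) dvd f" for f i
    proof -
      have "card {x \<in> Xs i. ev f x = 0} \<le> d * tdeg (if i < d - 1 then l1 else l2)"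
        using that fin l1 l2 by (intro prime_zeros_le prime_elem_tdeg1) (auto simp: X1_def X2_def Xs_def)
      then show ?thesis using l1 l2 by (simp split: if_splits)
    qed
    fix xs x f g
    assume xs: "length xs = k" "generic_list d \<pi> S xs" "\<And>i. i < k \<Longrightarrow> xs ! i \<in> Xs i" and x: "x \<in> set xs"
      and f: "\<pi> x * f \<in> Van (int d) (S \<union> set xs)" and g: "\<pi> x * g \<in> Van (int d) (S \<union> set xs)"
    define T1 where "T1 = set (take (d - 1) xs)"
    define T2 where "T2 = set (drop (d - 1) xs)"
    have dist: "distinct xs" using generic_list_distinct[OF xs(2)] by simp
    have T12: "set xs = T1 \<union> T2" unfolding T1_def T2_def by (metis append_take_drop_id set_append)
    have c: "card T1 = d - 1" "card T2 = d - 1"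
      using dist xs(1) d by (auto simp: T1_def T2_def k_def distinct_card)
    have T1: "T1 \<subseteq> X1"
    proof
      fix y assume "y \<in> T1"
      then obtain i where "i < d - 1" "y = xs ! i" using xs(1) by (auto simp: T1_def in_set_conv_nth k_def)
      then show "y \<in> X1" using xs(3)[of i] by (simp add: Xs_def k_def)
    qed
    have T2: "T2 \<subseteq> X2"
    proof
      fix y assume "y \<in> T2"
      then obtain i where "i < k - (d - 1)" "y = xs ! (d - 1 + i)" using xs(1) by (auto simp: T2_def in_set_conv_nth)
      then show "y \<in> X2" using xs(3)[of "d - 1 + i"] by (simp add: Xs_def)
    qed
    have part: "f \<in> Van (int (d - 1)) (S \<union> T)"
      if "l * f \<in> Van (int d) (S \<union> set xs)" "l \<noteq> 0" "tdeg l = 1" "\<And>s. s \<in> S \<union> T \<Longrightarrow> ev l s \<noteq> 0" "T \<subseteq> set xs" for l f T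
      using that Pol_div[of l f "int d"] d by (auto simp: Van_def of_nat_diff)
    show "\<not> lin_indep2 f g"
    proof (cases "x \<in> X1")
      case True
      then have \<pi>x: "\<pi> x = l1" by (simp add: \<pi>_def X1_def)
      have "k \<in> Van (int (d - 1)) (S \<union> T2)" if "l1 * k \<in> Van (int d) (S \<union> set xs)" for k
        using l1 S12 T2 T12 by (intro part[OF that]) (auto simp: X2_def)
      then have "f \<in> Van (int (d - 1)) (S \<union> T2)" "g \<in> Van (int (d - 1)) (S \<union> T2)"
        using f g unfolding \<pi>x by blast+
      moreover have "vdim (int (d - 1)) (S \<union> T2) \<le> 1"
        using l2 S12 T2 T12 c by (intro line_part[OF xs(2), of T2 l2]) (auto simp: X2_def \<pi>_def)
      ultimately show ?thesis using lin_indep2_vdim by fastforce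
    next
      case False
      then have "x \<in> X2" using x T1 T2 T12 by auto
      then have \<pi>x: "\<pi> x = l2" by (simp add: \<pi>_def X2_def)
      have "k \<in> Van (int (d - 1)) (S \<union> T1)" if "l2 * k \<in> Van (int d) (S \<union> set xs)" for k
        using l2 S12 T1 T12 by (intro part[OF that]) (auto simp: X1_def)
      then have "f \<in> Van (int (d - 1)) (S \<union> T1)" "g \<in> Van (int (d - 1)) (S \<union> T1)"
        using f g unfolding \<pi>x by blast+
      moreover have "vdim (int (d - 1)) (S \<union> T1) \<le> 1"
        using l1 S12 T1 T12 c by (intro line_part[OF xs(2), of T1 l1]) (auto simp: X1_def \<pi>_def)
      ultimately show ?thesis using lin_indep2_vdim by fastforce
    qed
  qed (use S in \<open>auto simp: Xs_def X1_def X2_def M_def \<pi>_def \<eta>_def split: if_splits\<close>)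
  moreover have "card A \<le> 2 * E * (M - ?K)"
  proof -
    have "2 * card A \<le> 2 * E * M + 2 * E" using M by simp
    then show ?thesis using n(1) by (simp add: diff_mult_distrib2 algebra_simps)
  qed
  moreover have "1 \<le> 2 * E * pd (int d)"
  proof -
    have "E \<noteq> 0"
    proof
      assume "E = 0"
      then show False using M n(2) by simp
    qed
    moreover have "1 \<le> pd (int d)" using k by simp
    ultimately show ?thesis by (simp add: Suc_le_eq)
  qed
  moreover have "d - 1 \<le> k" "k \<le> pd (int d)" using k d by (auto simp: k_def)
  ultimately show ?thesis using n(2) by (intro pow_transfer[where k = k and m = "M - ?K"]) auto
qed

text \<open>The dummy carrier \<open>\<eta>\<close> of degree d + 1 divides no nonzero polynomial of
  degree at most \<open>d\<close>. Thus non-divisibility just means being nonzero, and the basis off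
  the carrier is empty.\<close>

lemma many_good_light:
  assumes d: "3 \<le> d" and fin: "finite A" and R: "R \<subseteq> A"
    and b: "\<And>\<eta>. prime_elem \<eta> \<Longrightarrow> tdeg \<eta> \<le> d \<Longrightarrow> card {x \<in> R. ev \<eta> x = 0} \<le> b"
    and n: "card A \<le> c * (card R - (pd (int d) + (d + 1) * 2 ^ pd (int d) * (d * b)))" "1 \<le> card A"
  shows "card A ^ (d - 1) \<le> (c * pd (int d)) ^ pd (int d) * card {B. B \<subseteq> A \<and> good d B}"
proof -
  let ?K = "pd (int d) + (d + 1) * 2 ^ pd (int d) * (d * b)"
  obtain \<eta> where \<eta>: "\<eta> \<noteq> 0" "tdeg \<eta> = d + 1" using ex_tdeg by blast
  have neg: "pd (int d - int (d + 1)) = 0" "Pol (int d - int (d + 1)) = {0}" by (simp_all add: pd_neg Pol_neg)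
  define k where "k = pd (int d) - 3"
  have k: "k + pd (int d - int (d + 1)) + 3 = pd (int d)" "2 * d - 2 \<le> k"
    using pd_diff_ge[OF d, of "d + 1"] d by (auto simp: k_def pd_neg)
  have finR: "finite R" using R fin finite_subset by blast
  have dvd: "f = 0" if "\<eta> * g = f" "f \<in> Pol (int d)" for f g
  proof (rule ccontr)
    assume "f \<noteq> 0"
    then have "g \<noteq> 0" using that by auto
    then have "tdeg f = d + 1 + tdeg g" using that \<eta> tdeg_mult by metis
    then show False using that(2) Pol_iff[OF \<open>f \<noteq> 0\<close>] by simp
  qed
  have "(card R - ?K) ^ k \<le> card {B. B \<subseteq> A \<and> good d B} * k ^ k"
  proof (rule good_sets_count[OF d fin \<eta>(1) \<eta>(2)[symmetric] _ _ _ _ _ k(1), of "{}" "\<lambda>_. R" _ "\<lambda>_. \<eta>" "\<lambda>_. \<eta>"])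
    show "card {x \<in> R. ev f x = 0} \<le> d * b" if f: "f \<in> Pol (int d)" "\<not> \<eta> dvd f" for f
    proof -
      have f0: "f \<noteq> 0" using f(2) by auto
      then have ft: "tdeg f \<le> d" using f(1) Pol_iff by auto
      have "card {x \<in> R. ev f x = 0} \<le> tdeg f * b" by (rule zeros_le_of_primes[OF finR b f0 ft])
      also have "\<dots> \<le> d * b" using ft by (intro mult_right_mono) auto
      finally show ?thesis .
    qed
    show "\<not> lin_indep2 f g" if "\<eta> * f \<in> Van (int d) ({} \<union> set xs)" for f g and xs :: "(real \<times> real) list"
    proof -
      have "\<eta> * f = 0" using dvd[OF refl] that by (simp add: Van_def)
      then have "f = 0" using \<eta>(1) by simp
      then show ?thesis using lin_indep2_nonzero(1) by blast
    qed
  qed (use d R in \<open>auto simp: pd_neg Pol_neg\<close>)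
  moreover have "1 \<le> c * pd (int d)"
  proof -
    have "c \<noteq> 0"
    proof
      assume "c = 0"
      then show False using n by simp
    qed
    moreover have "1 \<le> pd (int d)" using k by simp
    ultimately show ?thesis by (simp add: Suc_le_eq)
  qed
  ultimately show ?thesis using k n by (intro pow_transfer[where k = k and m = "card R - ?K"]) auto
qed

section \<open>Conics\<close>

lemma pd_small: "pd 0 = 1" "pd 1 = 3" "pd 2 = 6"
  by (simp_all add: pd_def)

lemma line_unique:
  assumes "a \<noteq> b" "f \<in> Van 1 {a, b}" "f \<noteq> 0" "g \<in> Van 1 {a, b}"
  shows "\<exists>r. g = cmul r f"
proof (rule vdim_1_unique[OF _ assms(2-4)])
  have "indep 1 {a, b}" using indep_card_minus1[of "{a, b}"] assms(1) by simp
  from indep_vdim[OF this] show "vdim 1 {a, b} = 1" using assms(1) pd_small by simp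
qed

lemma tdeg_line: "f \<in> Pol 1 \<Longrightarrow> f \<noteq> 0 \<Longrightarrow> ev f a = 0 \<Longrightarrow> tdeg f = 1"
  using Pol_iff[of f 1] tdeg_pos[of f] ev_unit[of f a] by fastforce

lemma line_through:
  assumes "a \<noteq> b"
  obtains l where "l \<noteq> 0" "tdeg l = 1" "l \<in> Van 1 {a, b}"
proof -
  have "indep 1 {a, b}" using indep_card_minus1[of "{a, b}"] assms(1) by simp
  from indep_vdim[OF this] have "vdim 1 {a, b} = 1" using assms(1) pd_small by simp
  then obtain l where "l \<in> Van 1 {a, b}" "l \<noteq> 0" using vdim_pos[of 1 "{a, b}"] by auto
  then show thesis using that tdeg_line[of l a] by (auto simp: Van_def)
qed

lemma lines_meet:
  assumes "f \<in> Pol 1" "g \<in> Pol 1" "f \<noteq> 0" "ev f b \<noteq> 0" "ev g b = 0" "x \<noteq> y"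
    and "ev f x = 0" "ev f y = 0" "ev g x = 0" "ev g y = 0"
  shows "g = 0"
proof -
  obtain r where r: "g = cmul r f" using line_unique[of x y f g] assms by (auto simp: Van_def)
  then have "r = 0" using assms(4,5) by simp
  then show ?thesis using r by simp
qed

text \<open>\<open>Van 1 B = {0}\<close> says that the three points are not collinear.\<close>

definition tri :: "(real \<times> real) set \<Rightarrow> bool" where
  "tri B \<longleftrightarrow> card B = 3 \<and> Van 1 B = {0}"

lemma tri_indep:
  assumes "tri B"
  shows "finite B" "indep 1 B" "indep (int 2) B" "card B + 3 = pd (int 2)"
proof -
  show fB: "finite B" using assms card_ge_0_finite[of B] by (simp add: tri_def)
  obtain S0 where S0: "S0 \<subseteq> B" "indep 1 S0" "Van 1 S0 = Van 1 B"
    using indep_extend[of 1 "{}" B] fB by auto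
  have "card S0 = 3" using indep_spanning_card[OF S0(2)] S0(3) assms pd_small by (simp add: tri_def)
  then have "S0 = B" using S0(1) fB assms by (intro card_subset_eq) (auto simp: tri_def)
  then show "indep 1 B" using S0 by simp
  then show "indep (int 2) B" by (rule indep_mono) simp
  show "card B + 3 = pd (int 2)" using assms pd_small by (simp add: tri_def)
qed

text \<open>The points of \<open>A\<close> on the side of the triangle \<open>B\<close> opposite to \<open>b\<close>.\<close>

definition side :: "(real \<times> real) set \<Rightarrow> (real \<times> real) set \<Rightarrow> real \<times> real \<Rightarrow> (real \<times> real) set" where
  "side A B b = {x \<in> A. Van 1 (insert x (B - {b})) \<noteq> {0}}"

lemma tri_side:
  assumes "tri B" "b \<in> B"
  obtains l b1 b2 where "B = {b, b1, b2}" "b1 \<noteq> b2" "b \<noteq> b1" "b \<noteq> b2" "l \<noteq> 0" "tdeg l = 1" "l \<in> Pol 1"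
    "ev l b1 = 0" "ev l b2 = 0" "ev l b \<noteq> 0" "\<forall>A. side A B b = zs A l"
proof -
  have "finite B" using tri_indep(1) assms(1) by blast
  then have "card (B - {b}) = 2" using assms by (simp add: tri_def)
  then obtain b1 b2 where b12: "B - {b} = {b1, b2}" "b1 \<noteq> b2" by (auto simp: card_2_iff)
  then have B: "B = {b, b1, b2}" "b \<noteq> b1" "b \<noteq> b2" using assms(2) by auto
  obtain l where l: "l \<noteq> 0" "tdeg l = 1" "l \<in> Van 1 {b1, b2}" using line_through[OF b12(2)] .
  have lP: "l \<in> Pol 1" "ev l b1 = 0" "ev l b2 = 0" using l(3) by (auto simp: Van_def)
  have lb: "ev l b \<noteq> 0"
  proof
    assume "ev l b = 0"
    then have "l \<in> Van 1 B" using lP B by (auto simp: Van_def)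
    then show False using assms(1) l(1) by (auto simp: tri_def)
  qed
  have "side A B b = zs A l" for A
  proof (intro equalityI subsetI)
    fix x assume "x \<in> side A B b"
    then obtain f where f: "x \<in> A" "f \<in> Van 1 (insert x {b1, b2})" "f \<noteq> 0"
      using zero_Van[of 1 "insert x (B - {b})"] b12(1) by (auto simp: side_def)
    then obtain r where r: "l = cmul r f" using line_unique[OF b12(2), of f l] l(3) by (auto simp: Van_def)
    then show "x \<in> zs A l" using f by (auto simp: zs_def Van_def)
  next
    fix x assume x: "x \<in> zs A l"
    then have "l \<in> Van 1 (insert x (B - {b}))" using lP b12(1) by (auto simp: zs_def Van_def)
    then show "x \<in> side A B b" using x l(1) by (auto simp: side_def zs_def)
  qed
  then show thesis using that[OF B(1) b12(2) B(2,3) l(1,2) lP lb] by blast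
qed

lemma conic_dvd:
  assumes l: "l \<noteq> 0" "tdeg l = 1" and f: "f \<in> Pol (int 2)" and T: "finite T" "3 \<le> card T" "\<And>x. x \<in> T \<Longrightarrow> ev l x = 0 \<and> ev f x = 0"
  shows "l dvd f"
proof (rule ccontr)
  assume "\<not> l dvd f"
  then have "card {x \<in> T. ev f x = 0} \<le> 2 * tdeg l"
    using T by (intro prime_zeros_le[OF prime_elem_tdeg1[OF l(2,1)] f]) auto
  moreover have "{x \<in> T. ev f x = 0} = T" using T(3) by auto
  ultimately show False using l T by simp
qed

text \<open>A conic through three points of a side contains the side, and the residual line is only
  required to pass through \<open>b\<close>. Lines through \<open>b\<close> have no other common
  point, so the fibre consists of the side and \<open>b\<close>.\<close>

lemma netcl_side:
  assumes B: "tri B" "b \<in> B" "B \<subseteq> A" and a: "a \<in> side A B b" "a \<notin> B"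
  shows "netcl 2 A B a = side A B b \<union> {b}"
    "f \<in> Van (int 2) (insert a B) \<Longrightarrow> \<exists>l k. f = l * k \<and> l \<in> Pol 1 \<and> ev l b \<noteq> 0 \<and> l \<noteq> 0 \<and> side A B b = zs A l \<and> k \<in> Pol 1 \<and> ev k b = 0"
proof -
  obtain l b1 b2 where l: "B = {b, b1, b2}" "b1 \<noteq> b2" "b \<noteq> b1" "b \<noteq> b2" "l \<noteq> 0" "tdeg l = 1" "l \<in> Pol 1"
    "ev l b1 = 0" "ev l b2 = 0" "ev l b \<noteq> 0" "\<forall>A. side A B b = zs A l"
    using tri_side[OF B(1,2)] .
  have la: "ev l a = 0" using a l(11) by (auto simp: zs_def)
  have fac: "\<exists>k. f = l * k \<and> k \<in> Pol 1 \<and> ev k b = 0" if f: "f \<in> Van (int 2) (insert a B)" for f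
  proof -
    have "l dvd f"
      using f l la a by (intro conic_dvd[of l f "{a, b1, b2}"]) (auto simp: Van_def)
    then obtain k where k: "f = l * k" by blast
    then have "k \<in> Pol 1" using Pol_div[OF l(5), of k "int 2"] f l(6) by (simp add: Van_def)
    moreover have "ev k b = 0" using f k l by (auto simp: Van_def)
    ultimately show ?thesis using k by blast
  qed
  then show "\<exists>l k. f = l * k \<and> l \<in> Pol 1 \<and> ev l b \<noteq> 0 \<and> l \<noteq> 0 \<and> side A B b = zs A l \<and> k \<in> Pol 1 \<and> ev k b = 0"
    if "f \<in> Van (int 2) (insert a B)" using that l by blast
  show "netcl 2 A B a = side A B b \<union> {b}"
  proof (intro equalityI subsetI)
    fix x assume x: "x \<in> netcl 2 A B a"
    show "x \<in> side A B b \<union> {b}"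
    proof (rule ccontr)
      assume n: "x \<notin> side A B b \<union> {b}"
      then have lx: "ev l x \<noteq> 0" using x l(11) by (auto simp: zs_def netcl_def)
      obtain k where k: "k \<in> Pol 1" "ev k b = 0" "ev k x \<noteq> 0" using linear_separate[of b x] n by auto
      have "l * k \<in> Van (int 2) (insert a B)" using Pol_mult[OF l(7) k(1)] k l la by (auto simp: Van_def)
      then show False using x k lx by (auto simp: netcl_def)
    qed
  next
    fix x assume "x \<in> side A B b \<union> {b}"
    then have x: "x \<in> A" "ev l x = 0 \<or> x = b" using l(11) B by (auto simp: zs_def)
    have "ev f x = 0" if "f \<in> Van (int 2) (insert a B)" for f
      using fac[OF that] x(2) by auto
    then show "x \<in> netcl 2 A B a" using x(1) by (simp add: netcl_def)
  qed
qed

text \<open>A line shared by two independent conics of the pencil would miss at most one of the four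
  points, hence contain all of \<open>B\<close> or be a side through \<open>a\<close>. So Bezout
  applies and leaves room for just the four points.\<close>

lemma netcl_off_sides:
  assumes fin: "finite A" and B: "tri B" "B \<subseteq> A" and a: "a \<in> A" "a \<notin> B" "\<And>b. b \<in> B \<Longrightarrow> a \<notin> side A B b"
  shows "netcl 2 A B a = insert a B"
proof -
  note tB = tri_indep[OF B(1)]
  obtain g where g: "g \<in> Van (int 2) B" "ev g a \<noteq> 0"
    using indep_step[of "int 2" B a] tB(2) a(2) by auto
  have "coprime f1 f2" if f: "f1 \<in> Van (int 2) (insert a B)" "f2 \<in> Van (int 2) (insert a B)" "lin_indep2 f1 f2" for f1 f2
  proof (rule ccontr)
    assume nc: "\<not> coprime f1 f2"
    obtain h w1 w2 where h: "f1 = h * w1" "f2 = h * w2" "lin_indep2 w1 w2" "1 \<le> tdeg h" "tdeg h < 2"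
      and w: "w1 \<in> Pol (int 2 - int (tdeg h))" "w2 \<in> Pol (int 2 - int (tdeg h))"
    proof (rule not_coprime_factor[OF _ _ f(3) nc])
      show "f1 \<in> Pol (int 2)" "f2 \<in> Pol (int 2)" using f Van_Pol by blast+
    qed (rule that; assumption)
    have t: "tdeg h = 1" using h by simp
    have h0: "h \<noteq> 0" using lin_indep2_nonzero(1)[OF f(3)] h by auto
    have hP: "h \<in> Pol 1" using Pol_iff[OF h0] t by simp
    have wP: "w1 \<in> Pol 1" "w2 \<in> Pol 1" using w t by auto
    have one: "x = y" if xy: "x \<in> insert a B" "y \<in> insert a B" "ev h x \<noteq> 0" "ev h y \<noteq> 0" for x y
    proof (rule ccontr)
      assume "x \<noteq> y"
      have "w1 \<in> Van 1 {x, y}" "w2 \<in> Van 1 {x, y}" using f xy wP h by (auto simp: Van_def)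
      then have "2 \<le> vdim 1 {x, y}" using lin_indep2_vdim h(3) by blast
      moreover have "indep 1 {x, y}" using indep_card_minus1[of "{x, y}"] \<open>x \<noteq> y\<close> by simp
      then have "vdim 1 {x, y} = 1" using indep_vdim[of 1 "{x, y}"] \<open>x \<noteq> y\<close> pd_small by simp
      ultimately show False by simp
    qed
    show False
    proof (cases "\<exists>b\<in>B. ev h b \<noteq> 0")
      case False
      then have "h \<in> Van 1 B" using hP by (auto simp: Van_def)
      then show False using B(1) h0 by (auto simp: tri_def)
    next
      case True
      then obtain b where b: "b \<in> B" "ev h b \<noteq> 0" by blast
      have "ev h x = 0" if "x \<in> insert a (B - {b})" for x
        using one[of x b] that b a(2) by blast
      then have "h \<in> Van 1 (insert a (B - {b}))" using hP by (simp add: Van_def)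
      then show False using a(1,3) b(1) h0 by (auto simp: side_def)
    qed
  qed
  then have "card (netcl 2 A B a) \<le> 2 ^ 2" using g by (intro card_netcl_le[OF fin tB(3,4)]) auto
  moreover have "card (insert a B) = 4" using B(1) a(2) tB(1) by (simp add: tri_def)
  moreover have "insert a B \<subseteq> netcl 2 A B a" using netcl_contains B(2) a(1) by blast
  moreover have "finite (netcl 2 A B a)" using finite_subset[OF netcl_contains(3) fin] .
  ultimately show ?thesis using card_seteq[of "netcl 2 A B a" "insert a B"] by auto
qed

section \<open>Lines through a vertex with few points\<close>

definition pline :: "(real \<times> real) set \<Rightarrow> real \<times> real \<Rightarrow> real \<times> real \<Rightarrow> (real \<times> real) set" where
  "pline A b x = {y \<in> A. \<forall>f\<in>Van 1 {b, x}. ev f y = 0}"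

text \<open>The bound 3 allows for the vertex \<open>b\<close>, one point off the sides, and the
  intersection with the opposite side, as met in \<open>bad_pairs\<close>.\<close>

definition poor :: "(real \<times> real) set \<Rightarrow> real \<times> real \<Rightarrow> (real \<times> real) set set" where
  "poor A b = {L. \<exists>x\<in>A - {b}. L = pline A b x \<and> card L \<le> 3}"

lemma pline_zs:
  assumes "l \<in> Van 1 {b, x}" "l \<noteq> 0" "b \<noteq> x"
  shows "pline A b x = zs A l"
proof -
  have "ev f y = 0" if f: "f \<in> Van 1 {b, x}" "ev l y = 0" for f y
  proof -
    obtain r where "f = cmul r l" using line_unique[OF assms(3,1,2) f(1)] by blast
    then show ?thesis using f(2) by simp
  qed
  then show ?thesis using assms(1) by (auto simp: pline_def zs_def)
qed

lemma finite_poor: "finite A \<Longrightarrow> finite (poor A b)"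
  by (rule finite_subset[of _ "pline A b ` A"]) (auto simp: poor_def)

definition conic_reps :: "(real \<times> real) set \<Rightarrow> (real \<times> real) set \<Rightarrow> (real \<times> real) set \<Rightarrow> bool" where
  "conic_reps A B R \<longleftrightarrow> R \<subseteq> A \<and> (\<forall>a\<in>R. \<exists>f\<in>Van (int 2) B. ev f a \<noteq> 0) \<and>
     (\<forall>x\<in>A. \<forall>f\<in>Van (int 2) B. ev f x \<noteq> 0 \<longrightarrow> (\<exists>a\<in>R. x \<in> netcl 2 A B a)) \<and>
     (\<forall>a\<in>R. \<forall>b\<in>R. a \<noteq> b \<longrightarrow> b \<notin> netcl 2 A B a)"

context
  fixes A B R :: "(real \<times> real) set"
  assumes fin: "finite A" and B: "tri B" "B \<subseteq> A" and reps: "conic_reps A B R"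
begin

lemma reps_props: "R \<subseteq> A" "\<And>a. a \<in> R \<Longrightarrow> \<exists>f\<in>Van (int 2) B. ev f a \<noteq> 0"
    "\<And>x f. x \<in> A \<Longrightarrow> f \<in> Van (int 2) B \<Longrightarrow> ev f x \<noteq> 0 \<Longrightarrow> \<exists>a\<in>R. x \<in> netcl 2 A B a"
    "\<And>a b. a \<in> R \<Longrightarrow> b \<in> R \<Longrightarrow> a \<noteq> b \<Longrightarrow> b \<notin> netcl 2 A B a"
  using reps unfolding conic_reps_def by blast+

lemma rep_notin: "a \<in> R \<Longrightarrow> a \<notin> B"
  using reps_props(2)[of a] by (auto simp: Van_def)

lemma rep_side_unique:
  assumes "b \<in> B" "a \<in> R" "a' \<in> R" "a \<in> side A B b" "a' \<in> side A B b"
  shows "a = a'"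
proof (rule ccontr)
  assume "a \<noteq> a'"
  then have "a' \<notin> netcl 2 A B a" using reps_props(4) assms by blast
  then show False using netcl_side(1)[OF B(1) assms(1) B(2) assms(4) rep_notin[OF assms(2)]] assms by auto
qed

lemma rep_bad_side:
  assumes "a \<in> R" "\<not> card (netcl 2 A B a) \<le> 2 ^ 2"
  shows "\<exists>b\<in>B. a \<in> side A B b \<and> 3 < card (side A B b)"
proof -
  have aA: "a \<in> A" "a \<notin> B" using reps_props(1) rep_notin assms by auto
  have "\<exists>b\<in>B. a \<in> side A B b"
  proof (rule ccontr)
    assume "\<not> ?thesis"
    then have "netcl 2 A B a = insert a B" using netcl_off_sides[OF fin B aA] by blast
    moreover have "card (insert a B) \<le> 4" using B(1) card_insert_le_m1[of 4 B a] by (simp add: tri_def)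
    ultimately show False using assms by simp
  qed
  then obtain b where b: "b \<in> B" "a \<in> side A B b" by blast
  have "netcl 2 A B a = side A B b \<union> {b}" using netcl_side(1)[OF B(1) b(1) B(2) b(2) aA(2)] .
  then have "card (netcl 2 A B a) \<le> card (side A B b) + 1"
    using card_Un_le[of "side A B b" "{b}"] by simp
  then show ?thesis using assms b by auto
qed

lemma off_sides_reps:
  assumes "x \<in> A" "x \<notin> B" "\<And>b. b \<in> B \<Longrightarrow> x \<notin> side A B b"
  shows "x \<in> R"
proof -
  obtain f where "f \<in> Van (int 2) B" "ev f x \<noteq> 0"
    using indep_step[of "int 2" B x] tri_indep(2)[OF B(1)] assms(2) by auto
  then obtain a where a: "a \<in> R" "x \<in> netcl 2 A B a" using reps_props(3) assms(1) by blast
  have aA: "a \<in> A" "a \<notin> B" using reps_props(1) rep_notin a by auto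
  show ?thesis
  proof (cases "\<exists>b\<in>B. a \<in> side A B b")
    case True
    then obtain b where b: "b \<in> B" "a \<in> side A B b" by blast
    then have "x \<in> side A B b \<union> {b}" using netcl_side(1)[OF B(1) b(1) B(2) b(2) aA(2)] a by simp
    then show ?thesis using assms b by auto
  next
    case False
    then have "netcl 2 A B a = insert a B" using netcl_off_sides[OF fin B aA] by blast
    then show ?thesis using a assms by auto
  qed
qed

text \<open>A conic of the net through a representative \<open>a\<close> on a side splits into that side and a line
  \<open>k\<close> through the opposite vertex \<open>b\<close>; if the pair \<open>a, x\<close> is ordinary, \<open>k\<close> contains few points.\<close>

lemma bad_pairs:
  "card {e. \<exists>a x. e = {a, x} \<and> a \<in> R \<and> x \<in> R \<and> a \<noteq> x \<and> netpair 2 A B a x \<and> \<not> card (netcl 2 A B a) \<le> 2 ^ 2}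
    \<le> (\<Sum>b\<in>B. card (poor A b)) + 8"
proof -
  let ?bad = "{e. \<exists>a x. e = {a, x} \<and> a \<in> R \<and> x \<in> R \<and> a \<noteq> x \<and> netpair 2 A B a x \<and> \<not> card (netcl 2 A B a) \<le> 2 ^ 2}"
  \<comment> \<open>Representatives on the sides; each side has at most one, so there are at most
    three.\<close>
  define Q where "Q = {a \<in> R. \<exists>b\<in>B. a \<in> side A B b}"
  have finB: "finite B" using tri_indep(1)[OF B(1)] .
  have finR: "finite R" using reps_props(1) fin finite_subset by blast
  have "\<forall>a\<in>Q. \<exists>b. b \<in> B \<and> a \<in> side A B b" by (auto simp: Q_def)
  then obtain \<beta> where \<beta>: "\<And>a. a \<in> Q \<Longrightarrow> \<beta> a \<in> B \<and> a \<in> side A B (\<beta> a)"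
    using bchoice[of Q "\<lambda>a b. b \<in> B \<and> a \<in> side A B b"] by blast
  have inj: "inj_on \<beta> Q"
  proof (rule inj_onI)
    fix a a' assume "a \<in> Q" "a' \<in> Q" "\<beta> a = \<beta> a'"
    then show "a = a'" using \<beta>[of a] \<beta>[of a'] rep_side_unique[of "\<beta> a" a a'] by (auto simp: Q_def)
  qed
  have finQ: "finite Q" using finR by (simp add: Q_def)
  \<comment> \<open>Pairs inside \<open>Q\<close> are bounded by its number of subsets, which gives
    the summand 8.\<close>
  have "card Q \<le> card B" using \<beta> inj finB by (intro card_inj_on_le[of \<beta>]) auto
  then have cQ: "card (Pow Q) \<le> 8" using B(1) finQ power_increasing[of "card Q" 3 "2::nat"] by (simp add: card_Pow tri_def)
  define D where "D a x \<longleftrightarrow> a \<in> Q \<and> x \<in> R - Q \<and> a \<noteq> x \<and> netpair 2 A B a x" for a x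
  have key: "pline A (\<beta> a) x \<in> poor A (\<beta> a) \<and> pline A (\<beta> a) x \<inter> R \<subseteq> {a, x}" if D: "D a x" for a x
  proof -
    have a: "a \<in> R" "\<beta> a \<in> B" "a \<in> side A B (\<beta> a)" "a \<notin> B" using D \<beta> rep_notin by (auto simp: D_def Q_def)
    have x: "x \<in> R" "x \<in> A" "x \<notin> B" "\<And>b. b \<in> B \<Longrightarrow> x \<notin> side A B b"
      using D reps_props(1) rep_notin by (auto simp: D_def Q_def)
    let ?b = "\<beta> a"
    have na: "netcl 2 A B a = side A B ?b \<union> {?b}" using netcl_side(1)[OF B(1) a(2) B(2) a(3,4)] .
    have nx: "netcl 2 A B x = insert x B" using netcl_off_sides[OF fin B x(2-4)] .
    obtain f where f: "f \<in> Pol (int 2)" "f \<noteq> 0" "netcl 2 A B a \<union> netcl 2 A B x = zs A f"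
      using D by (auto simp: D_def netpair_def)
    have "insert a B \<subseteq> zs A f" using f(3) netcl_contains(1)[OF B(2), of 2 a] netcl_contains(2)[of a A 2 B] a(1) reps_props(1) by blast
    then have fV: "f \<in> Van (int 2) (insert a B)" using f(1) by (auto simp: Van_def zs_def)
    obtain l k where lk: "f = l * k" "l \<in> Pol 1" "ev l ?b \<noteq> 0" "l \<noteq> 0" "side A B ?b = zs A l" "k \<in> Pol 1" "ev k ?b = 0"
      using netcl_side(2)[OF B(1) a(2) B(2) a(3,4) fV] by blast
    have k0: "k \<noteq> 0" using f lk by auto
    have lx: "ev l x \<noteq> 0" using x(2) x(4)[OF a(2)] lk(5) by (auto simp: zs_def)
    have "x \<in> zs A f" using f(3) nx by blast
    then have kx: "ev k x = 0" using lk lx by (auto simp: zs_def)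
    have bx: "?b \<noteq> x" using a(2) x(3) by auto
    have pl: "pline A ?b x = zs A k" using lk kx k0 bx by (intro pline_zs) (auto simp: Van_def)
    \<comment> \<open>Ordinariness of the pair confines the points of \<open>k\<close> to the
      vertex, \<open>x\<close>, and the intersection with the side.\<close>
    have sub: "zs A k \<subseteq> {?b, x} \<union> (zs A k \<inter> zs A l)"
    proof
      fix y assume y: "y \<in> zs A k"
      then have "y \<in> netcl 2 A B a \<union> netcl 2 A B x" using f(3) lk(1) by (auto simp: zs_def)
      moreover have "y = ?b \<or> ev l y = 0" if "y \<in> B"
      proof -
        obtain l' b1 b2 where l': "B = {?b, b1, b2}" "ev l' b1 = 0" "ev l' b2 = 0" "\<forall>A. side A B ?b = zs A l'"
          by (rule tri_side[OF B(1) a(2)])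
        have "y = ?b \<or> y \<in> side A B ?b" using that l' B(2) by (auto simp: zs_def)
        then show ?thesis using lk(5) by (auto simp: zs_def)
      qed
      ultimately show "y \<in> {?b, x} \<union> (zs A k \<inter> zs A l)" using na nx lk(5) y by (auto simp: zs_def)
    qed
    have "card (zs A k \<inter> zs A l) \<le> 1"
    proof (rule ccontr)
      assume "\<not> ?thesis"
      then obtain y z where "y \<in> zs A k \<inter> zs A l" "z \<in> zs A k \<inter> zs A l" "y \<noteq> z"
      proof -
        have "finite (zs A k \<inter> zs A l)" using fin by (simp add: zs_def)
        from card_le_Suc0_iff_eq[OF this] \<open>\<not> card (zs A k \<inter> zs A l) \<le> 1\<close> show thesis using that by auto
      qed
      then have "k = 0" using lk by (intro lines_meet[of l k ?b y z]) (auto simp: zs_def)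
      then show False using k0 by simp
    qed
    moreover have "card (zs A k) \<le> card ({?b, x} \<union> (zs A k \<inter> zs A l))"
      using sub fin by (intro card_mono) (auto simp: zs_def)
    moreover have "card ({?b, x} \<union> (zs A k \<inter> zs A l)) \<le> card {?b, x} + card (zs A k \<inter> zs A l)" by (rule card_Un_le)
    ultimately have "card (zs A k) \<le> 3" using bx by simp
    then have "pline A ?b x \<in> poor A ?b" using pl x(2) bx by (auto simp: poor_def)
    moreover have "pline A ?b x \<inter> R \<subseteq> {a, x}"
    proof
      fix y assume y: "y \<in> pline A ?b x \<inter> R"
      then have "y \<in> netcl 2 A B a \<union> netcl 2 A B x" using f(3) lk(1) pl by (auto simp: zs_def)
      then show "y \<in> {a, x}" using reps_props(4)[of a y] reps_props(4)[of x y] a x y by blast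
    qed
    ultimately show ?thesis by blast
  qed
  let ?P = "Sigma B (poor A)"
  define L where "L = {(a, x). D a x}"
  \<comment> \<open>The vertex recovers \<open>a\<close>, and the poor line meets \<open>R\<close>
    at most in \<open>a\<close> and \<open>x\<close>, which recovers \<open>x\<close>.\<close>
  have "inj_on (\<lambda>(a, x). (\<beta> a, pline A (\<beta> a) x)) L"
  proof (rule inj_onI, clarify)
    fix a x a' x' assume L: "(a, x) \<in> L" "(a', x') \<in> L" and eq: "\<beta> a = \<beta> a'" "pline A (\<beta> a) x = pline A (\<beta> a') x'"
    have "a = a'" using inj eq(1) L by (auto simp: L_def D_def dest: inj_onD)
    have "x' \<in> pline A (\<beta> a) x" using eq(2) L reps_props(1) by (auto simp: pline_def L_def D_def Van_def)
    then have "x' \<in> {a, x}" using key[of a x] L by (auto simp: L_def D_def)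
    moreover have "x' \<noteq> a" using L \<open>a = a'\<close> by (auto simp: L_def D_def)
    ultimately show "a = a' \<and> x = x'" using \<open>a = a'\<close> by blast
  qed
  moreover have "(\<lambda>(a, x). (\<beta> a, pline A (\<beta> a) x)) ` L \<subseteq> ?P"
  proof (intro subsetI, elim imageE)
    fix p ax assume "p = (case ax of (a, x) \<Rightarrow> (\<beta> a, pline A (\<beta> a) x))" "ax \<in> L"
    then obtain a x where ax: "p = (\<beta> a, pline A (\<beta> a) x)" "D a x" by (auto simp: L_def)
    then have "\<beta> a \<in> B" using \<beta> by (simp add: D_def)
    then show "p \<in> ?P" using key[OF ax(2)] ax(1) by blast
  qed
  moreover have finP: "finite ?P" using finB finite_poor[OF fin] by blast
  ultimately have cL: "card L \<le> card ?P" by (intro card_inj_on_le)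
  have finL: "finite L" by (rule finite_subset[of _ "R \<times> R"]) (use finR in \<open>auto simp: L_def D_def Q_def\<close>)
  have "?bad \<subseteq> Pow Q \<union> (\<lambda>(a, x). {a, x}) ` L"
  proof
    fix e assume "e \<in> ?bad"
    then obtain a x where e: "e = {a, x}" "a \<in> R" "x \<in> R" "a \<noteq> x" "netpair 2 A B a x" "\<not> card (netcl 2 A B a) \<le> 2 ^ 2" by blast
    have "a \<in> Q" using rep_bad_side[OF e(2,6)] e(2) by (auto simp: Q_def)
    show "e \<in> Pow Q \<union> (\<lambda>(a, x). {a, x}) ` L"
    proof (cases "x \<in> Q")
      case True then show ?thesis using e(1) \<open>a \<in> Q\<close> by blast
    next
      case False
      then have "(a, x) \<in> L" using e \<open>a \<in> Q\<close> by (auto simp: L_def D_def)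
      then show ?thesis using e(1) by (auto intro!: image_eqI[of _ _ "(a, x)"])
    qed
  qed
  then have "card ?bad \<le> card (Pow Q \<union> (\<lambda>(a, x). {a, x}) ` L)" using finQ finL by (intro card_mono) auto
  also have "\<dots> \<le> card (Pow Q) + card ((\<lambda>(a, x). {a, x}) ` L)" by (rule card_Un_le)
  also have "card ((\<lambda>(a, x). {a, x}) ` L) \<le> card L" using finL by (rule card_image_le)
  finally have "card ?bad \<le> 8 + card L" using cQ by simp
  moreover have "card ?P = (\<Sum>b\<in>B. card (poor A b))" using finB finite_poor[OF fin] by (subst card_SigmaI) auto
  ultimately show ?thesis using cL by simp
qed

end

definition offs :: "(real \<times> real) set \<Rightarrow> (real \<times> real) set \<Rightarrow> (real \<times> real) set" where
  "offs A B = {x \<in> A. x \<notin> B \<and> (\<forall>b\<in>B. x \<notin> side A B b)}"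

text \<open>Ordinary pairs with an oversized fibre are few when the vertices have few poor lines;
  all others give determined conics. Only points off the sides are counted on the left, because each
  of them is its own representative.\<close>

lemma conic_count_low:
  assumes fin: "finite A" and A: "Van (int 2) A = {0}" and B: "tri B" "B \<subseteq> A"
  shows "card (offs A B) \<le> 10 * (card {T. ordset 2 A T \<and> B \<subseteq> T} + (\<Sum>b\<in>B. card (poor A b)) + 8) + 4"
proof -
  note tB = tri_indep[OF B(1)]
  obtain R where R: "R \<subseteq> A" "\<And>a. a \<in> R \<Longrightarrow> \<exists>f\<in>Van (int 2) B. ev f a \<noteq> 0"
    "\<And>x f. x \<in> A \<Longrightarrow> f \<in> Van (int 2) B \<Longrightarrow> ev f x \<noteq> 0 \<Longrightarrow> \<exists>a\<in>R. x \<in> netcl 2 A B a"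
    "\<And>a b. a \<in> R \<Longrightarrow> b \<in> R \<Longrightarrow> a \<noteq> b \<Longrightarrow> b \<notin> netcl 2 A B a"
    "\<And>q. q \<in> R \<Longrightarrow> Van (int 2) (B \<union> (R - {q})) = {0} \<Longrightarrow>
       card R \<le> 10 * card {e. \<exists>a b. e = {a, b} \<and> a \<in> R \<and> b \<in> R \<and> a \<noteq> b \<and> q \<notin> e \<and> netpair 2 A B a b} + 4"
    by (rule net_representatives[OF fin B(2) tB(3,4)]) (rule that; assumption)
  have reps: "conic_reps A B R" unfolding conic_reps_def using R(1-4) by blast
  have finR: "finite R" using R(1) fin finite_subset by blast
  have "offs A B \<subseteq> R" using off_sides_reps[OF fin B reps] by (auto simp: offs_def)
  then have 1: "card (offs A B) \<le> card R" using finR by (intro card_mono) auto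
  have "f \<in> Van (int 2) A" if "f \<in> Van (int 2) (B \<union> R)" for f
    using netcl_cover[of A 2 B R f, OF R(3) that] that by (simp add: Van_def)
  then have V0: "Van (int 2) (B \<union> R) = {0}" using A zero_Van[of "int 2" "B \<union> R"] by blast
  have RB: "R \<inter> B = {}" using R(2) by (fastforce simp: Van_def)
  let ?rhs = "10 * (card {T. ordset 2 A T \<and> B \<subseteq> T} + (\<Sum>b\<in>B. card (poor A b)) + 8) + 4"
  have "card R \<le> ?rhs"
    using ex_superfluous_rep[OF tB(3,4) finR RB V0]
  proof
    assume "\<exists>q\<in>R. Van (int 2) (B \<union> (R - {q})) = {0}"
    then obtain q where q: "q \<in> R" "Van (int 2) (B \<union> (R - {q})) = {0}" by blast
    let ?E = "{e. \<exists>a b. e = {a, b} \<and> a \<in> R \<and> b \<in> R \<and> a \<noteq> b \<and> q \<notin> e \<and> netpair 2 A B a b}"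
    let ?bad = "{e. \<exists>a x. e = {a, x} \<and> a \<in> R \<and> x \<in> R \<and> a \<noteq> x \<and> netpair 2 A B a x \<and> \<not> card (netcl 2 A B a) \<le> 2 ^ 2}"
    have fE: "finite ?E" "finite ?bad" by (rule finite_subset[of _ "Pow R"]; use finR in auto)+
    have "card (?E - ?bad) \<le> card {T. ordset 2 A T \<and> B \<subseteq> T}"
    proof (rule card_netpairs_le[OF fin B(2) tB(4) R(1,4)])
      fix e assume e: "e \<in> ?E - ?bad"
      then obtain a b where ab: "e = {a, b}" "a \<in> R" "b \<in> R" "a \<noteq> b" "netpair 2 A B a b" by blast
      have ba: "netpair 2 A B b a" using ab(5) by (simp add: netpair_def Un_commute)
      have "card (netcl 2 A B a) \<le> 2 ^ 2" using e ab by blast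
      moreover have "card (netcl 2 A B b) \<le> 2 ^ 2"
      proof (rule ccontr)
        assume "\<not> ?thesis"
        then have "e = {b, a} \<and> b \<in> R \<and> a \<in> R \<and> b \<noteq> a \<and> netpair 2 A B b a \<and> \<not> card (netcl 2 A B b) \<le> 2 ^ 2"
          using ab ba by (simp add: insert_commute)
        then have "e \<in> ?bad" by blast
        then show False using e by blast
      qed
      ultimately show "\<exists>a b. e = {a, b} \<and> a \<in> R \<and> b \<in> R \<and> netpair 2 A B a b \<and>
            card (netcl 2 A B a) \<le> 2 ^ 2 \<and> card (netcl 2 A B b) \<le> 2 ^ 2"
        using ab by blast
    qed
    moreover have "card ?E \<le> card (?E - ?bad) + card ?bad"
      by (rule order.trans[OF card_mono card_Un_le]) (use fE in auto)
    moreover have "card ?bad \<le> (\<Sum>b\<in>B. card (poor A b)) + 8" by (rule bad_pairs[OF fin B reps])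
    ultimately have "card ?E \<le> card {T. ordset 2 A T \<and> B \<subseteq> T} + (\<Sum>b\<in>B. card (poor A b)) + 8" by linarith
    then have "10 * card ?E \<le> 10 * (card {T. ordset 2 A T \<and> B \<subseteq> T} + (\<Sum>b\<in>B. card (poor A b)) + 8)"
      by (rule mult_le_mono2)
    then show ?thesis using R(5)[OF q] by simp
  qed simp
  then show ?thesis using 1 by linarith
qed

text \<open>Only the side opposite \<open>b1\<close> can have an oversized fibre, and it has at most
  one representative, which is then the point to be avoided. \<open>NF\<close> keeps the images of
  the other representatives non-collinear.\<close>

lemma conic_count_high:
  assumes fin: "finite A" and A: "Van (int 2) A = {0}" and B: "tri B" "B \<subseteq> A" "b1 \<in> B"
    and few: "\<And>b. b \<in> B - {b1} \<Longrightarrow> card (side A B b) \<le> 3"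
    and NF: "Van (int 2) (B \<union> {x \<in> A. x \<notin> side A B b1}) = {0}"
  shows "card (offs A B) \<le> 10 * card {T. ordset 2 A T \<and> B \<subseteq> T} + 4"
proof -
  note tB = tri_indep[OF B(1)]
  obtain R where R: "R \<subseteq> A" "\<And>a. a \<in> R \<Longrightarrow> \<exists>f\<in>Van (int 2) B. ev f a \<noteq> 0"
    "\<And>x f. x \<in> A \<Longrightarrow> f \<in> Van (int 2) B \<Longrightarrow> ev f x \<noteq> 0 \<Longrightarrow> \<exists>a\<in>R. x \<in> netcl 2 A B a"
    "\<And>a b. a \<in> R \<Longrightarrow> b \<in> R \<Longrightarrow> a \<noteq> b \<Longrightarrow> b \<notin> netcl 2 A B a"
    "\<And>q. q \<in> R \<Longrightarrow> Van (int 2) (B \<union> (R - {q})) = {0} \<Longrightarrow>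
       card R \<le> 10 * card {e. \<exists>a b. e = {a, b} \<and> a \<in> R \<and> b \<in> R \<and> a \<noteq> b \<and> q \<notin> e \<and> netpair 2 A B a b} + 4"
    by (rule net_representatives[OF fin B(2) tB(3,4)]) (rule that; assumption)
  have reps: "conic_reps A B R" unfolding conic_reps_def using R(1-4) by blast
  have finR: "finite R" using R(1) fin finite_subset by blast
  have RB: "R \<inter> B = {}" using R(2) by (fastforce simp: Van_def)
  have "offs A B \<subseteq> R" using off_sides_reps[OF fin B(1,2) reps] by (auto simp: offs_def)
  then have 1: "card (offs A B) \<le> card R" using finR by (intro card_mono) auto
  have ok: "card (netcl 2 A B a) \<le> 2 ^ 2" if a: "a \<in> R" "a \<notin> side A B b1" for a
  proof (rule ccontr)
    assume "\<not> ?thesis"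
    then obtain b where b: "b \<in> B" "a \<in> side A B b" "3 < card (side A B b)"
      using rep_bad_side[OF fin B(1,2) reps a(1)] by blast
    then have "b = b1" using few[of b] by (cases "b = b1") auto
    then show False using b a by simp
  qed
  have step: "card R \<le> 10 * card {T. ordset 2 A T \<and> B \<subseteq> T} + 4"
    if q: "q \<in> R" "Van (int 2) (B \<union> (R - {q})) = {0}" and c: "\<And>a. a \<in> R - {q} \<Longrightarrow> a \<notin> side A B b1" for q
  proof -
    let ?E = "{e. \<exists>a b. e = {a, b} \<and> a \<in> R \<and> b \<in> R \<and> a \<noteq> b \<and> q \<notin> e \<and> netpair 2 A B a b}"
    have "card ?E \<le> card {T. ordset 2 A T \<and> B \<subseteq> T}"
    proof (rule card_netpairs_le[OF fin B(2) tB(4) R(1,4)])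
      fix e assume "e \<in> ?E"
      then obtain a b where ab: "e = {a, b}" "a \<in> R - {q}" "b \<in> R - {q}" "netpair 2 A B a b" by blast
      then show "\<exists>a b. e = {a, b} \<and> a \<in> R \<and> b \<in> R \<and> netpair 2 A B a b \<and>
            card (netcl 2 A B a) \<le> 2 ^ 2 \<and> card (netcl 2 A B b) \<le> 2 ^ 2"
        using ok c by blast
    qed
    then show ?thesis using R(5)[OF q] by linarith
  qed
  have "card R \<le> 10 * card {T. ordset 2 A T \<and> B \<subseteq> T} + 4"
  proof (cases "\<exists>q\<in>R. q \<in> side A B b1")
    case True
    then obtain q where q: "q \<in> R" "q \<in> side A B b1" by blast
    have "f = 0" if f: "f \<in> Van (int 2) (B \<union> (R - {q}))" for f
    proof -
      have fB: "f \<in> Van (int 2) B" using f by (auto simp: Van_def)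
      have "ev f x = 0" if x: "x \<in> A" "x \<notin> side A B b1" for x
      proof (rule ccontr)
        assume n: "ev f x \<noteq> 0"
        then obtain r where r: "r \<in> R" "x \<in> netcl 2 A B r" using R(3)[OF x(1) fB] by blast
        have "r = q"
        proof (rule ccontr)
          assume "r \<noteq> q"
          then have "f \<in> Van (int 2) (insert r B)" using f r by (auto simp: Van_def)
          then show False using n r(2) by (auto simp: netcl_def)
        qed
        then have "x \<in> side A B b1 \<union> {b1}"
          using netcl_side(1)[OF B(1,3,2) q(2)] rep_notin[OF fin B(1,2) reps q(1)] r(2) by simp
        then have "x = b1" using x by simp
        then show False using n fB B(3) by (simp add: Van_def)
      qed
      then have "f \<in> Van (int 2) (B \<union> {x \<in> A. x \<notin> side A B b1})" using fB by (auto simp: Van_def)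
      then show "f = 0" using NF by auto
    qed
    then have "Van (int 2) (B \<union> (R - {q})) = {0}" using zero_Van[of "int 2" "B \<union> (R - {q})"] by blast
    moreover have "a \<notin> side A B b1" if "a \<in> R - {q}" for a
      using rep_side_unique[OF fin B(1,2) reps B(3) _ q(1) _ q(2), of a] that by blast
    ultimately show ?thesis using step[OF q(1)] by blast
  next
    case False
    have "f \<in> Van (int 2) A" if "f \<in> Van (int 2) (B \<union> R)" for f
      using netcl_cover[of A 2 B R f, OF R(3) that] that by (simp add: Van_def)
    then have V0: "Van (int 2) (B \<union> R) = {0}" using A zero_Van[of "int 2" "B \<union> R"] by blast
    from ex_superfluous_rep[OF tB(3,4) finR RB V0] show ?thesis
    proof
      assume "\<exists>q\<in>R. Van (int 2) (B \<union> (R - {q})) = {0}"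
      then show ?thesis using step False by blast
    qed simp
  qed
  then show ?thesis using 1 by linarith
qed

section \<open>Families of triangles\<close>

lemma tri_line:
  assumes "l \<in> Pol 1" "ev l a = 0" "ev l b = 0" "ev l c \<noteq> 0" "a \<noteq> b"
  shows "tri {c, a, b}" "side A {c, a, b} c = zs A l"
proof -
  have ne: "c \<noteq> a" "c \<noteq> b" using assms by auto
  have l0: "l \<noteq> 0" using assms(4) by auto
  have "g = 0" if "g \<in> Van 1 {c, a, b}" for g
    using that assms l0 lines_meet[of l g c a b] by (auto simp: Van_def)
  then have "Van 1 {c, a, b} = {0}" using zero_Van[of 1 "{c, a, b}"] by blast
  then show t: "tri {c, a, b}" using ne assms(5) by (simp add: tri_def)
  obtain l' b1 b2 where l': "{c, a, b} = {c, b1, b2}" "b1 \<noteq> b2" "c \<noteq> b1" "c \<noteq> b2" "l' \<noteq> 0" "tdeg l' = 1" "l' \<in> Pol 1"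
    "ev l' b1 = 0" "ev l' b2 = 0" "ev l' c \<noteq> 0" "\<forall>A. side A {c, a, b} c = zs A l'"
    by (rule tri_side[OF t, of c]) (simp, (rule that; assumption))
  have "{b1, b2} = {a, b}" using l' ne by auto
  then have "l' \<in> Van 1 {a, b}" using l' by (auto simp: Van_def)
  then have "pline A a b = zs A l'" using l'(5) assms(5) by (intro pline_zs) auto
  moreover have "pline A a b = zs A l" using assms l0 by (intro pline_zs) (auto simp: Van_def)
  ultimately show "side A {c, a, b} c = zs A l" using l' by simp
qed

lemma tri_sides:
  assumes "tri {a, b, c}" "a \<noteq> b" "a \<noteq> c" "b \<noteq> c"
  shows "side A {a, b, c} a = pline A b c" "side A {a, b, c} b = pline A a c" "side A {a, b, c} c = pline A a b"
proof -
  have gen: "side A {c, a, b} c = pline A a b" if t: "tri {c, a, b}" and n: "a \<noteq> b" for a b c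
  proof -
    obtain l where l: "l \<noteq> 0" "tdeg l = 1" "l \<in> Van 1 {a, b}" using line_through[OF n] .
    have "ev l c \<noteq> 0"
    proof
      assume "ev l c = 0"
      then have "l \<in> Van 1 {c, a, b}" using l(3) by (auto simp: Van_def)
      then show False using t l(1) by (auto simp: tri_def)
    qed
    then have "side A {c, a, b} c = zs A l" using l n by (intro tri_line(2)) (auto simp: Van_def)
    then show ?thesis using pline_zs[OF l(3,1) n] by simp
  qed
  show "side A {a, b, c} a = pline A b c" using gen[of a b c] assms by simp
  show "side A {a, b, c} b = pline A a c" using gen[of b a c] assms by (simp add: insert_commute)
  show "side A {a, b, c} c = pline A a b" using gen[of c a b] assms by (simp add: insert_commute)
qed

lemma card_insert_image:
  assumes "finite W" "x \<noteq> y" "x \<notin> W" "y \<notin> W"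
  shows "card ((\<lambda>z. {x, y, z}) ` W) = card W"
  using assms by (intro card_image) (auto simp: inj_on_def doubleton_eq_iff insert_eq_iff)

text \<open>If a line carries an eighth of \<open>A\<close>, the triangles have a fixed vertex off
  it, a fixed one on it and a varying one on it. Otherwise two vertices are fixed and the third is
  any point off their line. Either way the three sides leave a positive proportion of
  \<open>A\<close> uncovered.\<close>

lemma low_family:
  assumes fin: "finite A" and n: "1000 \<le> card A"
    and lines: "\<And>l. l \<noteq> 0 \<Longrightarrow> tdeg l = 1 \<Longrightarrow> card A \<le> 24 * card (A - zs A l)"
  obtains BB where "\<And>B. B \<in> BB \<Longrightarrow> tri B \<and> B \<subseteq> A \<and> card A \<le> 100 * card (offs A B)" "card A \<le> 100 * card BB"
proof (cases "\<exists>l. l \<noteq> 0 \<and> tdeg l = 1 \<and> card A \<le> 8 * card (zs A l)")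
  case True
  then obtain l where l: "l \<noteq> 0" "tdeg l = 1" "card A \<le> 8 * card (zs A l)" by blast
  have lP: "l \<in> Pol 1" using Pol_iff[OF l(1)] l(2) by simp
  define X where "X = zs A l"
  define Y where "Y = A - X"
  have fX: "finite X" "finite Y" using fin by (auto simp: X_def Y_def zs_def)
  have cY: "card A \<le> 24 * card Y" using lines[OF l(1,2)] by (simp add: X_def Y_def)
  then have "Y \<noteq> {}" using n by auto
  then obtain b3 where b3: "b3 \<in> Y" by blast
  have lb3: "ev l b3 \<noteq> 0" using b3 by (auto simp: Y_def X_def zs_def)
  define Yx where "Yx x = {y \<in> Y. y \<noteq> b3 \<and> y \<in> pline A b3 x}" for x
  have neX: "x \<noteq> b3" if "x \<in> X" for x using that b3 by (auto simp: Y_def)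
  have lX: "ev l x = 0" if "x \<in> X" for x using that by (auto simp: X_def zs_def)
  have dis: "Yx x \<inter> Yx x' = {}" if x: "x \<in> X" "x' \<in> X" "x \<noteq> x'" for x x'
  proof (rule ccontr)
    assume "\<not> ?thesis"
    then obtain y where y: "y \<noteq> b3" "y \<in> pline A b3 x" "y \<in> pline A b3 x'" by (auto simp: Yx_def)
    obtain g where g: "g \<noteq> 0" "tdeg g = 1" "g \<in> Van 1 {b3, x}" using line_through neX x(1) by metis
    obtain h where h: "h \<noteq> 0" "tdeg h = 1" "h \<in> Van 1 {b3, x'}" using line_through neX x(2) by metis
    have "g \<in> Van 1 {b3, y}" "h \<in> Van 1 {b3, y}" using g h y by (auto simp: pline_def Van_def)
    then obtain r where "g = cmul r h" using line_unique[of b3 y h g] y(1) h(1) by blast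
    then have "ev g x' = 0" using h(3) by (simp add: Van_def)
    then have "g = 0" using lines_meet[of l g b3 x x'] lP l(1) lb3 g lX x by (auto simp: Van_def)
    then show False using g by simp
  qed
  \<comment> \<open>Lines from \<open>b3\<close> to different points of \<open>X\<close> share no
    further point of \<open>Y\<close>, so at most three of them can take more than a quarter of
    \<open>Y\<close>.\<close>
  define Xb where "Xb = {x \<in> X. card Y < 4 * card (Yx x)}"
  have fY: "finite (Yx x)" for x using fX by (simp add: Yx_def)
  have "card Xb \<le> 3"
  proof -
    have "card Xb * (card Y + 1) \<le> (\<Sum>x\<in>Xb. 4 * card (Yx x))"
      using sum_bounded_below[of Xb "card Y + 1" "\<lambda>x. 4 * card (Yx x)"] by (simp add: Xb_def)
    also have "\<dots> = 4 * card (\<Union>x\<in>Xb. Yx x)"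
      using fX dis fY by (subst card_UN_disjoint) (auto simp: Xb_def sum_distrib_left)
    also have "\<dots> \<le> 4 * card Y" using fX by (intro mult_left_mono card_mono) (auto simp: Yx_def)
    finally have *: "card Xb * (card Y + 1) \<le> 4 * card Y" .
    show ?thesis
    proof (rule ccontr)
      assume "\<not> ?thesis"
      then have "4 * (card Y + 1) \<le> card Xb * (card Y + 1)" by (intro mult_right_mono) auto
      then show False using * by simp
    qed
  qed
  define Xg where "Xg = X - Xb"
  have cXg: "card X \<le> card Xg + 3"
    using card_split[OF fX(1), of Xb] \<open>card Xb \<le> 3\<close> by (simp add: Xg_def Xb_def)
  have cX: "card A \<le> 8 * card X" using l(3) by (simp add: X_def)
  then have "Xg \<noteq> {}" using cXg n by auto
  then obtain b1 where b1: "b1 \<in> Xg" by blast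
  define BB where "BB = (\<lambda>z. {b3, b1, z}) ` (Xg - {b1})"
  have b1X: "b1 \<in> X" using b1 by (simp add: Xg_def)
  have cBB: "card BB = card (Xg - {b1})"
    unfolding BB_def using fX b3 b1X by (intro card_insert_image) (auto simp: Xg_def Y_def)
  show thesis
  proof (rule that[of BB])
    have "card (Xg - {b1}) + 1 = card Xg" using b1 fX card_Suc_Diff1[of Xg b1] by (simp add: Xg_def)
    then show "card A \<le> 100 * card BB" using cBB cXg cX n by linarith
    fix B assume "B \<in> BB"
    then obtain b2 where b2: "b2 \<in> Xg" "b2 \<noteq> b1" "B = {b3, b1, b2}" by (auto simp: BB_def)
    have b2X: "b2 \<in> X" using b2 by (simp add: Xg_def)
    have t: "tri B" "side A B b3 = zs A l"
      unfolding b2(3) using lP lX b1X b2X lb3 b2(2) by (intro tri_line; simp)+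
    have ne: "b3 \<noteq> b1" "b3 \<noteq> b2" "b1 \<noteq> b2" using neX[OF b1X] neX[OF b2X] b2(2) by auto
    have s: "side A B b1 = pline A b3 b2" "side A B b2 = pline A b3 b1"
      using tri_sides[of b3 b1 b2 A] t(1) ne unfolding b2(3) by auto
    have "Y - Yx b1 - Yx b2 - {b3} \<subseteq> offs A B"
    proof
      fix y assume y: "y \<in> Y - Yx b1 - Yx b2 - {b3}"
      then have "y \<notin> zs A l" "y \<notin> pline A b3 b1" "y \<notin> pline A b3 b2" by (auto simp: Y_def X_def Yx_def)
      moreover have "y \<notin> B" using y b2(3) b1X b2X by (auto simp: Y_def)
      ultimately show "y \<in> offs A B" using y s t(2) b2(3) by (auto simp: offs_def Y_def)
    qed
    then have "card (Y - Yx b1 - Yx b2 - {b3}) \<le> card (offs A B)"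
      using fin by (intro card_mono) (auto simp: offs_def)
    moreover have "card Y \<le> card (Y - Yx b1 - Yx b2 - {b3}) + card (Yx b1) + card (Yx b2) + 1"
    proof -
      have "Y \<subseteq> (Y - Yx b1 - Yx b2 - {b3}) \<union> Yx b1 \<union> Yx b2 \<union> {b3}" by blast
      then have "card Y \<le> card ((Y - Yx b1 - Yx b2 - {b3}) \<union> Yx b1 \<union> Yx b2 \<union> {b3})"
        using fX fY by (intro card_mono) auto
      also have "\<dots> \<le> card ((Y - Yx b1 - Yx b2 - {b3}) \<union> Yx b1 \<union> Yx b2) + card {b3}" by (rule card_Un_le)
      also have "card ((Y - Yx b1 - Yx b2 - {b3}) \<union> Yx b1 \<union> Yx b2) \<le> card ((Y - Yx b1 - Yx b2 - {b3}) \<union> Yx b1) + card (Yx b2)" by (rule card_Un_le)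
      also have "card ((Y - Yx b1 - Yx b2 - {b3}) \<union> Yx b1) \<le> card (Y - Yx b1 - Yx b2 - {b3}) + card (Yx b1)" by (rule card_Un_le)
      finally show ?thesis by simp
    qed
    moreover have "4 * card (Yx b1) \<le> card Y" "4 * card (Yx b2) \<le> card Y" using b1 b2 by (auto simp: Xg_def Xb_def)
    ultimately have "card A \<le> 100 * card (offs A B)" using cY n by linarith
    moreover have "B \<subseteq> A" using b2(3) b1X b2X b3 by (auto simp: X_def Y_def zs_def)
    ultimately show "tri B \<and> B \<subseteq> A \<and> card A \<le> 100 * card (offs A B)" using t by blast
  qed
next
  case False
  then have small: "8 * card (zs A l) < card A" if "l \<noteq> 0" "tdeg l = 1" for l using that by (meson not_le)
  have "2 \<le> card A" using n by simp
  then obtain T where "T \<subseteq> A" "card T = 2" by (rule obtain_subset_with_card_n)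
  then obtain b1 b2 where b: "b1 \<in> A" "b2 \<in> A" "b1 \<noteq> b2" by (auto simp: card_2_iff)
  obtain l where l: "l \<noteq> 0" "tdeg l = 1" "l \<in> Van 1 {b1, b2}" using line_through[OF b(3)] .
  define W where "W = A - zs A l"
  have W: "z \<in> A" "ev l z \<noteq> 0" if "z \<in> W" for z using that by (auto simp: W_def zs_def)
  have lb: "ev l b1 = 0" "ev l b2 = 0" "l \<in> Pol 1" using l by (auto simp: Van_def)
  have plsmall: "8 * card (pline A x y) < card A" if xy: "x \<noteq> y" for x y
  proof -
    obtain k where k: "k \<noteq> 0" "tdeg k = 1" "k \<in> Van 1 {x, y}" using line_through[OF xy] .
    then show ?thesis using small[OF k(1,2)] pline_zs[OF k(3,1) xy] by simp
  qed
  show thesis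
  proof (rule that[of "(\<lambda>z. {b1, b2, z}) ` W"])
    have "card ((\<lambda>z. {b1, b2, z}) ` W) = card W"
      using fin b lb by (intro card_insert_image) (auto simp: W_def zs_def)
    then show "card A \<le> 100 * card ((\<lambda>z. {b1, b2, z}) ` W)" using lines[OF l(1,2)] by (simp add: W_def)
    fix B assume "B \<in> (\<lambda>z. {b1, b2, z}) ` W"
    then obtain z where z: "z \<in> W" "B = {b1, b2, z}" by blast
    have ne: "z \<noteq> b1" "z \<noteq> b2" using W[OF z(1)] lb by auto
    have t: "tri B" using tri_line(1)[OF lb(3,1,2) W(2)[OF z(1)] b(3)] z(2) by (simp add: insert_commute)
    have s: "side A B b1 = pline A b2 z" "side A B b2 = pline A b1 z" "side A B z = pline A b1 b2"
      using tri_sides[of b1 b2 z A] t ne b(3) unfolding z(2) by auto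
    have in_pl: "x \<in> pline A x y" "y \<in> pline A x y" if "x \<in> A" "y \<in> A" for x y
      using that by (auto simp: pline_def Van_def)
    have "A \<subseteq> offs A B \<union> pline A b2 z \<union> pline A b1 z \<union> pline A b1 b2"
    proof
      fix x assume x: "x \<in> A"
      have "b1 \<in> pline A b1 b2" "b2 \<in> pline A b1 b2" "z \<in> pline A b1 z"
        using in_pl b W(1)[OF z(1)] by blast+
      then have "x \<in> B \<Longrightarrow> x \<in> pline A b1 z \<union> pline A b1 b2" using z(2) by blast
      then show "x \<in> offs A B \<union> pline A b2 z \<union> pline A b1 z \<union> pline A b1 b2"
        using x s z(2) by (cases "x \<in> B") (auto simp: offs_def)
    qed
    moreover have fp: "finite (pline A x y)" "finite (offs A B)" for x y using fin by (auto simp: pline_def offs_def)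
    ultimately have "card A \<le> card (offs A B \<union> pline A b2 z \<union> pline A b1 z \<union> pline A b1 b2)" by (intro card_mono) auto
    also have "\<dots> \<le> card (offs A B \<union> pline A b2 z \<union> pline A b1 z) + card (pline A b1 b2)" by (rule card_Un_le)
    also have "card (offs A B \<union> pline A b2 z \<union> pline A b1 z) \<le> card (offs A B \<union> pline A b2 z) + card (pline A b1 z)" by (rule card_Un_le)
    also have "card (offs A B \<union> pline A b2 z) \<le> card (offs A B) + card (pline A b2 z)" by (rule card_Un_le)
    finally have "card A \<le> 100 * card (offs A B)"
      using plsmall[OF b(3)] plsmall[of b1 z] plsmall[of b2 z] ne by simp
    then show "tri B \<and> B \<subseteq> A \<and> card A \<le> 100 * card (offs A B)" using t z b W by auto
  qed
qed

text \<open>Two sides of each triangle are poor lines through \<open>b1\<close>, so only the third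
  can be rich. The work lies in choosing \<open>z\<close> and \<open>z'\<close> such that no conic
  passes through the triangle and all points off that side.\<close>

lemma high_family:
  assumes fin: "finite A" and A: "Van (int 2) A = {0}" and n: "1000000 \<le> card A"
    and lines: "\<And>l. l \<noteq> 0 \<Longrightarrow> tdeg l = 1 \<Longrightarrow> card A \<le> 24 * card (A - zs A l)"
    and b1: "b1 \<in> A" "card A \<le> 6000 * card (poor A b1)"
  obtains BB where "\<And>B. B \<in> BB \<Longrightarrow> B \<subseteq> A \<and> card A \<le> 1000 * card {T. ordset 2 A T \<and> B \<subseteq> T}"
    "card A \<le> 100000 * card BB"
proof -
  \<comment> \<open>One point from each poor line, so that distinct members of \<open>Z\<close> lie
    on distinct lines through \<open>b1\<close>.\<close>
  obtain \<zeta> where \<zeta>: "\<And>L. L \<in> poor A b1 \<Longrightarrow> \<zeta> L \<in> A - {b1} \<and> L = pline A b1 (\<zeta> L) \<and> card L \<le> 3"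
  proof -
    have "\<exists>x. x \<in> A - {b1} \<and> L = pline A b1 x \<and> card L \<le> 3" if "L \<in> poor A b1" for L
      using that unfolding poor_def by auto
    then show thesis using that by metis
  qed
  define Z where "Z = \<zeta> ` poor A b1"
  have Z: "z \<in> A" "z \<noteq> b1" "card (pline A b1 z) \<le> 3" if "z \<in> Z" for z using \<zeta> that by (auto simp: Z_def)
  have Zne: "pline A b1 z \<noteq> pline A b1 z'" if "z \<in> Z" "z' \<in> Z" "z \<noteq> z'" for z z'
    using that \<zeta> by (auto simp: Z_def)
  have cZ: "card Z = card (poor A b1)"
    unfolding Z_def by (rule card_image) (metis \<zeta> inj_onI)
  have ZA: "Z \<subseteq> A" using Z by blast
  then have fZ: "finite Z" using fin finite_subset by blast
  have nZ: "card A \<le> 6000 * card Z" using b1 cZ by simp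
  have off_b1: "ev l b1 \<noteq> 0" if l: "l \<noteq> 0" "l \<in> Pol 1" "ev l z = 0" "ev l z' = 0" and z: "z \<in> Z" "z' \<in> Z" "z \<noteq> z'" for l z z'
  proof
    assume "ev l b1 = 0"
    then have "l \<in> Van 1 {b1, z}" "l \<in> Van 1 {b1, z'}" using l by (auto simp: Van_def)
    then have "pline A b1 z = zs A l" "pline A b1 z' = zs A l"
      using pline_zs l(1) Z(2)[OF z(1)] Z(2)[OF z(2)] by blast+
    then show False using Zne[OF z] by simp
  qed
  have main: "{b1, z, z'} \<subseteq> A \<and> card A \<le> 1000 * card {T. ordset 2 A T \<and> {b1, z, z'} \<subseteq> T}"
    if z: "z \<in> Z" "z' \<in> Z" "z \<noteq> z'" and l: "l \<noteq> 0" "tdeg l = 1" "l \<in> Van 1 {z, z'}"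
      and NF: "Van (int 2) ({b1, z, z'} \<union> (A - zs A l)) = {0}" for z z' l
  proof -
    let ?B = "{b1, z, z'}"
    have lP: "l \<in> Pol 1" "ev l z = 0" "ev l z' = 0" using l(3) by (auto simp: Van_def)
    have lb: "ev l b1 \<noteq> 0" using off_b1[OF l(1) lP z] .
    have t: "tri ?B" "side A ?B b1 = zs A l" using tri_line[OF lP lb z(3)] by auto
    have ne: "b1 \<noteq> z" "b1 \<noteq> z'" using Z(2)[OF z(1)] Z(2)[OF z(2)] by simp_all
    have s: "side A ?B z = pline A b1 z'" "side A ?B z' = pline A b1 z"
      using tri_sides[OF t(1) ne z(3)] by auto
    have BA: "?B \<subseteq> A" using b1 Z z by auto
    have "{x \<in> A. x \<notin> side A ?B b1} = A - zs A l" using t(2) by auto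
    then have cnt: "card (offs A ?B) \<le> 10 * card {T. ordset 2 A T \<and> ?B \<subseteq> T} + 4"
      using s Z(3)[OF z(1)] Z(3)[OF z(2)] NF by (intro conic_count_high[OF fin A t(1) BA, of b1]) auto
    have "A - zs A l \<subseteq> offs A ?B \<union> pline A b1 z \<union> pline A b1 z' \<union> ?B"
      using s t(2) by (auto simp: offs_def)
    moreover have fp: "finite (pline A x y)" "finite (offs A ?B)" for x y using fin by (auto simp: pline_def offs_def)
    ultimately have "card (A - zs A l) \<le> card (offs A ?B \<union> pline A b1 z \<union> pline A b1 z' \<union> ?B)" by (intro card_mono) auto
    also have "\<dots> \<le> card (offs A ?B \<union> pline A b1 z \<union> pline A b1 z') + card ?B" by (rule card_Un_le)
    also have "card (offs A ?B \<union> pline A b1 z \<union> pline A b1 z') \<le> card (offs A ?B \<union> pline A b1 z) + card (pline A b1 z')" by (rule card_Un_le)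
    also have "card (offs A ?B \<union> pline A b1 z) \<le> card (offs A ?B) + card (pline A b1 z)" by (rule card_Un_le)
    finally have "card (A - zs A l) \<le> card (offs A ?B) + 9"
      using Z(3)[OF z(1)] Z(3)[OF z(2)] t(1) by (simp add: tri_def)
    then show ?thesis using lines[OF l(1,2)] cnt n BA by simp
  qed
  \<comment> \<open>Six points on no common conic: a side that avoids them satisfies the requirement
    at once.\<close>
  obtain S6 where S6: "S6 \<subseteq> A" "indep (int 2) S6" "Van (int 2) S6 = {0}"
    using indep_extend[of "int 2" "{}" A] fin A by auto
  have cS6: "card S6 = 6" using indep_spanning_card[OF S6(2,3)] pd_small by simp
  have fS6: "finite S6" using S6(2) by (simp add: indep_def)
  define Z' where "Z' = Z - S6"
  have cZ': "card Z \<le> card Z' + 6"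
  proof -
    have "Z \<subseteq> Z' \<union> S6" by (auto simp: Z'_def)
    then have "card Z \<le> card (Z' \<union> S6)" using fZ fS6 by (intro card_mono) (auto simp: Z'_def)
    also have "\<dots> \<le> card Z' + card S6" by (rule card_Un_le)
    finally show ?thesis using cS6 by simp
  qed
  have fZ': "finite Z'" using fZ by (simp add: Z'_def)
  define W where "W b = {z \<in> Z' - {b}. pline A b z \<inter> S6 = {}}" for b
  have fW: "finite (W b)" for b using fZ' by (simp add: W_def)
  have b1Z: "b1 \<notin> Z" using Z(2) by blast
  show thesis
  proof (cases "\<exists>b\<in>Z'. card Z \<le> 4 * card (W b)")
    case True
    then obtain b where b: "b \<in> Z'" "card Z \<le> 4 * card (W b)" by blast
    have bZ: "b \<in> Z" using b by (simp add: Z'_def)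
    show thesis
    proof (rule that[of "(\<lambda>z. {b1, b, z}) ` W b"])
      have "card ((\<lambda>z. {b1, b, z}) ` W b) = card (W b)"
        using fW b1Z bZ by (intro card_insert_image) (auto simp: W_def Z'_def)
      then show "card A \<le> 100000 * card ((\<lambda>z. {b1, b, z}) ` W b)" using b(2) nZ by simp
      fix B assume "B \<in> (\<lambda>z. {b1, b, z}) ` W b"
      then obtain z where z: "z \<in> W b" "B = {b1, b, z}" by blast
      then have zZ: "z \<in> Z" "b \<noteq> z" by (auto simp: W_def Z'_def)
      obtain l where l: "l \<noteq> 0" "tdeg l = 1" "l \<in> Van 1 {b, z}" using line_through[OF zZ(2)] .
      have "S6 \<subseteq> A - zs A l" using z(1) S6(1) pline_zs[OF l(3,1) zZ(2), of A] by (auto simp: W_def)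
      then have "Van (int 2) ({b1, b, z} \<union> (A - zs A l)) \<subseteq> {0}"
        using S6(3) Van_anti[of S6 "{b1, b, z} \<union> (A - zs A l)" "int 2"] by blast
      then have "Van (int 2) ({b1, b, z} \<union> (A - zs A l)) = {0}"
        using zero_Van[of "int 2" "{b1, b, z} \<union> (A - zs A l)"] by blast
      then show "B \<subseteq> A \<and> card A \<le> 1000 * card {T. ordset 2 A T \<and> B \<subseteq> T}"
        unfolding z(2) by (rule main[OF bZ zZ l])
    qed
  next
    case False
    have "Z' \<noteq> {}" using cZ' nZ n by auto
    then obtain b where b: "b \<in> Z'" by blast
    have bZ: "b \<in> Z" "b \<notin> S6" using b by (auto simp: Z'_def)
    have Wb: "4 * card (W b) < card Z" using False b by (meson not_le)
    define V where "V t = {z \<in> Z' - {b}. t \<in> pline A b z}" for t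
    have fV: "finite (V t)" for t using fZ' by (simp add: V_def)
    have "Z' \<subseteq> W b \<union> (\<Union>t\<in>S6. V t) \<union> {b}" by (auto simp: W_def V_def)
    then have "card Z' \<le> card (W b \<union> (\<Union>t\<in>S6. V t) \<union> {b})"
      using fZ' fV fS6 by (intro card_mono) (auto simp: W_def)
    also have "\<dots> \<le> card (W b \<union> (\<Union>t\<in>S6. V t)) + card {b}" by (rule card_Un_le)
    also have "card (W b \<union> (\<Union>t\<in>S6. V t)) \<le> card (W b) + card (\<Union>t\<in>S6. V t)" by (rule card_Un_le)
    also have "card (\<Union>t\<in>S6. V t) \<le> (\<Sum>t\<in>S6. card (V t))" by (rule card_UN_le[OF fS6])
    finally have sum: "card Z' \<le> card (W b) + (\<Sum>t\<in>S6. card (V t)) + 1" by simp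
    \<comment> \<open>Roughly three quarters of \<open>Z\<close> lie on lines from \<open>b\<close>
      through a point of \<open>S6\<close>, so one of the six points accounts for about an eighth;
      the factor 9 absorbs the lower-order terms.\<close>
    have "\<exists>t\<in>S6. card Z \<le> 9 * card (V t)"
    proof (rule ccontr)
      assume "\<not> ?thesis"
      then have "9 * card (V t) \<le> card Z" if "t \<in> S6" for t using that by (meson not_le less_imp_le)
      then have "(\<Sum>t\<in>S6. 9 * card (V t)) \<le> card S6 * card Z"
        using sum_bounded_above[of S6 "\<lambda>t. 9 * card (V t)" "card Z"] by simp
      then have "9 * (\<Sum>t\<in>S6. card (V t)) \<le> 6 * card Z" using cS6 by (simp add: sum_distrib_left)
      then show False using sum cZ' Wb nZ n by linarith
    qed
    then obtain t where t: "t \<in> S6" "card Z \<le> 9 * card (V t)" by blast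
    have tb: "b \<noteq> t" using t bZ by auto
    obtain l where l: "l \<noteq> 0" "tdeg l = 1" "l \<in> Van 1 {b, t}" using line_through[OF tb] .
    have lP: "l \<in> Pol 1" "ev l b = 0" using l(3) by (auto simp: Van_def)
    define X where "X = V t"
    have X: "x \<in> Z" "x \<noteq> b" "ev l x = 0" if "x \<in> X" for x
    proof -
      show x: "x \<in> Z" "x \<noteq> b" using that by (auto simp: X_def V_def Z'_def)
      obtain k where k: "k \<noteq> 0" "tdeg k = 1" "k \<in> Van 1 {b, x}" using line_through[of b x] x(2) by metis
      have "ev k t = 0" using that k(3) by (auto simp: X_def V_def pline_def)
      then have "k \<in> Van 1 {b, t}" using k(3) by (auto simp: Van_def)
      then obtain r where "l = cmul r k" using line_unique[OF tb _ k(1) l(3)] by blast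
      then show "ev l x = 0" using k(3) by (simp add: Van_def)
    qed
    have fX: "finite X" using fV by (simp add: X_def)
    have cX: "card A \<le> 54000 * card X" using t nZ by (simp add: X_def)
    let ?Y = "A - zs A l"
    have Yeq: "?Y = {x \<in> A. ev l x \<noteq> 0}" by (auto simp: zs_def)
    have zer: "card {x \<in> X. ev f x = 0} \<le> 2" if f: "f \<in> Van (int 2) ?Y" "f \<noteq> 0" for f
    proof -
      have "\<not> l dvd f"
      proof
        assume "l dvd f"
        then obtain g where g: "f = l * g" by blast
        have "f \<in> Van (int 2) A" using f(1) g by (auto simp: Van_def zs_def)
        then show False using A f(2) by auto
      qed
      then have "card {x \<in> X. ev f x = 0} \<le> 2 * tdeg l"
        using f(1) X(3) by (intro prime_zeros_le[OF prime_elem_tdeg1[OF l(2,1)] _ _ fX]) (auto simp: Van_def)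
      then show ?thesis using l(2) by simp
    qed
    have cY: "card A \<le> 24 * card ?Y" by (rule lines[OF l(1,2)])
    \<comment> \<open>Three non-collinear points off \<open>l\<close> and one further point off
      \<open>l\<close> impose four independent conditions on the six-dimensional space of
      conics.\<close>
    have v2: "vdim (int 2) ?Y \<le> 2"
    proof -
      obtain S3 where "S3 \<subseteq> {a \<in> A. ev l a \<noteq> 0}" "indep (int 2 - int (tdeg l)) S3"
          "card S3 = pd (int 2 - int (tdeg l))"
        by (rule ex_basis_avoid[OF A l(1) fin indep_empty empty_subsetI])
      then have S3: "S3 \<subseteq> ?Y" "indep 1 S3" "card S3 = 3"
        using pd_small(2) by (simp_all only: Yeq l(2)) simp_all
      have i2: "indep (int 2) S3" by (rule indep_mono[OF S3(2)]) simp
      have "\<not> ?Y \<subseteq> S3"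
      proof
        assume "?Y \<subseteq> S3"
        then have "card ?Y \<le> card S3" using S3(2) by (intro card_mono) (auto simp: indep_def)
        then show False using S3(3) cY n by simp
      qed
      then obtain y where y: "y \<in> ?Y" "y \<notin> S3" by blast
      obtain f where f: "f \<in> Van (int 2) S3" "ev f y \<noteq> 0"
        using indep_step[of "int 2" S3 y] S3(2) y(2) by auto
      have "vdim (int 2) (insert y S3) = 2"
        using vdim_insert_new[OF f] indep_vdim[OF i2] S3(3) pd_small by simp
      moreover have "vdim (int 2) ?Y \<le> vdim (int 2) (insert y S3)" using y S3(1) by (intro vdim_anti) auto
      ultimately show ?thesis by simp
    qed
    have "\<exists>c\<in>X. vdim (int 2) (insert c ?Y) \<le> 1"
    proof (cases "vdim (int 2) ?Y \<le> 1")
      case True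
      have "X \<noteq> {}" using cX n by auto
      then obtain c where "c \<in> X" by blast
      moreover have "vdim (int 2) (insert c ?Y) \<le> vdim (int 2) ?Y" by (rule vdim_anti) auto
      ultimately show ?thesis using True by (meson le_trans)
    next
      case False
      then obtain f where f: "f \<in> Van (int 2) ?Y" "f \<noteq> 0" using vdim_pos[of "int 2" ?Y] by auto
      have "\<not> X \<subseteq> {x \<in> X. ev f x = 0}"
      proof
        assume "X \<subseteq> {x \<in> X. ev f x = 0}"
        then have "card X \<le> card {x \<in> X. ev f x = 0}" using fX by (intro card_mono) auto
        then show False using zer[OF f] cX n by simp
      qed
      then obtain c where "c \<in> X" "ev f c \<noteq> 0" by blast
      then show ?thesis using vdim_insert_new[OF f(1), of c] v2 by auto
    qed
    then obtain c where c: "c \<in> X" "vdim (int 2) (insert c ?Y) \<le> 1" by blast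
    \<comment> \<open>The points \<open>c\<close> and \<open>z\<close> on \<open>l\<close> remove
      what is left: a remaining conic does not contain \<open>l\<close>, so all but at most two
      choices of \<open>z\<close> avoid it.\<close>
    have exQ: "\<exists>Q\<subseteq>X. card Q \<le> 2 \<and> (\<forall>z\<in>X - Q. Van (int 2) (insert z (insert c ?Y)) = {0})"
    proof (cases "vdim (int 2) (insert c ?Y) = 0")
      case True
      then have "Van (int 2) (insert z (insert c ?Y)) = {0}" for z
        using vdim_0_iff[of "int 2" "insert c ?Y"] zero_Van[of "int 2" "insert z (insert c ?Y)"]
        by (metis Van_anti subset_insertI subset_singletonD empty_iff)
      then show ?thesis by (intro exI[of _ "{}"]) auto
    next
      case False
      then have v1: "vdim (int 2) (insert c ?Y) = 1" using c(2) by simp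
      then obtain g where g: "g \<in> Van (int 2) (insert c ?Y)" "g \<noteq> 0" using vdim_pos[of "int 2" "insert c ?Y"] by auto
      have "card {x \<in> X. ev g x = 0} \<le> 2" using g by (intro zer) (auto simp: Van_def)
      moreover have "Van (int 2) (insert z (insert c ?Y)) = {0}" if "z \<in> X - {x \<in> X. ev g x = 0}" for z
        using vdim_insert_new[OF g(1), of z] that v1 vdim_0_iff[of "int 2" "insert z (insert c ?Y)"] by simp
      ultimately show ?thesis by (intro exI[of _ "{x \<in> X. ev g x = 0}"]) auto
    qed
    obtain Q where "Q \<subseteq> X \<and> card Q \<le> 2 \<and> (\<forall>z\<in>X - Q. Van (int 2) (insert z (insert c ?Y)) = {0})"
      using exQ by (rule exE)
    then have Q: "Q \<subseteq> X" "card Q \<le> 2" "z \<in> X - Q \<Longrightarrow> Van (int 2) (insert z (insert c ?Y)) = {0}" for z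
      by simp_all
    define G where "G = X - Q - {c}"
    have "card X \<le> card G + 3"
    proof -
      have "X \<subseteq> G \<union> Q \<union> {c}" by (auto simp: G_def)
      then have "card X \<le> card (G \<union> Q \<union> {c})" using fX finite_subset[OF Q(1) fX] by (intro card_mono) (simp_all add: G_def)
      also have "\<dots> \<le> card (G \<union> Q) + card {c}" by (rule card_Un_le)
      also have "card (G \<union> Q) \<le> card G + card Q" by (rule card_Un_le)
      finally show ?thesis using Q(2) by simp
    qed
    show thesis
    proof (rule that[of "(\<lambda>z. {b1, c, z}) ` G"])
      have "card ((\<lambda>z. {b1, c, z}) ` G) = card G"
      proof (rule card_insert_image)
        show "finite G" using fX by (simp add: G_def)
        show "b1 \<noteq> c" using b1Z X(1)[OF c(1)] by blast
        show "b1 \<notin> G" using b1Z X(1)[of b1] by (auto simp: G_def)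
        show "c \<notin> G" by (simp add: G_def)
      qed
      then show "card A \<le> 100000 * card ((\<lambda>z. {b1, c, z}) ` G)"
        using cX n \<open>card X \<le> card G + 3\<close> by simp
      fix B assume "B \<in> (\<lambda>z. {b1, c, z}) ` G"
      then obtain z where z: "z \<in> X" "z \<notin> Q" "c \<noteq> z" "B = {b1, c, z}" by (auto simp: G_def)
      have lcz: "l \<in> Van 1 {c, z}" using lP X(3) c(1) z(1) by (auto simp: Van_def)
      have "Van (int 2) ({b1, c, z} \<union> ?Y) \<subseteq> Van (int 2) (insert z (insert c ?Y))" by (rule Van_anti) auto
      then have "Van (int 2) ({b1, c, z} \<union> ?Y) = {0}"
        using Q(3)[of z] z zero_Van[of "int 2" "{b1, c, z} \<union> ?Y"] by blast
      then show "B \<subseteq> A \<and> card A \<le> 1000 * card {T. ordset 2 A T \<and> B \<subseteq> T}"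
        unfolding z(4) by (rule main[OF X(1)[OF c(1)] X(1)[OF z(1)] z(3) l(1,2) lcz])
    qed
  qed
qed

text \<open>The threshold 6000 balances the two counts: three vertices with fewer than |A| / 6000
  poor lines each cost \<open>conic_count_low\<close> at most half of what \<open>low_family\<close>
  provides.\<close>

lemma conic_family:
  assumes fin: "finite A" and A: "Van (int 2) A = {0}" and n: "1000000 \<le> card A"
    and lines: "\<And>l. l \<noteq> 0 \<Longrightarrow> tdeg l = 1 \<Longrightarrow> card A \<le> 24 * card (A - zs A l)"
  obtains BB where "\<And>B. B \<in> BB \<Longrightarrow> B \<subseteq> A \<and> card A \<le> 4000 * card {T. ordset 2 A T \<and> B \<subseteq> T}"
    "card A \<le> 100000 * card BB"
proof (cases "\<exists>b\<in>A. card A \<le> 6000 * card (poor A b)")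
  case True
  then obtain b where "b \<in> A" "card A \<le> 6000 * card (poor A b)" by blast
  then obtain BB where BB: "\<And>B. B \<in> BB \<Longrightarrow> B \<subseteq> A \<and> card A \<le> 1000 * card {T. ordset 2 A T \<and> B \<subseteq> T}"
    "card A \<le> 100000 * card BB"
    using high_family[OF fin A n lines] by blast
  show thesis
  proof (rule that[OF _ BB(2)])
    fix B assume "B \<in> BB"
    from BB(1)[OF this] show "B \<subseteq> A \<and> card A \<le> 4000 * card {T. ordset 2 A T \<and> B \<subseteq> T}" by simp
  qed
next
  case False
  then have few: "6000 * card (poor A b) < card A" if "b \<in> A" for b using that by (meson not_le)
  have "1000 \<le> card A" using n by simp
  then obtain BB where BB: "\<And>B. B \<in> BB \<Longrightarrow> tri B \<and> B \<subseteq> A \<and> card A \<le> 100 * card (offs A B)" "card A \<le> 100 * card BB"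
    using low_family[OF fin _ lines] by blast
  show thesis
  proof (rule that[of BB])
    show "card A \<le> 100000 * card BB" using BB(2) by simp
    fix B assume "B \<in> BB"
    then have B: "tri B" "B \<subseteq> A" "card A \<le> 100 * card (offs A B)" using BB(1) by auto
    have "6000 * card (poor A b) \<le> card A" if "b \<in> B" for b
      using few[of b] B(2) that by auto
    then have "(\<Sum>b\<in>B. 6000 * card (poor A b)) \<le> card B * card A"
      using sum_bounded_above[of B "\<lambda>b. 6000 * card (poor A b)" "card A"] by simp
    then have "6000 * (\<Sum>b\<in>B. card (poor A b)) \<le> card B * card A"
      by (simp only: sum_distrib_left)
    then have "6000 * (\<Sum>b\<in>B. card (poor A b)) \<le> 3 * card A" using B(1) by (simp add: tri_def)
    then show "B \<subseteq> A \<and> card A \<le> 4000 * card {T. ordset 2 A T \<and> B \<subseteq> T}"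
      using conic_count_low[OF fin A B(1,2)] B(2,3) n by simp
  qed
qed

section \<open>Counting determined curves\<close>

text \<open>Each of about |A|^(d - 1) base sets contributes |A| / c traces; one factor 2 pays for
  the rounding in \<open>card A div c\<close>.\<close>

lemma count_of_family:
  assumes fin: "finite A" and d: "1 \<le> d" and BB: "\<And>B. B \<in> BB \<Longrightarrow> B \<subseteq> A \<and> card A \<le> c * card {T. ordset d A T \<and> B \<subseteq> T}"
    and many: "card A ^ (d - 1) \<le> C * card BB" and c: "1 \<le> c" "c \<le> card A"
  shows "card A ^ d \<le> 2 * c * C * 2 ^ (3 * d ^ 2 + 4) * card {T. ordset d A T}"
proof -
  define k where "k = card A div c"
  have "k \<le> card {T. ordset d A T \<and> B \<subseteq> T}" if "B \<in> BB" for B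
    using BB[OF that] c(1) unfolding k_def
    by (metis div_le_mono nonzero_mult_div_cancel_left not_one_le_zero)
  then have *: "card BB * k \<le> card {T. ordset d A T} * 2 ^ (3 * d ^ 2 + 4)"
    using BB by (intro ordset_double_count[OF fin]) auto
  have "1 \<le> k" unfolding k_def using c by (simp add: div_greater_zero_iff Suc_le_eq)
  have "card A < c * (k + 1)" unfolding k_def using c(1) dividend_less_times_div[of c "card A"] by simp
  also have "\<dots> \<le> 2 * c * k" using \<open>1 \<le> k\<close> by simp
  finally have n: "card A \<le> 2 * c * k" by simp
  have "card A ^ d = card A ^ (d - 1) * card A" using d by (simp add: power_eq_if)
  also have "\<dots> \<le> (C * card BB) * (2 * c * k)" using many n by (rule mult_le_mono)
  also have "\<dots> = 2 * c * C * (card BB * k)" by simp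
  also have "\<dots> \<le> 2 * c * C * (card {T. ordset d A T} * 2 ^ (3 * d ^ 2 + 4))" using * by (rule mult_le_mono2)
  finally show ?thesis by (simp add: mult_ac)
qed

lemma count_of_near_line:
  assumes d: "1 \<le> d" and fin: "finite A" and A: "Van (int d) A = {0}" and l: "l \<noteq> 0" "tdeg l = 1"
    and near: "2 * d ^ 2 * (card (A - zs A l) + 1) \<le> card (zs A l)"
  shows "card A ^ d \<le> 2 * (2 * d) ^ d * card {T. ordset d A T}"
proof -
  let ?X = "zs A l"
  have d2: "d \<le> d ^ 2" using d by (simp add: power2_eq_square)
  have le: "2 * d ^ 2 + (card (A - ?X)) * 1 \<le> 2 * d ^ 2 * (card (A - ?X) + 1)"
  proof -
    have "card (A - ?X) * 1 \<le> card (A - ?X) * (2 * d ^ 2)" using d d2 by (intro mult_le_mono2) linarith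
    then show ?thesis by (simp add: algebra_simps)
  qed
  have "card X ^ d \<le> 2 * card {T. ordset d A T} * d ^ d" if "X = ?X" for X
    using near le d d2 that by (intro count_near_line[OF d fin A l]) (auto simp: zs_def)
  then have X: "card ?X ^ d \<le> 2 * card {T. ordset d A T} * d ^ d" by blast
  have "card ?X + card (A - ?X) = card A" by (rule card_split[OF fin]) (auto simp: zs_def)
  then have "card A \<le> 2 * card ?X" using near le by linarith
  then have "card A ^ d \<le> (2 * card ?X) ^ d" by (rule power_mono) simp
  also have "\<dots> = 2 ^ d * card ?X ^ d" by (simp add: power_mult_distrib)
  also have "\<dots> \<le> 2 ^ d * (2 * card {T. ordset d A T} * d ^ d)" using X by (rule mult_le_mono2)
  also have "\<dots> = 2 * (2 * d) ^ d * card {T. ordset d A T}" by (simp add: power_mult_distrib)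
  finally show ?thesis .
qed

text \<open>For d = 2 the factor is 24, the constant assumed by the conic families.\<close>

lemma far_from_lines:
  assumes fin: "finite A" and n: "6 * d ^ 2 \<le> card A" and d: "1 \<le> d"
    and far: "\<not> 2 * d ^ 2 * (card (A - zs A l) + 1) \<le> card (zs A l)"
  shows "card A \<le> 6 * d ^ 2 * card (A - zs A l)"
proof -
  let ?r = "card (A - zs A l)"
  have s: "card (zs A l) + ?r = card A" by (rule card_split[OF fin]) (auto simp: zs_def)
  have d2: "1 \<le> d ^ 2" using d by simp
  have "?r \<le> d ^ 2 * ?r" using d2 by simp
  moreover have "card (zs A l) < 2 * (d ^ 2 * ?r) + 2 * d ^ 2" using far by (simp add: algebra_simps)
  ultimately have "card A < 3 * (d ^ 2 * ?r) + 2 * d ^ 2" using s by linarith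
  then have 1: "card A < 3 * d ^ 2 * ?r + 2 * d ^ 2" by (simp only: mult.assoc)
  have "1 \<le> ?r"
  proof (rule ccontr)
    assume "\<not> 1 \<le> ?r"
    then have "?r = 0" by simp
    then show False using 1 n by simp
  qed
  then have "2 * d ^ 2 * 1 \<le> 2 * d ^ 2 * ?r" by (rule mult_le_mono2)
  moreover have "3 * d ^ 2 * ?r + 2 * d ^ 2 * ?r \<le> 6 * d ^ 2 * ?r"
    unfolding distrib_right[symmetric] by (intro mult_le_mono1) simp
  ultimately show ?thesis using 1 by linarith
qed

lemma many_good:
  assumes d: "3 \<le> d"
  shows "\<exists>C n0. \<forall>A. finite A \<and> Van (int d) A = {0} \<and> n0 \<le> card A \<and>
     (\<forall>l. l \<noteq> 0 \<longrightarrow> tdeg l = 1 \<longrightarrow> card A \<le> 6 * d ^ 2 * card (A - zs A l)) \<longrightarrow>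
     card A ^ (d - 1) \<le> C * card {B. B \<subseteq> A \<and> good d B}"
proof -
  define D where "D = pd (int d)"
  define c where "c = 6 * d ^ 2"
  \<comment> \<open>Chosen so that, with \<open>b = card A div E\<close>, the term
    \<open>(d + 1) * 2 ^ D * (d * b)\<close> for non-generic points stays below half of |A| /
    c.\<close>
  define E where "E = 2 * c * ((d + 1) * 2 ^ D * d)"
  define C where "C = (2 * E * D) ^ D + (4 * c * D) ^ D"
  define n0 where "n0 = 2 * E * (D + (d + 1) * 2 ^ D * d ^ 2 + 1) + 4 * c * D + 1"
  have c1: "1 \<le> c" using d by (simp add: c_def)
  have E1: "1 \<le> E" using d c1 by (simp add: E_def Suc_le_eq)
  have "card A ^ (d - 1) \<le> C * card {B. B \<subseteq> A \<and> good d B}"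
    if fin: "finite A" and A: "Van (int d) A = {0}" and n: "n0 \<le> card A"
      and lines: "\<And>l. l \<noteq> 0 \<Longrightarrow> tdeg l = 1 \<Longrightarrow> card A \<le> c * card (A - zs A l)" for A
  proof -
    let ?G = "card {B. B \<subseteq> A \<and> good d B}"
    have n1: "1 \<le> card A" using n by (simp add: n0_def)
    have C1: "card A ^ (d - 1) \<le> C * ?G" if "card A ^ (d - 1) \<le> (2 * E * D) ^ D * ?G"
      using that by (simp add: C_def distrib_right)
    show ?thesis
    proof (cases "\<exists>\<eta>. prime_elem \<eta> \<and> 2 \<le> tdeg \<eta> \<and> tdeg \<eta> \<le> d \<and> heavy E A \<eta>")
      case True
      then obtain \<eta> where \<eta>: "prime_elem \<eta>" "2 \<le> tdeg \<eta>" "tdeg \<eta> \<le> d" "heavy E A \<eta>" by blast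
      have "2 * E * (D + (d + 1) * 2 ^ D * d ^ 2) \<le> card A" using n by (simp add: n0_def)
      then show ?thesis using many_good_prime[OF d fin A \<eta> _ n1] by (intro C1) (simp add: D_def)
    next
      case noprime: False
      show ?thesis
      proof (cases "\<exists>l1 l2. l1 \<noteq> 0 \<and> tdeg l1 = 1 \<and> heavy E A l1 \<and> l2 \<noteq> 0 \<and> tdeg l2 = 1 \<and> heavy E A l2 \<and> \<not> l1 dvd l2 \<and> \<not> l2 dvd l1")
        case True
        then obtain l1 l2 where l: "l1 \<noteq> 0" "tdeg l1 = 1" "heavy E A l1" "l2 \<noteq> 0" "tdeg l2 = 1" "heavy E A l2"
          "\<not> l1 dvd l2" "\<not> l2 dvd l1" by blast
        have "(d + 1) * 2 ^ D * d \<le> (d + 1) * 2 ^ D * d ^ 2" using d by (simp add: power2_eq_square)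
        then have "2 * E * (D + (d + 1) * 2 ^ D * d + 1) \<le> 2 * E * (D + (d + 1) * 2 ^ D * d ^ 2 + 1)" by (intro mult_le_mono2) simp
        moreover have "2 * E * (D + (d + 1) * 2 ^ D * d ^ 2 + 1) \<le> card A" using n unfolding n0_def by linarith
        ultimately have "2 * E * (D + (d + 1) * 2 ^ D * d + 1) \<le> card A" by (rule le_trans)
        then show ?thesis using many_good_lines[OF d fin A l _ n1] by (intro C1) (simp add: D_def)
      next
        case noline: False
        \<comment> \<open>\<open>R\<close> is \<open>A\<close> without its heavy line if there is
          one: a heavy irreducible curve of degree at most \<open>d\<close> is then that line up to
          a constant factor and has no zeros in \<open>R\<close>.\<close>
        have "\<exists>R\<subseteq>A. card A \<le> c * card R \<and> (\<forall>\<eta>. prime_elem \<eta> \<and> tdeg \<eta> \<le> d \<longrightarrow> card {x \<in> R. ev \<eta> x = 0} \<le> card A div E)"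
        proof (cases "\<exists>l. l \<noteq> 0 \<and> tdeg l = 1 \<and> heavy E A l")
          case True
          then obtain l where l: "l \<noteq> 0" "tdeg l = 1" "heavy E A l" by blast
          let ?R = "A - zs A l"
          have "card {x \<in> ?R. ev \<eta> x = 0} \<le> card A div E" if \<eta>: "prime_elem \<eta>" "tdeg \<eta> \<le> d" for \<eta>
          proof (cases "heavy E A \<eta>")
            case hv: True
            have \<eta>0: "\<eta> \<noteq> 0" "\<not> is_unit \<eta>" using \<eta>(1) by (auto simp: prime_elem_def)
            then have t: "tdeg \<eta> = 1" using noprime \<eta> hv tdeg_pos[OF \<eta>0] by force
            have "{x \<in> ?R. ev \<eta> x = 0} = {}"
            proof -
              have "l dvd \<eta> \<or> \<eta> dvd l" using noline l \<eta>0 t hv by blast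
              then have "\<exists>u. l = \<eta> * u \<or> (\<eta> = l * u \<and> is_unit u)"
              proof
                assume "l dvd \<eta>"
                then obtain u where u: "\<eta> = l * u" by blast
                then have "u \<noteq> 0" using \<eta>0 by auto
                then have "tdeg u = 0" using tdeg_mult[OF l(1) \<open>u \<noteq> 0\<close>] u t l(2) by simp
                then show ?thesis using tdeg_0_unit[OF \<open>u \<noteq> 0\<close>] u by blast
              qed (auto elim!: dvdE)
              then show ?thesis using ev_unit by (auto simp: zs_def)
            qed
            then show ?thesis by (simp only: card.empty le0)
          next
            case False
            then have "E * card {x \<in> A. ev \<eta> x = 0} \<le> card A" by (simp add: heavy_def)
            then have "card {x \<in> A. ev \<eta> x = 0} \<le> card A div E" using E1 by (simp add: less_eq_div_iff_mult_less_eq mult.commute)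
            moreover have "card {x \<in> ?R. ev \<eta> x = 0} \<le> card {x \<in> A. ev \<eta> x = 0}" using fin by (intro card_mono) auto
            ultimately show ?thesis by linarith
          qed
          then show ?thesis using lines[OF l(1,2)] by (intro exI[of _ ?R]) auto
        next
          case False
          have "card {x \<in> A. ev \<eta> x = 0} \<le> card A div E" if \<eta>: "prime_elem \<eta>" "tdeg \<eta> \<le> d" for \<eta>
          proof -
            have \<eta>0: "\<eta> \<noteq> 0" "\<not> is_unit \<eta>" using \<eta>(1) by (auto simp: prime_elem_def)
            have "\<not> heavy E A \<eta>"
            proof
              assume hv: "heavy E A \<eta>"
              then have "tdeg \<eta> \<noteq> 1" using False \<eta>0 by blast
              then have "2 \<le> tdeg \<eta>" using tdeg_pos[OF \<eta>0] by simp
              then show False using noprime \<eta> hv by blast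
            qed
            then have "E * card {x \<in> A. ev \<eta> x = 0} \<le> card A" by (simp add: heavy_def)
            then show ?thesis using E1 by (simp add: less_eq_div_iff_mult_less_eq mult.commute)
          qed
          moreover have "card A \<le> c * card A" using c1 by simp
          ultimately show ?thesis by (intro exI[of _ A]) auto
        qed
        then obtain R where "R \<subseteq> A \<and> card A \<le> c * card R \<and>
            (\<forall>\<eta>. prime_elem \<eta> \<and> tdeg \<eta> \<le> d \<longrightarrow> card {x \<in> R. ev \<eta> x = 0} \<le> card A div E)" by (elim exE)
        then have R: "R \<subseteq> A" "card A \<le> c * card R"
          "\<And>\<eta>. prime_elem \<eta> \<Longrightarrow> tdeg \<eta> \<le> d \<Longrightarrow> card {x \<in> R. ev \<eta> x = 0} \<le> card A div E" by simp_all
        define b where "b = card A div E"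
        let ?K = "D + (d + 1) * 2 ^ D * (d * b)"
        \<comment> \<open>Of the 4 |A| guaranteed by \<open>4 * c * card R\<close>, the first term
          costs one |A| and the second two, which leaves one.\<close>
        have "4 * c * ?K = 4 * c * D + 2 * (E * b)" by (simp add: E_def algebra_simps)
        moreover have "E * b \<le> card A" by (simp add: b_def)
        moreover have "4 * c * D \<le> card A" using n by (simp add: n0_def)
        ultimately have "4 * c * ?K \<le> 3 * card A" by linarith
        then have "card A \<le> 4 * c * (card R - ?K)" using R(2) by (simp add: diff_mult_distrib2)
        then have "card A ^ (d - 1) \<le> (4 * c * D) ^ D * ?G"
          using many_good_light[OF d fin R(1,3) _ n1, of "4 * c"] by (simp add: D_def b_def)
        then show ?thesis by (simp add: C_def distrib_right)
      qed
    qed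
  qed
  then show ?thesis
    unfolding c_def by (intro exI[of _ C] exI[of _ n0]) simp
qed

lemma count_main:
  assumes d: "1 \<le> d"
  shows "\<exists>c n0. \<forall>A. finite A \<and> Van (int d) A = {0} \<and> n0 \<le> card A \<longrightarrow> card A ^ d \<le> c * card {T. ordset d A T}"
proof -
  \<comment> \<open>The summand 4 d^2 from \<open>good_count\<close> is at most half of |A| and is
    absorbed by doubling 10.\<close>
  have good_case: "card A \<le> 20 * d ^ 2 * card {T. ordset d A T \<and> B \<subseteq> T}"
    if "finite A" "Van (int d) A = {0}" "8 * d ^ 2 \<le> card A" "B \<subseteq> A" "good d B" for A B
    using good_count[OF that(1,2,4,5)] that(3) by (simp add: algebra_simps)
  have d2: "1 \<le> d ^ 2" using d by simp
  consider "d = 1" | "d = 2" | "3 \<le> d" using d by linarith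
  then show ?thesis
  proof cases
    case 1
    \<comment> \<open>The empty base set alone suffices for d = 1, where a linear number of ordinary
      lines is wanted.\<close>
    have "card A ^ d \<le> 20 * card {T. ordset d A T}" if "finite A \<and> Van (int d) A = {0} \<and> 8 \<le> card A" for A
      using good_case[of A "{}"] good_empty that 1 by simp
    then show ?thesis by blast
  next
    case 2
    define c where "c = 2 * (2 * d) ^ d + 2 * 4000 * 100000 * 2 ^ (3 * d ^ 2 + 4)"
    have "card A ^ d \<le> c * card {T. ordset d A T}"
      if A: "finite A" "Van (int d) A = {0}" "1000000 \<le> card A" for A
    proof (cases "\<exists>l. l \<noteq> 0 \<and> tdeg l = 1 \<and> 2 * d ^ 2 * (card (A - zs A l) + 1) \<le> card (zs A l)")
      case True
      then have "card A ^ d \<le> 2 * (2 * d) ^ d * card {T. ordset d A T}"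
        using count_of_near_line[OF d A(1,2)] by blast
      also have "\<dots> \<le> c * card {T. ordset d A T}" by (intro mult_le_mono1) (simp add: c_def)
      finally show ?thesis .
    next
      case False
      have lines: "card A \<le> 24 * card (A - zs A l)" if "l \<noteq> 0" "tdeg l = 1" for l
        using far_from_lines[OF A(1) _ d, of l] False that A(3) 2 by auto
      obtain BB where BB: "\<And>B. B \<in> BB \<Longrightarrow> B \<subseteq> A \<and> card A \<le> 4000 * card {T. ordset 2 A T \<and> B \<subseteq> T}"
        "card A \<le> 100000 * card BB"
        using conic_family[OF A(1) _ A(3) lines] A(2) 2 by auto
      have "card A ^ d \<le> 2 * 4000 * 100000 * 2 ^ (3 * d ^ 2 + 4) * card {T. ordset d A T}"
        using BB A 2 by (intro count_of_family[OF A(1) d]) auto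
      also have "\<dots> \<le> c * card {T. ordset d A T}" by (intro mult_le_mono1) (simp add: c_def)
      finally show ?thesis .
    qed
    then show ?thesis by blast
  next
    case 3
    obtain C n0 where C: "\<And>A. finite A \<Longrightarrow> Van (int d) A = {0} \<Longrightarrow> n0 \<le> card A \<Longrightarrow>
       (\<And>l. l \<noteq> 0 \<Longrightarrow> tdeg l = 1 \<Longrightarrow> card A \<le> 6 * d ^ 2 * card (A - zs A l)) \<Longrightarrow>
       card A ^ (d - 1) \<le> C * card {B. B \<subseteq> A \<and> good d B}"
    proof -
      obtain C n0 where "\<forall>A. finite A \<and> Van (int d) A = {0} \<and> n0 \<le> card A \<and>
         (\<forall>l. l \<noteq> 0 \<longrightarrow> tdeg l = 1 \<longrightarrow> card A \<le> 6 * d ^ 2 * card (A - zs A l)) \<longrightarrow>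
         card A ^ (d - 1) \<le> C * card {B. B \<subseteq> A \<and> good d B}"
        using many_good[OF 3] by (elim exE)
      then show thesis by (intro that[of n0 C]) simp
    qed
    define c where "c = 2 * (2 * d) ^ d + 2 * (20 * d ^ 2) * C * 2 ^ (3 * d ^ 2 + 4)"
    have "card A ^ d \<le> c * card {T. ordset d A T}"
      if A: "finite A" "Van (int d) A = {0}" "n0 + 20 * d ^ 2 \<le> card A" for A
    proof (cases "\<exists>l. l \<noteq> 0 \<and> tdeg l = 1 \<and> 2 * d ^ 2 * (card (A - zs A l) + 1) \<le> card (zs A l)")
      case True
      then have "card A ^ d \<le> 2 * (2 * d) ^ d * card {T. ordset d A T}"
        using count_of_near_line[OF d A(1,2)] by blast
      also have "\<dots> \<le> c * card {T. ordset d A T}" by (intro mult_le_mono1) (simp add: c_def)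
      finally show ?thesis .
    next
      case False
      have "card A \<le> 6 * d ^ 2 * card (A - zs A l)" if "l \<noteq> 0" "tdeg l = 1" for l
        using False that A(3) by (intro far_from_lines[OF A(1) _ d]) auto
      then have many: "card A ^ (d - 1) \<le> C * card {B. B \<subseteq> A \<and> good d B}"
        using A by (intro C) auto
      have "card A ^ d \<le> 2 * (20 * d ^ 2) * C * 2 ^ (3 * d ^ 2 + 4) * card {T. ordset d A T}"
      proof (rule count_of_family[OF A(1) d _ many])
        show "B \<subseteq> A \<and> card A \<le> 20 * d ^ 2 * card {T. ordset d A T \<and> B \<subseteq> T}" if "B \<in> {B. B \<subseteq> A \<and> good d B}" for B
          using that good_case[OF A(1,2)] A(3) by simp
        show "1 \<le> 20 * d ^ 2" "20 * d ^ 2 \<le> card A" using d2 A(3) by simp_all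
      qed
      also have "\<dots> \<le> c * card {T. ordset d A T}" by (intro mult_le_mono1) (simp add: c_def)
      finally show ?thesis .
    qed
    then show ?thesis by blast
  qed
qed

theorem theorem5:
  "\<forall>d::nat. d > 0 \<longrightarrow>
     (\<exists>c2::real. c2 > 0 \<and> (\<exists>c3::real. c3 > 0 \<and>
       (\<forall>A :: (real \<times> real) set. finite A \<and> real (card A) > c2 \<and>
          \<not> (\<exists>C \<in> curves d. A \<subseteq> C) \<longrightarrow>
          real (card (O_curves d ((3 * real d ^ 2 - 3 * real d + 4) / 2) A))
            \<ge> c3 * real (card A) ^ d)))"
proof (intro allI impI)
  fix d :: nat assume "d > 0"
  then obtain c n0 where c: "\<And>A. finite A \<Longrightarrow> Van (int d) A = {0} \<Longrightarrow> n0 \<le> card A \<Longrightarrow>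
      card A ^ d \<le> c * card {T. ordset d A T}"
    using count_main[of d] by (auto simp: Suc_le_eq)
  \<comment> \<open>Adding 1 keeps the denominator positive even if \<open>c\<close> is 0.\<close>
  have "1 / (real c + 1) * real (card A) ^ d \<le> real (card (O_curves d ((3 * real d ^ 2 - 3 * real d + 4) / 2) A))"
    if A: "finite A" "real (card A) > real n0 + 1" "\<not> (\<exists>C \<in> curves d. A \<subseteq> C)" for A
  proof -
    let ?O = "card (O_curves d ((3 * real d ^ 2 - 3 * real d + 4) / 2) A)"
    have "card A ^ d \<le> c * card {T. ordset d A T}"
      using c[OF A(1) Van_zero_of_no_curve[OF A(3)]] A(2) by simp
    also have "\<dots> \<le> (c + 1) * ?O" using card_ordset_le[OF A(1)] by (intro mult_le_mono) auto
    finally have "real (card A ^ d) \<le> real ((c + 1) * ?O)" by (rule of_nat_mono)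
    then have "real (card A) ^ d \<le> (real c + 1) * real ?O" by (simp add: algebra_simps)
    then show ?thesis by (simp add: divide_le_eq mult.commute)
  qed
  then show "\<exists>c2::real. c2 > 0 \<and> (\<exists>c3::real. c3 > 0 \<and>
       (\<forall>A :: (real \<times> real) set. finite A \<and> real (card A) > c2 \<and>
          \<not> (\<exists>C \<in> curves d. A \<subseteq> C) \<longrightarrow>
          real (card (O_curves d ((3 * real d ^ 2 - 3 * real d + 4) / 2) A))
            \<ge> c3 * real (card A) ^ d))"
    by (intro exI[of _ "real n0 + 1"] exI[of _ "1 / (real c + 1)"] conjI) auto
qed

end
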